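(* Let $\mathcal C$ be a semisimple $k$-linear rigid monoidal category and $n\ge 1$ an integer. Then the $n$-th Frobenius-Schur endomorphism is a natural endomorphism of the identity functor of $\mathcal C$; that is, $f\,\underline{\mathrm{FS}}^{(n)}_V=\underline{\mathrm{FS}}^{(n)}_W\,f$ for every morphism $f\colon V\to W$ in $\mathcal C$.
   Context: Conventions. $k$ is a field. In a monoidal category the associativity isomorphism is $\Phi\colon (U\otimes V)\otimes W\to U\otimes (V\otimes W)$ and the unit object $I$ is strict: $V\otimes I=V=I\otimes V$. An object also denotes its identity morphism. A semisimple $k$-linear monoidal category is an abelian $k$-linear category with finite-dimensional morphism spaces, bilinear tensor product, every object a finite direct sum of simple objects (simple: endomorphism ring equal to $k$), and simple unit object. Rigid means every object has a left dual; a semisimple rigid category then also has right duals. A right dual $X$ of $V$ comes with $\mathrm{ev}\colon V\otimes X\to I$, $\mathrm{db}\colon I\to X\otimes V$ satisfying the usual duality (zig-zag) identities. Put $V^{\otimes 0}=I$, $V^{\otimes(n+1)}=V\otimes V^{\otimes n}$, and let $\Phi^{(n)}\colon V^{\otimes(n-1)}\otimes V\to V^{\otimes n}$ be the canonical associativity isomorphism. A trivial object is one isomorphic to a finite direct sum of copies of $I$. A trivial component of $V$ is a triple $(V^{\mathrm{triv}},\iota,\pi)$ with $V^{\mathrm{triv}}$ trivial, $\iota\colon V^{\mathrm{triv}}\to V$, $\pi\colon V\to V^{\mathrm{triv}}$, $\pi\iota=\mathrm{id}$, such that $\iota$ and $\pi$ are the injection and projection of the $I$-isotypical component in the decomposition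 of $V$ into isotypical components (sums of copies of one simple). There is a unique isomorphism $\tau_{VT}\colon V\otimes T\to T\otimes V$, natural in $V\in\mathcal C$ and in trivial objects $T$, with $\tau_{VI}=\mathrm{id}_V$. Choose a right dual $X$ of $V^{\otimes(n-1)}$ and a trivial component $((V^{\otimes n})^{\mathrm{triv}},\iota,\pi)$. The $n$-th Frobenius-Schur endomorphism $\underline{\mathrm{FS}}^{(n)}_V\colon V\to V$ is the composite $$V\xrightarrow{U}X\otimes(V^{\otimes(n-1)}\otimes V)\xrightarrow{X\otimes\Phi^{(n)}}X\otimes V^{\otimes n}\xrightarrow{X\otimes\pi}X\otimes(V^{\otimes n})^{\mathrm{triv}}\xrightarrow{\tau}(V^{\otimes n})^{\mathrm{triv}}\otimes X\xrightarrow{\iota\otimes X}V^{\otimes n}\otimes X\xrightarrow{C}V,$$ where $U=\Phi(\mathrm{db}\otimes V)$ with $\mathrm{db}\colon I\to X\otimes V^{\otimes(n-1)}$, and $C=(V\otimes\mathrm{ev})\Phi$ with $\mathrm{ev}\colon V^{\otimes(n-1)}\otimes X\to I$. It is independent of the choices. *)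

theory Defs
  imports "HOL-Algebra.Module"
begin

text \<open>
  A linear category with tensor product is given by a set of objects, a \<open>k\<close>-module of morphisms
  \<open>Mor C A B\<close> for each pair of objects, and operations on objects and morphisms. Composition
  \<open>g \<cdot> f\<close> is written in applicative order (first \<open>f\<close>, then \<open>g\<close>). The tensor product is
  \<open>\<boxtimes>\<close> on objects and \<open>\<boxdot>\<close> on morphisms; \<open>asc A B D : (A \<boxtimes> B) \<boxtimes> D \<rightarrow> A \<boxtimes> (B \<boxtimes> D)\<close> is the
  associativity isomorphism. The ring components \<open>mult\<close> and \<open>one\<close> of the record
  \<open>Mor C A B\<close> are irrelevant, as always for HOL-Algebra modules.
\<close>

record ('o, 'm, 'k) lin_tensor_cat =
  Obj :: "'o set"
  Mor :: "'o \<Rightarrow> 'o \<Rightarrow> ('k, 'm) module"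
  idm :: "'o \<Rightarrow> 'm" ("\<one>\<^sub>m\<index>")
  cmp :: "'m \<Rightarrow> 'm \<Rightarrow> 'm" (infixr "\<cdot>\<index>" 65)
  tob :: "'o \<Rightarrow> 'o \<Rightarrow> 'o" (infixr "\<boxtimes>\<index>" 75)
  tmo :: "'m \<Rightarrow> 'm \<Rightarrow> 'm" (infixr "\<boxdot>\<index>" 75)
  unt :: "'o" ("\<I>\<index>")
  asc :: "'o \<Rightarrow> 'o \<Rightarrow> 'o \<Rightarrow> 'm" ("\<Phi>\<index>")

abbreviation hom_set :: "('o, 'm, 'k) lin_tensor_cat \<Rightarrow> 'o \<Rightarrow> 'o \<Rightarrow> 'm set" ("\<H>\<index>")
  where "hom_set C A B \<equiv> carrier (Mor C A B)"


subsection \<open>Notions in a linear category\<close>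

context
  fixes C :: "('o, 'm, 'k) lin_tensor_cat" (structure)
begin

definition inverse_mors :: "'o \<Rightarrow> 'o \<Rightarrow> 'm \<Rightarrow> 'm \<Rightarrow> bool" where
  "inverse_mors A B f g \<longleftrightarrow>
     f \<in> \<H> A B \<and> g \<in> \<H> B A \<and> g \<cdot> f = \<one>\<^sub>m A \<and> f \<cdot> g = \<one>\<^sub>m B"

definition iso_mor :: "'o \<Rightarrow> 'o \<Rightarrow> 'm \<Rightarrow> bool" where
  "iso_mor A B f \<longleftrightarrow> (\<exists>g. inverse_mors A B f g)"

definition inv_mor :: "'o \<Rightarrow> 'o \<Rightarrow> 'm \<Rightarrow> 'm" where
  "inv_mor A B f = (THE g. inverse_mors A B f g)"

definition iso_obj :: "'o \<Rightarrow> 'o \<Rightarrow> bool" where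
  "iso_obj A B \<longleftrightarrow> (\<exists>f. iso_mor A B f)"

definition mono_mor :: "'o \<Rightarrow> 'o \<Rightarrow> 'm \<Rightarrow> bool" where
  "mono_mor A B f \<longleftrightarrow> f \<in> \<H> A B \<and>
     (\<forall>D\<in>Obj C. \<forall>g\<in>\<H> D A. \<forall>h\<in>\<H> D A. f \<cdot> g = f \<cdot> h \<longrightarrow> g = h)"

definition epi_mor :: "'o \<Rightarrow> 'o \<Rightarrow> 'm \<Rightarrow> bool" where
  "epi_mor A B f \<longleftrightarrow> f \<in> \<H> A B \<and>
     (\<forall>D\<in>Obj C. \<forall>g\<in>\<H> B D. \<forall>h\<in>\<H> B D. g \<cdot> f = h \<cdot> f \<longrightarrow> g = h)"

definition zero_obj :: "'o \<Rightarrow> bool" where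
  "zero_obj Z \<longleftrightarrow> Z \<in> Obj C \<and> (\<forall>A\<in>Obj C. (\<exists>!f. f \<in> \<H> A Z) \<and> (\<exists>!f. f \<in> \<H> Z A))"

definition kernel_of :: "'o \<Rightarrow> 'o \<Rightarrow> 'm \<Rightarrow> 'o \<Rightarrow> 'm \<Rightarrow> bool" where
  "kernel_of A B f N m \<longleftrightarrow> f \<in> \<H> A B \<and> m \<in> \<H> N A \<and> f \<cdot> m = \<zero>\<^bsub>Mor C N B\<^esub> \<and>
     (\<forall>D\<in>Obj C. \<forall>g\<in>\<H> D A. f \<cdot> g = \<zero>\<^bsub>Mor C D B\<^esub> \<longrightarrow> (\<exists>!h. h \<in> \<H> D N \<and> m \<cdot> h = g))"

definition cokernel_of :: "'o \<Rightarrow> 'o \<Rightarrow> 'm \<Rightarrow> 'o \<Rightarrow> 'm \<Rightarrow> bool" where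
  "cokernel_of A B f Q q \<longleftrightarrow> f \<in> \<H> A B \<and> q \<in> \<H> B Q \<and> q \<cdot> f = \<zero>\<^bsub>Mor C A Q\<^esub> \<and>
     (\<forall>D\<in>Obj C. \<forall>g\<in>\<H> B D. g \<cdot> f = \<zero>\<^bsub>Mor C A D\<^esub> \<longrightarrow> (\<exists>!h. h \<in> \<H> Q D \<and> h \<cdot> q = g))"

text \<open>
  \<open>A\<close> is the direct sum of the objects \<open>B 0, \<dots>, B (m - 1)\<close> with injections \<open>i j\<close> and
  projections \<open>p j\<close>. For \<open>m = 0\<close> this says that \<open>A\<close> is a zero object.
\<close>

definition direct_sum :: "'o \<Rightarrow> nat \<Rightarrow> (nat \<Rightarrow> 'o) \<Rightarrow> (nat \<Rightarrow> 'm) \<Rightarrow> (nat \<Rightarrow> 'm) \<Rightarrow> bool" where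
  "direct_sum A m B i p \<longleftrightarrow> A \<in> Obj C \<and>
     (\<forall>j<m. B j \<in> Obj C \<and> i j \<in> \<H> (B j) A \<and> p j \<in> \<H> A (B j)) \<and>
     (\<forall>j<m. \<forall>l<m. p j \<cdot> i l = (if j = l then \<one>\<^sub>m (B j) else \<zero>\<^bsub>Mor C (B l) (B j)\<^esub>)) \<and>
     finsum (Mor C A A) (\<lambda>j. i j \<cdot> p j) {..<m} = \<one>\<^sub>m A"

definition simple_obj :: "'o \<Rightarrow> bool" where
  "simple_obj S \<longleftrightarrow> S \<in> Obj C \<and> \<not> zero_obj S \<and>
     (\<forall>A\<in>Obj C. \<forall>f. mono_mor A S f \<longrightarrow> zero_obj A \<or> iso_mor A S f)"

definition isotypical :: "'o \<Rightarrow> 'o \<Rightarrow> bool" where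
  "isotypical S A \<longleftrightarrow> simple_obj S \<and> (\<exists>m i p. direct_sum A m (\<lambda>_. S) i p)"

definition isotypical_decomposition ::
    "'o \<Rightarrow> nat \<Rightarrow> (nat \<Rightarrow> 'o) \<Rightarrow> (nat \<Rightarrow> 'o) \<Rightarrow> (nat \<Rightarrow> 'm) \<Rightarrow> (nat \<Rightarrow> 'm) \<Rightarrow> bool" where
  "isotypical_decomposition V m S A i p \<longleftrightarrow>
     direct_sum V m A i p \<and> (\<forall>j<m. isotypical (S j) (A j)) \<and>
     (\<forall>j<m. \<forall>l<m. j \<noteq> l \<longrightarrow> \<not> iso_obj (S j) (S l))"

end


subsection \<open>Semisimple linear rigid monoidal categories\<close>

locale linear_category = field K
  for K :: "('k, 'a) ring_scheme" and C :: "('o, 'm, 'k) lin_tensor_cat" (structure) +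
  assumes mor_module: "\<lbrakk>A \<in> Obj C; B \<in> Obj C\<rbrakk> \<Longrightarrow> module K (Mor C A B)"
    and mor_disjoint: "\<lbrakk>A \<in> Obj C; B \<in> Obj C; A' \<in> Obj C; B' \<in> Obj C; f \<in> \<H> A B; f \<in> \<H> A' B'\<rbrakk>
          \<Longrightarrow> A = A' \<and> B = B'"
    and id_closed: "A \<in> Obj C \<Longrightarrow> \<one>\<^sub>m A \<in> \<H> A A"
    and cmp_closed: "\<lbrakk>A \<in> Obj C; B \<in> Obj C; D \<in> Obj C; f \<in> \<H> A B; g \<in> \<H> B D\<rbrakk>
          \<Longrightarrow> g \<cdot> f \<in> \<H> A D"
    and cmp_id_left: "\<lbrakk>A \<in> Obj C; B \<in> Obj C; f \<in> \<H> A B\<rbrakk> \<Longrightarrow> \<one>\<^sub>m B \<cdot> f = f"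
    and cmp_id_right: "\<lbrakk>A \<in> Obj C; B \<in> Obj C; f \<in> \<H> A B\<rbrakk> \<Longrightarrow> f \<cdot> \<one>\<^sub>m A = f"
    and cmp_assoc: "\<lbrakk>A \<in> Obj C; B \<in> Obj C; D \<in> Obj C; E \<in> Obj C; f \<in> \<H> A B; g \<in> \<H> B D; h \<in> \<H> D E\<rbrakk>
          \<Longrightarrow> (h \<cdot> g) \<cdot> f = h \<cdot> (g \<cdot> f)"
    and cmp_add_left: "\<lbrakk>A \<in> Obj C; B \<in> Obj C; D \<in> Obj C; f \<in> \<H> A B; g \<in> \<H> B D; g' \<in> \<H> B D\<rbrakk>
          \<Longrightarrow> (g \<oplus>\<^bsub>Mor C B D\<^esub> g') \<cdot> f = (g \<cdot> f) \<oplus>\<^bsub>Mor C A D\<^esub> (g' \<cdot> f)"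
    and cmp_add_right: "\<lbrakk>A \<in> Obj C; B \<in> Obj C; D \<in> Obj C; f \<in> \<H> A B; f' \<in> \<H> A B; g \<in> \<H> B D\<rbrakk>
          \<Longrightarrow> g \<cdot> (f \<oplus>\<^bsub>Mor C A B\<^esub> f') = (g \<cdot> f) \<oplus>\<^bsub>Mor C A D\<^esub> (g \<cdot> f')"
    and cmp_smult_left: "\<lbrakk>A \<in> Obj C; B \<in> Obj C; D \<in> Obj C; f \<in> \<H> A B; g \<in> \<H> B D; c \<in> carrier K\<rbrakk>
          \<Longrightarrow> (c \<odot>\<^bsub>Mor C B D\<^esub> g) \<cdot> f = c \<odot>\<^bsub>Mor C A D\<^esub> (g \<cdot> f)"
    and cmp_smult_right: "\<lbrakk>A \<in> Obj C; B \<in> Obj C; D \<in> Obj C; f \<in> \<H> A B; g \<in> \<H> B D; c \<in> carrier K\<rbrakk>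
          \<Longrightarrow> g \<cdot> (c \<odot>\<^bsub>Mor C A B\<^esub> f) = c \<odot>\<^bsub>Mor C A D\<^esub> (g \<cdot> f)"

locale abelian_linear_category = linear_category +
  assumes ex_zero_obj: "\<exists>Z. zero_obj C Z"
    and ex_direct_sum: "\<lbrakk>A \<in> Obj C; B \<in> Obj C\<rbrakk>
          \<Longrightarrow> \<exists>S i p. direct_sum C S 2 (\<lambda>j. if j = 0 then A else B) i p"
    and ex_kernel: "\<lbrakk>A \<in> Obj C; B \<in> Obj C; f \<in> \<H> A B\<rbrakk> \<Longrightarrow> \<exists>N\<in>Obj C. \<exists>m. kernel_of C A B f N m"
    and ex_cokernel: "\<lbrakk>A \<in> Obj C; B \<in> Obj C; f \<in> \<H> A B\<rbrakk> \<Longrightarrow> \<exists>Q\<in>Obj C. \<exists>q. cokernel_of C A B f Q q"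
    and mono_is_kernel: "\<lbrakk>A \<in> Obj C; B \<in> Obj C; mono_mor C A B f\<rbrakk>
          \<Longrightarrow> \<exists>D\<in>Obj C. \<exists>g. kernel_of C B D g A f"
    and epi_is_cokernel: "\<lbrakk>A \<in> Obj C; B \<in> Obj C; epi_mor C A B f\<rbrakk>
          \<Longrightarrow> \<exists>D\<in>Obj C. \<exists>g. cokernel_of C D A g B f"

text \<open>
  Strictness of the unit object means that both unit isomorphisms are identities. Hence
  tensoring with the unit object is the identity also on morphisms, and the triangle axiom
  becomes \<open>\<Phi> A \<I> B = \<one>\<^sub>m (A \<boxtimes> B)\<close>.
\<close>

locale linear_monoidal_category = linear_category +
  assumes tob_closed: "\<lbrakk>A \<in> Obj C; B \<in> Obj C\<rbrakk> \<Longrightarrow> A \<boxtimes> B \<in> Obj C"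
    and tmo_closed: "\<lbrakk>A \<in> Obj C; B \<in> Obj C; A' \<in> Obj C; B' \<in> Obj C; f \<in> \<H> A B; f' \<in> \<H> A' B'\<rbrakk>
          \<Longrightarrow> f \<boxdot> f' \<in> \<H> (A \<boxtimes> A') (B \<boxtimes> B')"
    and tmo_id: "\<lbrakk>A \<in> Obj C; B \<in> Obj C\<rbrakk> \<Longrightarrow> \<one>\<^sub>m A \<boxdot> \<one>\<^sub>m B = \<one>\<^sub>m (A \<boxtimes> B)"
    and tmo_cmp: "\<lbrakk>A \<in> Obj C; B \<in> Obj C; D \<in> Obj C; A' \<in> Obj C; B' \<in> Obj C; D' \<in> Obj C;
          f \<in> \<H> A B; g \<in> \<H> B D; f' \<in> \<H> A' B'; g' \<in> \<H> B' D'\<rbrakk>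
          \<Longrightarrow> (g \<cdot> f) \<boxdot> (g' \<cdot> f') = (g \<boxdot> g') \<cdot> (f \<boxdot> f')"
    and tmo_add_left: "\<lbrakk>A \<in> Obj C; B \<in> Obj C; A' \<in> Obj C; B' \<in> Obj C;
          f \<in> \<H> A B; g \<in> \<H> A B; h \<in> \<H> A' B'\<rbrakk>
          \<Longrightarrow> (f \<oplus>\<^bsub>Mor C A B\<^esub> g) \<boxdot> h = (f \<boxdot> h) \<oplus>\<^bsub>Mor C (A \<boxtimes> A') (B \<boxtimes> B')\<^esub> (g \<boxdot> h)"
    and tmo_add_right: "\<lbrakk>A \<in> Obj C; B \<in> Obj C; A' \<in> Obj C; B' \<in> Obj C;
          h \<in> \<H> A B; f \<in> \<H> A' B'; g \<in> \<H> A' B'\<rbrakk>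
          \<Longrightarrow> h \<boxdot> (f \<oplus>\<^bsub>Mor C A' B'\<^esub> g) = (h \<boxdot> f) \<oplus>\<^bsub>Mor C (A \<boxtimes> A') (B \<boxtimes> B')\<^esub> (h \<boxdot> g)"
    and tmo_smult_left: "\<lbrakk>A \<in> Obj C; B \<in> Obj C; A' \<in> Obj C; B' \<in> Obj C;
          f \<in> \<H> A B; h \<in> \<H> A' B'; c \<in> carrier K\<rbrakk>
          \<Longrightarrow> (c \<odot>\<^bsub>Mor C A B\<^esub> f) \<boxdot> h = c \<odot>\<^bsub>Mor C (A \<boxtimes> A') (B \<boxtimes> B')\<^esub> (f \<boxdot> h)"
    and tmo_smult_right: "\<lbrakk>A \<in> Obj C; B \<in> Obj C; A' \<in> Obj C; B' \<in> Obj C;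
          h \<in> \<H> A B; f \<in> \<H> A' B'; c \<in> carrier K\<rbrakk>
          \<Longrightarrow> h \<boxdot> (c \<odot>\<^bsub>Mor C A' B'\<^esub> f) = c \<odot>\<^bsub>Mor C (A \<boxtimes> A') (B \<boxtimes> B')\<^esub> (h \<boxdot> f)"
    and unt_closed: "\<I> \<in> Obj C"
    and tob_unt_right: "A \<in> Obj C \<Longrightarrow> A \<boxtimes> \<I> = A"
    and tob_unt_left: "A \<in> Obj C \<Longrightarrow> \<I> \<boxtimes> A = A"
    and tmo_unt_right: "\<lbrakk>A \<in> Obj C; B \<in> Obj C; f \<in> \<H> A B\<rbrakk> \<Longrightarrow> f \<boxdot> \<one>\<^sub>m \<I> = f"
    and tmo_unt_left: "\<lbrakk>A \<in> Obj C; B \<in> Obj C; f \<in> \<H> A B\<rbrakk> \<Longrightarrow> \<one>\<^sub>m \<I> \<boxdot> f = f"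
    and asc_iso: "\<lbrakk>A \<in> Obj C; B \<in> Obj C; D \<in> Obj C\<rbrakk>
          \<Longrightarrow> iso_mor C ((A \<boxtimes> B) \<boxtimes> D) (A \<boxtimes> (B \<boxtimes> D)) (\<Phi> A B D)"
    and asc_natural: "\<lbrakk>A \<in> Obj C; B \<in> Obj C; D \<in> Obj C; A' \<in> Obj C; B' \<in> Obj C; D' \<in> Obj C;
          f \<in> \<H> A A'; g \<in> \<H> B B'; h \<in> \<H> D D'\<rbrakk>
          \<Longrightarrow> \<Phi> A' B' D' \<cdot> ((f \<boxdot> g) \<boxdot> h) = (f \<boxdot> (g \<boxdot> h)) \<cdot> \<Phi> A B D"
    and pentagon: "\<lbrakk>A \<in> Obj C; B \<in> Obj C; D \<in> Obj C; E \<in> Obj C\<rbrakk>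
          \<Longrightarrow> \<Phi> A B (D \<boxtimes> E) \<cdot> \<Phi> (A \<boxtimes> B) D E
              = (\<one>\<^sub>m A \<boxdot> \<Phi> B D E) \<cdot> \<Phi> A (B \<boxtimes> D) E \<cdot> (\<Phi> A B D \<boxdot> \<one>\<^sub>m E)"
    and triangle: "\<lbrakk>A \<in> Obj C; B \<in> Obj C\<rbrakk> \<Longrightarrow> \<Phi> A \<I> B = \<one>\<^sub>m (A \<boxtimes> B)"

text \<open>
  ``Simple: endomorphism ring equal to \<open>k\<close>'' is read as: simple objects are the simple objects of
  the abelian category, and each of them has only scalar endomorphisms. Objects with endomorphism
  ring \<open>k\<close> alone would not do: the indecomposable representations of the quiver \<open>A\<^sub>2\<close> all have
  endomorphism ring \<open>k\<close>.
\<close>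

locale semisimple_monoidal_category = abelian_linear_category + linear_monoidal_category +
  assumes finite_dimensional: "\<lbrakk>A \<in> Obj C; B \<in> Obj C\<rbrakk> \<Longrightarrow>
          \<exists>G. finite G \<and> G \<subseteq> \<H> A B \<and>
            (\<forall>f\<in>\<H> A B. \<exists>c\<in>G \<rightarrow> carrier K.
               f = finsum (Mor C A B) (\<lambda>g. c g \<odot>\<^bsub>Mor C A B\<^esub> g) G)"
    and ex_simple_decomposition: "A \<in> Obj C \<Longrightarrow>
          \<exists>m S i p. (\<forall>j<m. simple_obj C (S j)) \<and> direct_sum C A m S i p"
    and end_simple: "simple_obj C S \<Longrightarrow>
          bij_betw (\<lambda>c. c \<odot>\<^bsub>Mor C S S\<^esub> \<one>\<^sub>m S) (carrier K) (\<H> S S)"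
    and simple_unt: "simple_obj C \<I>"

context
  fixes C :: "('o, 'm, 'k) lin_tensor_cat" (structure)
begin

definition left_dual :: "'o \<Rightarrow> 'o \<Rightarrow> 'm \<Rightarrow> 'm \<Rightarrow> bool" where
  "left_dual V X ev db \<longleftrightarrow> V \<in> Obj C \<and> X \<in> Obj C \<and>
     ev \<in> \<H> (X \<boxtimes> V) \<I> \<and> db \<in> \<H> \<I> (V \<boxtimes> X) \<and>
     (\<one>\<^sub>m V \<boxdot> ev) \<cdot> \<Phi> V X V \<cdot> (db \<boxdot> \<one>\<^sub>m V) = \<one>\<^sub>m V \<and>
     (ev \<boxdot> \<one>\<^sub>m X) \<cdot> inv_mor C ((X \<boxtimes> V) \<boxtimes> X) (X \<boxtimes> (V \<boxtimes> X)) (\<Phi> X V X) \<cdot> (\<one>\<^sub>m X \<boxdot> db) = \<one>\<^sub>m X"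

text \<open>
  A right dual \<open>X\<close> of \<open>V\<close>, with \<open>ev : V \<boxtimes> X \<rightarrow> \<I>\<close> and \<open>db : \<I> \<rightarrow> X \<boxtimes> V\<close>, is the same as a
  presentation of \<open>V\<close> as a left dual of \<open>X\<close>.
\<close>

definition right_dual :: "'o \<Rightarrow> 'o \<Rightarrow> 'm \<Rightarrow> 'm \<Rightarrow> bool" where
  "right_dual V X ev db \<longleftrightarrow> left_dual X V ev db"

end

locale semisimple_rigid_monoidal_category = semisimple_monoidal_category +
  assumes rigid: "V \<in> Obj C \<Longrightarrow> \<exists>X ev db. left_dual C V X ev db"


subsection \<open>Frobenius--Schur endomorphisms\<close>

context
  fixes C :: "('o, 'm, 'k) lin_tensor_cat" (structure)
begin

primrec tpow :: "'o \<Rightarrow> nat \<Rightarrow> 'o" where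
  "tpow V 0 = \<I>"
| "tpow V (Suc n) = V \<boxtimes> tpow V n"

text \<open>
  The index is shifted: \<open>asc_pow V (n - 1) : tpow V (n - 1) \<boxtimes> V \<rightarrow> tpow V n\<close> is the canonical
  associativity isomorphism usually indexed by \<open>n \<ge> 1\<close>. Source and target of \<open>asc_pow V 0\<close>
  are both \<open>V\<close>, because the unit object is strict.
\<close>

primrec asc_pow :: "'o \<Rightarrow> nat \<Rightarrow> 'm" where
  "asc_pow V 0 = \<one>\<^sub>m V"
| "asc_pow V (Suc n) = (\<one>\<^sub>m V \<boxdot> asc_pow V n) \<cdot> \<Phi> V (tpow V n) V"

definition trivial_obj :: "'o \<Rightarrow> bool" where
  "trivial_obj T \<longleftrightarrow> (\<exists>m i p. direct_sum C T m (\<lambda>_. \<I>) i p)"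

definition trivial_component :: "'o \<Rightarrow> 'o \<Rightarrow> 'm \<Rightarrow> 'm \<Rightarrow> bool" where
  "trivial_component V T \<iota> \<pi> \<longleftrightarrow> trivial_obj T \<and> \<iota> \<in> \<H> T V \<and> \<pi> \<in> \<H> V T \<and> \<pi> \<cdot> \<iota> = \<one>\<^sub>m T \<and>
     (\<exists>m S A i p. isotypical_decomposition C V m S A i p \<and>
        (\<exists>j<m. S j = \<I> \<and> A j = T \<and> i j = \<iota> \<and> p j = \<pi>))"

definition trivial_flip :: "('o \<Rightarrow> 'o \<Rightarrow> 'm) \<Rightarrow> bool" where
  "trivial_flip t \<longleftrightarrow>
     (\<forall>V\<in>Obj C. \<forall>T. trivial_obj T \<longrightarrow> iso_mor C (V \<boxtimes> T) (T \<boxtimes> V) (t V T)) \<and>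
     (\<forall>V\<in>Obj C. \<forall>W\<in>Obj C. \<forall>T T'. trivial_obj T \<longrightarrow> trivial_obj T' \<longrightarrow>
        (\<forall>f\<in>\<H> V W. \<forall>g\<in>\<H> T T'. (g \<boxdot> f) \<cdot> t V T = t W T' \<cdot> (f \<boxdot> g))) \<and>
     (\<forall>V\<in>Obj C. t V \<I> = \<one>\<^sub>m V)"

text \<open>There is exactly one flip on the pairs \<open>(V, T)\<close> with \<open>T\<close> trivial; \<open>\<tau>\<close> is irrelevant elsewhere.\<close>

definition tau :: "'o \<Rightarrow> 'o \<Rightarrow> 'm" ("\<tau>") where
  "\<tau> V T = (THE h. \<exists>t. trivial_flip t \<and> h = t V T)"

text \<open>
  Right duals and trivial components are only determined up to isomorphism, so the endomorphism
  \<open>FS n V\<close>, for \<open>n \<ge> 1\<close>, takes them as arguments; \<open>FS_choice\<close> lists the admissible ones.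
\<close>

definition FS_choice :: "nat \<Rightarrow> 'o \<Rightarrow> 'o \<Rightarrow> 'm \<Rightarrow> 'm \<Rightarrow> 'o \<Rightarrow> 'm \<Rightarrow> 'm \<Rightarrow> bool" where
  "FS_choice n V X ev db T \<iota> \<pi> \<longleftrightarrow>
     right_dual C (tpow V (n - 1)) X ev db \<and> trivial_component (tpow V n) T \<iota> \<pi>"

definition FS :: "nat \<Rightarrow> 'o \<Rightarrow> 'o \<Rightarrow> 'm \<Rightarrow> 'm \<Rightarrow> 'o \<Rightarrow> 'm \<Rightarrow> 'm \<Rightarrow> 'm" where
  "FS n V X ev db T \<iota> \<pi> =
     (let P = tpow V (n - 1);
          u = \<Phi> X P V \<cdot> (db \<boxdot> \<one>\<^sub>m V);
          c = (\<one>\<^sub>m V \<boxdot> ev) \<cdot> \<Phi> V P X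
      in c \<cdot> (\<iota> \<boxdot> \<one>\<^sub>m X) \<cdot> \<tau> X T \<cdot> (\<one>\<^sub>m X \<boxdot> \<pi>) \<cdot> (\<one>\<^sub>m X \<boxdot> asc_pow V (n - 1)) \<cdot> u)"

end

end

theory Submission
  imports Defs
begin

text \<open>
  For objects \<open>X\<close> and \<open>A\<close> let \<open>\<sigma> X A : X \<boxtimes> A \<rightarrow> A \<boxtimes> X\<close> project \<open>A\<close> to its trivial part, flip it past
  \<open>X\<close>, and include it again. In coordinates \<open>\<sigma> X A = \<Sum>j. (a j \<boxdot> X) (X \<boxdot> b j)\<close>, where the
  \<open>a j : \<I> \<rightarrow> A\<close> and \<open>b j : A \<rightarrow> \<I>\<close> are dual bases of the trivial part. This sum does not depend
  on the bases, is natural in \<open>X\<close> and in \<open>A\<close>, and equals the composite of \<open>\<pi>\<close>, \<open>\<tau>\<close> and \<open>\<iota>\<close> for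
  every trivial component (\<open>trivial_component_partial_flip\<close>).

  If \<open>P\<close> has a right dual \<open>X\<close>, a morphism \<open>h : P \<boxtimes> V \<rightarrow> W \<boxtimes> P\<close> has a trace
  \<open>\<Theta> h : V \<rightarrow> W\<close>, which closes the two occurrences of \<open>P\<close> by \<open>db\<close> and \<open>ev\<close> and uses \<open>\<sigma>\<close> to
  move \<open>X\<close> from the left to the right. The endomorphism \<open>FS\<close> is the trace of the
  associativity isomorphism \<open>\<phi> : V\<^sup>m \<boxtimes> V \<rightarrow> V \<boxtimes> V\<^sup>m\<close>, where \<open>m = n - 1\<close>
  (\<open>FS_eq_flip_trace\<close>). A morphism \<open>f : V \<rightarrow> W\<close> applied to the output or to the input can be
  absorbed into \<open>h\<close>. Moreover the trace is cyclic:
  \<open>\<Theta> (h (g \<boxdot> V)) = \<Theta> ((W \<boxdot> g) h)\<close> for \<open>g : P \<rightarrow> P'\<close> and \<open>h : P' \<boxtimes> V \<rightarrow> W \<boxtimes> P\<close>, because \<open>g\<close>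
  can be replaced by its transpose \<open>X' \<rightarrow> X\<close> at \<open>db\<close> and at \<open>ev\<close>, and \<open>\<sigma>\<close> is natural
  (\<open>flip_trace_slide\<close>).

  Now \<open>f\<close> applied after \<open>FS\<close> sits on the first tensor factor of the target of \<open>\<phi>\<close>. As
  \<open>\<phi>\<close> only rebrackets, \<open>f\<close> may be applied to the first factor of the source
  instead. That factor belongs to \<open>P\<close>, and cyclicity carries \<open>f\<close> to the second factor of the
  target. After \<open>m\<close> such turns \<open>f\<close> reaches the last factor of the source, which is the
  input of \<open>FS\<close> (\<open>flip_trace_word_chain\<close>). Meanwhile the traced object runs through the
  words \<open>W\<^sup>k V\<^sup>m\<^sup>-\<^sup>k\<close>, so all of them must have right duals.

  Right duals exist by semisimplicity (\<open>ex_right_dual\<close>). For a simple object \<open>S\<close> with left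
  dual \<open>Y\<close>, the coevaluation \<open>\<I> \<rightarrow> S \<boxtimes> Y\<close> splits. The splitting \<open>S \<boxtimes> Y \<rightarrow> \<I>\<close> corresponds to a
  nonzero morphism from \<open>S\<close> to the left dual \<open>Z\<close> of \<open>Y\<close>. It is an isomorphism, because \<open>Z\<close>
  inherits from \<open>S\<close> that all endomorphisms are scalars. Hence \<open>S\<close> itself is a left dual of \<open>Y\<close>.
  A direct sum of right duals is a right dual of the direct sum.
\<close>


section \<open>Morphisms and finite sums in a linear category\<close>

context linear_category
begin

text \<open>
  Morphism sets of different pairs of objects are disjoint, so source and target are functions of
  the morphism. Writing all typing conditions as equations between sources and targets
  lets the simplifier decide whether a composite is defined; membership in a morphism set is
  rewritten to this form by \<open>hom_iff\<close>.
\<close>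

definition arr :: "'m \<Rightarrow> bool" where
  "arr f \<longleftrightarrow> (\<exists>A\<in>Obj C. \<exists>B\<in>Obj C. f \<in> \<H> A B)"

definition src :: "'m \<Rightarrow> 'o" where
  "src f = (THE A. A \<in> Obj C \<and> (\<exists>B\<in>Obj C. f \<in> \<H> A B))"

definition tgt :: "'m \<Rightarrow> 'o" where
  "tgt f = (THE B. B \<in> Obj C \<and> (\<exists>A\<in>Obj C. f \<in> \<H> A B))"

abbreviation mor_in :: "'m \<Rightarrow> 'o \<Rightarrow> 'o \<Rightarrow> bool" ("\<guillemotleft>_ : _ \<rightarrow> _\<guillemotright>") where
  "\<guillemotleft>f : A \<rightarrow> B\<guillemotright> \<equiv> arr f \<and> src f = A \<and> tgt f = B \<and> A \<in> Obj C \<and> B \<in> Obj C"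

lemma hom_iff [simp]:
  assumes "A \<in> Obj C" "B \<in> Obj C"
  shows "f \<in> \<H> A B \<longleftrightarrow> arr f \<and> src f = A \<and> tgt f = B"
proof -
  have 1: "arr f \<and> src f = A \<and> tgt f = B" if "A \<in> Obj C" "B \<in> Obj C" "f \<in> \<H> A B" for A B
    using that unfolding arr_def src_def tgt_def
    by (auto intro!: the_equality dest: mor_disjoint)
  show ?thesis
    using 1 assms unfolding arr_def by metis
qed

lemma arr_obj [simp]:
  assumes "arr f"
  shows "src f \<in> Obj C" "tgt f \<in> Obj C"
  using assms hom_iff unfolding arr_def by metis+

lemma arr_id [simp]:
  assumes "A \<in> Obj C"
  shows "arr (\<one>\<^sub>m A)" "src (\<one>\<^sub>m A) = A" "tgt (\<one>\<^sub>m A) = A"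
  using id_closed[OF assms] assms by auto

lemma arr_cmp [simp]:
  assumes "arr g" "arr f" "src g = tgt f"
  shows "arr (g \<cdot> f)" "src (g \<cdot> f) = src f" "tgt (g \<cdot> f) = tgt g"
  using cmp_closed[of "src f" "tgt f" "tgt g" f g] assms by auto

lemma cmp_one [simp]:
  assumes "arr f"
  shows "src f = A \<Longrightarrow> f \<cdot> \<one>\<^sub>m A = f" "tgt f = B \<Longrightarrow> \<one>\<^sub>m B \<cdot> f = f"
  using cmp_id_left[of "src f" "tgt f"] cmp_id_right[of "src f" "tgt f"] assms by auto

lemma cmp_assoc' [simp]:
  assumes "arr h" "arr g" "arr f" "src h = tgt g" "src g = tgt f"
  shows "(h \<cdot> g) \<cdot> f = h \<cdot> (g \<cdot> f)"
  using cmp_assoc[of "src f" "tgt f" "tgt g" "tgt h" f g h] assms by auto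

text \<open>
  Composites are kept nested to the right, so that an equation for \<open>g \<cdot> f\<close> does not match inside a
  longer composite; this is its extended form.
\<close>

lemma cmp_extend:
  assumes "g \<cdot> f = h" "arr g" "arr f" "arr k" "src g = tgt f" "src f = tgt k"
  shows "g \<cdot> f \<cdot> k = h \<cdot> k"
  using assms cmp_assoc'[of g f k] by simp

lemma mor_abelian_group:
  assumes "A \<in> Obj C" "B \<in> Obj C"
  shows "abelian_group (Mor C A B)"
  using mor_module[OF assms] by (simp add: module_def)

lemma mor_abelian_monoid:
  assumes "A \<in> Obj C" "B \<in> Obj C"
  shows "abelian_monoid (Mor C A B)"
  using mor_abelian_group[OF assms] by (simp add: abelian_group_def)

lemma zero_mor [simp]:
  assumes "A \<in> Obj C" "B \<in> Obj C"
  shows "arr \<zero>\<^bsub>Mor C A B\<^esub>" "src \<zero>\<^bsub>Mor C A B\<^esub> = A" "tgt \<zero>\<^bsub>Mor C A B\<^esub> = B"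
  using abelian_monoid.zero_closed[OF mor_abelian_monoid[OF assms]] assms by auto

lemma smult_mor [simp]:
  assumes "c \<in> carrier K" "arr f" "src f = A" "tgt f = B"
  shows "arr (c \<odot>\<^bsub>Mor C A B\<^esub> f)" "src (c \<odot>\<^bsub>Mor C A B\<^esub> f) = A" "tgt (c \<odot>\<^bsub>Mor C A B\<^esub> f) = B"
  using module.smult_closed[OF mor_module, of A B c f] assms by auto

lemma finsum_mor [simp]:
  assumes "\<And>j. j \<in> J \<Longrightarrow> \<guillemotleft>f j : A \<rightarrow> B\<guillemotright>" "A \<in> Obj C" "B \<in> Obj C"
  shows "arr (finsum (Mor C A B) f J)" "src (finsum (Mor C A B) f J) = A"
    "tgt (finsum (Mor C A B) f J) = B"
  using abelian_monoid.finsum_closed[OF mor_abelian_monoid, of A B f J] assms by (auto simp: Pi_iff)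

lemma mor_finsum_cong:
  assumes "\<And>j. j \<in> J \<Longrightarrow> f j = g j" "\<And>j. j \<in> J \<Longrightarrow> \<guillemotleft>g j : A \<rightarrow> B\<guillemotright>" "A \<in> Obj C" "B \<in> Obj C"
  shows "finsum (Mor C A B) f J = finsum (Mor C A B) g J"
  using assms by (intro abelian_monoid.finsum_cong'[OF mor_abelian_monoid]) (auto simp: Pi_iff)

lemma additive_zero:
  assumes "A \<in> Obj C" "B \<in> Obj C" "A' \<in> Obj C" "B' \<in> Obj C"
    and "\<And>f. \<guillemotleft>f : A \<rightarrow> B\<guillemotright> \<Longrightarrow> \<guillemotleft>h f : A' \<rightarrow> B'\<guillemotright>"
    and "\<And>f g. \<guillemotleft>f : A \<rightarrow> B\<guillemotright> \<Longrightarrow> \<guillemotleft>g : A \<rightarrow> B\<guillemotright> \<Longrightarrow>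
           h (f \<oplus>\<^bsub>Mor C A B\<^esub> g) = h f \<oplus>\<^bsub>Mor C A' B'\<^esub> h g"
  shows "h \<zero>\<^bsub>Mor C A B\<^esub> = \<zero>\<^bsub>Mor C A' B'\<^esub>"
proof -
  interpret M: abelian_group "Mor C A B" by (rule mor_abelian_group) fact+
  interpret N: abelian_group "Mor C A' B'" by (rule mor_abelian_group) fact+
  have c: "h \<zero>\<^bsub>Mor C A B\<^esub> \<in> carrier (Mor C A' B')" using assms by simp
  have "h \<zero>\<^bsub>Mor C A B\<^esub> \<oplus>\<^bsub>Mor C A' B'\<^esub> h \<zero>\<^bsub>Mor C A B\<^esub> = h \<zero>\<^bsub>Mor C A B\<^esub>"
    using assms(6)[of "\<zero>\<^bsub>Mor C A B\<^esub>" "\<zero>\<^bsub>Mor C A B\<^esub>"] assms M.r_zero[OF M.zero_closed] by simp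
  then show ?thesis using N.add.l_cancel_one[OF c c] by simp
qed

text \<open>
  Composition and tensor product are biadditive; this lemma gives their distributivity over
  finite sums, in either argument, from one induction. Infinite index sets do no harm: there
  both sums are zero.
\<close>

lemma additive_finsum:
  assumes "A \<in> Obj C" "B \<in> Obj C" "A' \<in> Obj C" "B' \<in> Obj C"
    and "\<And>f. \<guillemotleft>f : A \<rightarrow> B\<guillemotright> \<Longrightarrow> \<guillemotleft>h f : A' \<rightarrow> B'\<guillemotright>"
    and "\<And>f g. \<guillemotleft>f : A \<rightarrow> B\<guillemotright> \<Longrightarrow> \<guillemotleft>g : A \<rightarrow> B\<guillemotright> \<Longrightarrow>
           h (f \<oplus>\<^bsub>Mor C A B\<^esub> g) = h f \<oplus>\<^bsub>Mor C A' B'\<^esub> h g"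
    and "\<And>j. j \<in> J \<Longrightarrow> \<guillemotleft>f j : A \<rightarrow> B\<guillemotright>"
  shows "h (finsum (Mor C A B) f J) = finsum (Mor C A' B') (\<lambda>j. h (f j)) J"
proof -
  interpret M: abelian_group "Mor C A B" by (rule mor_abelian_group) fact+
  interpret N: abelian_group "Mor C A' B'" by (rule mor_abelian_group) fact+
  have z: "h \<zero>\<^bsub>Mor C A B\<^esub> = \<zero>\<^bsub>Mor C A' B'\<^esub>" by (rule additive_zero) fact+
  show ?thesis
  proof (cases "finite J")
    case True
    then show ?thesis
      using assms(7)
    proof induction
      case empty
      then show ?case using z by simp
    next
      case (insert j J)
      have "h (finsum (Mor C A B) f (insert j J)) = h (f j \<oplus>\<^bsub>Mor C A B\<^esub> finsum (Mor C A B) f J)"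
        using insert assms(1-2) by (subst M.finsum_insert) (auto simp: Pi_iff)
      also have "\<dots> = h (f j) \<oplus>\<^bsub>Mor C A' B'\<^esub> h (finsum (Mor C A B) f J)"
        using insert assms(1-2) by (intro assms(6)) auto
      also have "\<dots> = finsum (Mor C A' B') (\<lambda>j. h (f j)) (insert j J)"
        using insert assms(1-5) by (subst N.finsum_insert) (auto simp: Pi_iff)
      finally show ?case .
    qed
  qed (use z in \<open>simp add: M.finsum_infinite N.finsum_infinite\<close>)
qed

lemma cmp_finsum_left:
  assumes "\<And>j. j \<in> J \<Longrightarrow> \<guillemotleft>f j : A \<rightarrow> B\<guillemotright>" "\<guillemotleft>g : B \<rightarrow> D\<guillemotright>" "A \<in> Obj C"
  shows "g \<cdot> finsum (Mor C A B) f J = finsum (Mor C A D) (\<lambda>j. g \<cdot> f j) J"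
  using assms by (intro additive_finsum cmp_add_right) auto

lemma cmp_finsum_right:
  assumes "\<And>j. j \<in> J \<Longrightarrow> \<guillemotleft>f j : B \<rightarrow> D\<guillemotright>" "\<guillemotleft>g : A \<rightarrow> B\<guillemotright>" "D \<in> Obj C"
  shows "finsum (Mor C B D) f J \<cdot> g = finsum (Mor C A D) (\<lambda>j. f j \<cdot> g) J"
  using assms by (intro additive_finsum[where h = "\<lambda>f. f \<cdot> g"] cmp_add_left) auto

lemma cmp_zero_left [simp]:
  assumes "arr f" "tgt f = B" "D \<in> Obj C"
  shows "\<zero>\<^bsub>Mor C B D\<^esub> \<cdot> f = \<zero>\<^bsub>Mor C (src f) D\<^esub>"
  using assms by (intro additive_zero[where h = "\<lambda>g. g \<cdot> f"] cmp_add_left) auto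

lemma cmp_zero_right [simp]:
  assumes "arr f" "src f = B" "D \<in> Obj C"
  shows "f \<cdot> \<zero>\<^bsub>Mor C D B\<^esub> = \<zero>\<^bsub>Mor C D (tgt f)\<^esub>"
  using assms by (intro additive_zero[where h = "\<lambda>g. f \<cdot> g"] cmp_add_right) auto

lemma finsum_single:
  assumes "finite J" "j \<in> J" "\<guillemotleft>f j : A \<rightarrow> B\<guillemotright>" "\<And>l. l \<in> J \<Longrightarrow> l \<noteq> j \<Longrightarrow> f l = \<zero>\<^bsub>Mor C A B\<^esub>"
  shows "finsum (Mor C A B) f J = f j"
proof -
  interpret M: abelian_group "Mor C A B" using assms by (intro mor_abelian_group) auto
  have "finsum (Mor C A B) f J = finsum (Mor C A B) (\<lambda>l. if j = l then f j else \<zero>\<^bsub>Mor C A B\<^esub>) J"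
    using assms by (intro mor_finsum_cong) auto
  also have "\<dots> = f j"
    using assms by (intro M.finsum_singleton[of j J "\<lambda>_. f j"]) (auto simp: Pi_iff)
  finally show ?thesis .
qed

lemma finsum_restrict:
  assumes "finite J" "I \<subseteq> J" "\<And>j. j \<in> I \<Longrightarrow> \<guillemotleft>f j : A \<rightarrow> B\<guillemotright>" "A \<in> Obj C" "B \<in> Obj C"
    "\<And>l. l \<in> J - I \<Longrightarrow> f l = \<zero>\<^bsub>Mor C A B\<^esub>"
  shows "finsum (Mor C A B) f J = finsum (Mor C A B) f I"
proof -
  interpret M: abelian_group "Mor C A B" using assms by (intro mor_abelian_group) auto
  have "finite (J - I)" using assms(1) by blast
  then have "finsum (Mor C A B) f (I \<union> (J - I)) = finsum (Mor C A B) f I \<oplus>\<^bsub>Mor C A B\<^esub> finsum (Mor C A B) f (J - I)"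
    using assms by (intro M.finsum_Un_disjoint) (auto simp: Pi_iff finite_subset)
  moreover have "finsum (Mor C A B) f (J - I) = \<zero>\<^bsub>Mor C A B\<^esub>"
    using assms(6) by (intro M.add.finprod_one_eqI) auto
  moreover have "I \<union> (J - I) = J" using assms(2) by blast
  ultimately show ?thesis using assms by simp
qed

lemma finsum_swap:
  assumes "finite J" "finite L" "\<And>j l. j \<in> J \<Longrightarrow> l \<in> L \<Longrightarrow> \<guillemotleft>f j l : A \<rightarrow> B\<guillemotright>" "A \<in> Obj C" "B \<in> Obj C"
  shows "finsum (Mor C A B) (\<lambda>j. finsum (Mor C A B) (f j) L) J =
         finsum (Mor C A B) (\<lambda>l. finsum (Mor C A B) (\<lambda>j. f j l) J) L"
  using assms(1,3)
proof induction
  interpret M: abelian_group "Mor C A B" using assms by (intro mor_abelian_group) auto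
  {
    case empty
    then show ?case using assms(2) by (simp add: M.finsum_zero)
  next
    case (insert i J)
    have "finsum (Mor C A B) (\<lambda>l. finsum (Mor C A B) (\<lambda>j. f j l) (insert i J)) L
        = finsum (Mor C A B) (\<lambda>l. f i l \<oplus>\<^bsub>Mor C A B\<^esub> finsum (Mor C A B) (\<lambda>j. f j l) J) L"
      using insert assms(4,5) by (intro M.finsum_cong' M.finsum_insert) (auto simp: Pi_iff simp del: hom_iff simp: hom_iff[symmetric])
    then show ?case
      using insert assms(2,4,5) by (simp add: M.finsum_addf Pi_iff)
  }
qed

lemma inverse_mors_iff [simp]:
  assumes "A \<in> Obj C" "B \<in> Obj C"
  shows "inverse_mors C A B f g \<longleftrightarrow>
    arr f \<and> src f = A \<and> tgt f = B \<and> arr g \<and> src g = B \<and> tgt g = A \<and> g \<cdot> f = \<one>\<^sub>m A \<and> f \<cdot> g = \<one>\<^sub>m B"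
  using assms unfolding inverse_mors_def by auto

lemma inv_mor:
  assumes "iso_mor C A B f" "A \<in> Obj C" "B \<in> Obj C"
  shows "inverse_mors C A B f (inv_mor C A B f)"
proof -
  obtain g where g: "inverse_mors C A B f g" using assms unfolding iso_mor_def by blast
  have "h = g" if "inverse_mors C A B f h" for h
  proof -
    have "h = h \<cdot> f \<cdot> g" using that g assms by simp
    also have "\<dots> = (h \<cdot> f) \<cdot> g" using that g assms(2,3) by (subst cmp_assoc') auto
    also have "\<dots> = g" using that g assms(2,3) by simp
    finally show ?thesis .
  qed
  then show ?thesis unfolding inv_mor_def using g by (metis theI)
qed

end


section \<open>Coherence and transposition in a monoidal category\<close>

context linear_monoidal_category
begin

lemmas tob_obj [simp] = tob_closed
lemmas unt_obj [simp] = unt_closed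
lemmas tob_unt [simp] = tob_unt_right tob_unt_left
lemmas tmo_one [simp] = tmo_id

lemma arr_tmo [simp]:
  assumes "arr f" "arr g"
  shows "arr (f \<boxdot> g)" "src (f \<boxdot> g) = src f \<boxtimes> src g" "tgt (f \<boxdot> g) = tgt f \<boxtimes> tgt g"
  using tmo_closed[of "src f" "tgt f" "src g" "tgt g" f g] assms by auto

lemma tmo_unt [simp]:
  assumes "arr f"
  shows "f \<boxdot> \<one>\<^sub>m \<I> = f" "\<one>\<^sub>m \<I> \<boxdot> f = f"
  using tmo_unt_right[of "src f" "tgt f" f] tmo_unt_left[of "src f" "tgt f" f] assms by auto

lemma interchange [simp]:
  assumes "arr f" "arr g" "arr f'" "arr g'" "src g = tgt f" "src g' = tgt f'"
  shows "(g \<boxdot> g') \<cdot> (f \<boxdot> f') = (g \<cdot> f) \<boxdot> (g' \<cdot> f')"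
  using tmo_cmp[of "src f" "tgt f" "tgt g" "src f'" "tgt f'" "tgt g'" f g f' g'] assms by auto

lemma interchange_assoc [simp]:
  assumes "arr f" "arr g" "arr f'" "arr g'" "src g = tgt f" "src g' = tgt f'"
    "arr k" "tgt k = src f \<boxtimes> src f'"
  shows "(g \<boxdot> g') \<cdot> (f \<boxdot> f') \<cdot> k = ((g \<cdot> f) \<boxdot> (g' \<cdot> f')) \<cdot> k"
  using assms by (intro cmp_extend) auto

lemma tmo_finsum_left:
  assumes "\<And>j. j \<in> J \<Longrightarrow> \<guillemotleft>f j : A \<rightarrow> B\<guillemotright>" "\<guillemotleft>g : A' \<rightarrow> B'\<guillemotright>" "A \<in> Obj C" "B \<in> Obj C"
  shows "finsum (Mor C A B) f J \<boxdot> g = finsum (Mor C (A \<boxtimes> A') (B \<boxtimes> B')) (\<lambda>j. f j \<boxdot> g) J"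
  using assms by (intro additive_finsum[where h = "\<lambda>f. f \<boxdot> g"] tmo_add_left) auto

lemma tmo_finsum_right:
  assumes "\<And>j. j \<in> J \<Longrightarrow> \<guillemotleft>f j : A' \<rightarrow> B'\<guillemotright>" "\<guillemotleft>g : A \<rightarrow> B\<guillemotright>" "A' \<in> Obj C" "B' \<in> Obj C"
  shows "g \<boxdot> finsum (Mor C A' B') f J = finsum (Mor C (A \<boxtimes> A') (B \<boxtimes> B')) (\<lambda>j. g \<boxdot> f j) J"
  using assms by (intro additive_finsum[where h = "\<lambda>f. g \<boxdot> f"] tmo_add_right) auto

lemma tmo_zero [simp]:
  assumes "arr g" "A \<in> Obj C" "B \<in> Obj C"
  shows "\<zero>\<^bsub>Mor C A B\<^esub> \<boxdot> g = \<zero>\<^bsub>Mor C (A \<boxtimes> src g) (B \<boxtimes> tgt g)\<^esub>"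
    "g \<boxdot> \<zero>\<^bsub>Mor C A B\<^esub> = \<zero>\<^bsub>Mor C (src g \<boxtimes> A) (tgt g \<boxtimes> B)\<^esub>"
  using assms
  by (auto intro!: additive_zero[where h = "\<lambda>f. f \<boxdot> g"] tmo_add_left
        additive_zero[where h = "\<lambda>f. g \<boxdot> f"] tmo_add_right)

definition asc_inv ("\<Psi>") where
  "\<Psi> A B D = inv_mor C ((A \<boxtimes> B) \<boxtimes> D) (A \<boxtimes> (B \<boxtimes> D)) (\<Phi> A B D)"

lemma arr_asc [simp]:
  assumes "A \<in> Obj C" "B \<in> Obj C" "D \<in> Obj C"
  shows "arr (\<Phi> A B D)" "src (\<Phi> A B D) = (A \<boxtimes> B) \<boxtimes> D" "tgt (\<Phi> A B D) = A \<boxtimes> (B \<boxtimes> D)"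
    "arr (\<Psi> A B D)" "tgt (\<Psi> A B D) = (A \<boxtimes> B) \<boxtimes> D" "src (\<Psi> A B D) = A \<boxtimes> (B \<boxtimes> D)"
    "\<Phi> A B D \<cdot> \<Psi> A B D = \<one>\<^sub>m (A \<boxtimes> (B \<boxtimes> D))" "\<Psi> A B D \<cdot> \<Phi> A B D = \<one>\<^sub>m ((A \<boxtimes> B) \<boxtimes> D)"
  using inv_mor[OF asc_iso[OF assms]] assms unfolding asc_inv_def by auto

lemma asc_cancel [simp]:
  assumes "A \<in> Obj C" "B \<in> Obj C" "D \<in> Obj C" "arr k"
  shows "tgt k = A \<boxtimes> (B \<boxtimes> D) \<Longrightarrow> \<Phi> A B D \<cdot> \<Psi> A B D \<cdot> k = k"
    "tgt k = (A \<boxtimes> B) \<boxtimes> D \<Longrightarrow> \<Psi> A B D \<cdot> \<Phi> A B D \<cdot> k = k"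
  using assms cmp_extend[of "\<Phi> A B D" "\<Psi> A B D" "\<one>\<^sub>m (A \<boxtimes> (B \<boxtimes> D))" k]
    cmp_extend[of "\<Psi> A B D" "\<Phi> A B D" "\<one>\<^sub>m ((A \<boxtimes> B) \<boxtimes> D)" k] by auto

lemma asc_nat:
  assumes "arr f" "arr g" "arr h"
  shows "\<Phi> (tgt f) (tgt g) (tgt h) \<cdot> ((f \<boxdot> g) \<boxdot> h) = (f \<boxdot> (g \<boxdot> h)) \<cdot> \<Phi> (src f) (src g) (src h)"
  using asc_natural[of "src f" "src g" "src h" "tgt f" "tgt g" "tgt h" f g h] assms by auto

lemma asc_inv_nat:
  assumes "arr f" "arr g" "arr h"
  shows "\<Psi> (tgt f) (tgt g) (tgt h) \<cdot> (f \<boxdot> (g \<boxdot> h)) = ((f \<boxdot> g) \<boxdot> h) \<cdot> \<Psi> (src f) (src g) (src h)"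
proof -
  let ?\<Psi> = "\<Psi> (tgt f) (tgt g) (tgt h)"
  have "?\<Psi> \<cdot> (f \<boxdot> (g \<boxdot> h)) = ?\<Psi> \<cdot> (f \<boxdot> (g \<boxdot> h)) \<cdot> \<Phi> (src f) (src g) (src h) \<cdot> \<Psi> (src f) (src g) (src h)"
    using assms by simp
  also have "\<dots> = ?\<Psi> \<cdot> \<Phi> (tgt f) (tgt g) (tgt h) \<cdot> ((f \<boxdot> g) \<boxdot> h) \<cdot> \<Psi> (src f) (src g) (src h)"
    using assms cmp_extend[OF asc_nat[OF assms], of "\<Psi> (src f) (src g) (src h)"] by simp
  finally show ?thesis using assms by simp
qed

text \<open>
  Mac Lane's argument: by the pentagon and the triangle, the associator with a unit in an outer
  position is idempotent, and an invertible idempotent is an identity.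
\<close>

lemma asc_unt [simp]:
  assumes "A \<in> Obj C" "B \<in> Obj C"
  shows "\<Phi> A B \<I> = \<one>\<^sub>m (A \<boxtimes> B)" "\<Phi> \<I> A B = \<one>\<^sub>m (A \<boxtimes> B)" "\<Phi> A \<I> B = \<one>\<^sub>m (A \<boxtimes> B)"
proof -
  have idem: "f = \<one>\<^sub>m D" if "f \<cdot> f = f" "\<guillemotleft>f : D \<rightarrow> D\<guillemotright>" "g \<cdot> f = \<one>\<^sub>m D" "\<guillemotleft>g : D \<rightarrow> D\<guillemotright>" for f g D
    using that by (metis cmp_assoc' cmp_one(2))
  have "\<Phi> A B \<I> \<cdot> \<Phi> A B \<I> = \<Phi> A B \<I>"
    using pentagon[of A B \<I> \<I>, symmetric] assms by (simp add: triangle)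
  from idem[OF this, of "A \<boxtimes> B" "\<Psi> A B \<I>"] show "\<Phi> A B \<I> = \<one>\<^sub>m (A \<boxtimes> B)"
    using assms arr_asc[of A B \<I>] by simp
  have "\<Phi> \<I> A B \<cdot> \<Phi> \<I> A B = \<Phi> \<I> A B"
    using pentagon[of \<I> \<I> A B, symmetric] assms triangle[of \<I> "A \<boxtimes> B"] triangle[of \<I> A] by simp
  from idem[OF this, of "A \<boxtimes> B" "\<Psi> \<I> A B"] show "\<Phi> \<I> A B = \<one>\<^sub>m (A \<boxtimes> B)"
    using assms arr_asc[of \<I> A B] by simp
qed (use assms in \<open>simp add: triangle\<close>)

lemma asc_inv_unt [simp]:
  assumes "A \<in> Obj C" "B \<in> Obj C"
  shows "\<Psi> A B \<I> = \<one>\<^sub>m (A \<boxtimes> B)" "\<Psi> \<I> A B = \<one>\<^sub>m (A \<boxtimes> B)" "\<Psi> A \<I> B = \<one>\<^sub>m (A \<boxtimes> B)"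
  using arr_asc(8)[of A B \<I>] arr_asc(8)[of \<I> A B] arr_asc(8)[of A \<I> B] assms by simp_all

lemma pentagon_left:
  assumes "A \<in> Obj C" "B \<in> Obj C" "D \<in> Obj C" "E \<in> Obj C"
  shows "\<Psi> A B (D \<boxtimes> E) \<cdot> (\<one>\<^sub>m A \<boxdot> \<Phi> B D E)
       = \<Phi> (A \<boxtimes> B) D E \<cdot> (\<Psi> A B D \<boxdot> \<one>\<^sub>m E) \<cdot> \<Psi> A (B \<boxtimes> D) E"
proof -
  let ?t = "(\<Psi> A B D \<boxdot> \<one>\<^sub>m E) \<cdot> \<Psi> A (B \<boxtimes> D) E"
  have "\<Phi> A B (D \<boxtimes> E) \<cdot> \<Phi> (A \<boxtimes> B) D E \<cdot> ?t
      = ((\<one>\<^sub>m A \<boxdot> \<Phi> B D E) \<cdot> \<Phi> A (B \<boxtimes> D) E \<cdot> (\<Phi> A B D \<boxdot> \<one>\<^sub>m E)) \<cdot> ?t"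
    using assms by (intro cmp_extend[OF pentagon]) auto
  also have "\<dots> = \<one>\<^sub>m A \<boxdot> \<Phi> B D E" using assms by simp
  finally have "\<Psi> A B (D \<boxtimes> E) \<cdot> \<Phi> A B (D \<boxtimes> E) \<cdot> \<Phi> (A \<boxtimes> B) D E \<cdot> ?t
      = \<Psi> A B (D \<boxtimes> E) \<cdot> (\<one>\<^sub>m A \<boxdot> \<Phi> B D E)" by simp
  then show ?thesis using assms by simp
qed

lemma pentagon_right:
  assumes "A \<in> Obj C" "B \<in> Obj C" "D \<in> Obj C" "E \<in> Obj C"
  shows "(\<one>\<^sub>m A \<boxdot> \<Psi> B D E) \<cdot> \<Phi> A B (D \<boxtimes> E)
       = \<Phi> A (B \<boxtimes> D) E \<cdot> (\<Phi> A B D \<boxdot> \<one>\<^sub>m E) \<cdot> \<Psi> (A \<boxtimes> B) D E"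
proof -
  have "(\<one>\<^sub>m A \<boxdot> \<Psi> B D E) \<cdot> (\<Phi> A B (D \<boxtimes> E) \<cdot> \<Phi> (A \<boxtimes> B) D E) \<cdot> \<Psi> (A \<boxtimes> B) D E
    = (\<one>\<^sub>m A \<boxdot> \<Psi> B D E) \<cdot> ((\<one>\<^sub>m A \<boxdot> \<Phi> B D E) \<cdot> \<Phi> A (B \<boxtimes> D) E \<cdot> (\<Phi> A B D \<boxdot> \<one>\<^sub>m E)) \<cdot> \<Psi> (A \<boxtimes> B) D E"
    using assms by (subst pentagon) auto
  then show ?thesis using assms by simp
qed


text \<open>
  The naming fits the use below, where \<open>X\<close> is a right dual of \<open>P\<close>:
  \<open>left_dual C X P ev db\<close> says that \<open>ev : P \<boxtimes> X \<rightarrow> \<I>\<close> and \<open>db : \<I> \<rightarrow> X \<boxtimes> P\<close> are a duality.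
\<close>

lemma left_dualD:
  assumes "left_dual C X P ev db"
  shows "\<guillemotleft>ev : P \<boxtimes> X \<rightarrow> \<I>\<guillemotright>" "\<guillemotleft>db : \<I> \<rightarrow> X \<boxtimes> P\<guillemotright>" "X \<in> Obj C" "P \<in> Obj C"
    "(\<one>\<^sub>m X \<boxdot> ev) \<cdot> \<Phi> X P X \<cdot> (db \<boxdot> \<one>\<^sub>m X) = \<one>\<^sub>m X"
    "(ev \<boxdot> \<one>\<^sub>m P) \<cdot> \<Psi> P X P \<cdot> (\<one>\<^sub>m P \<boxdot> db) = \<one>\<^sub>m P"
  using assms unfolding left_dual_def asc_inv_def by auto

text \<open>
  The adjunction between \<open>P \<boxtimes> -\<close> and \<open>X \<boxtimes> -\<close>: every \<open>y : P \<boxtimes> Q \<rightarrow> \<I>\<close> comes from its transpose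
  \<open>Q \<rightarrow> X\<close>. Naturality moves \<open>y\<close> behind \<open>ev\<close>, the pentagon brings the two remaining
  associators into the position of the zig-zag identity for \<open>P\<close>, and there they cancel.
\<close>

lemma transpose_ev:
  assumes d: "left_dual C X P ev db" and y: "\<guillemotleft>y : P \<boxtimes> Q \<rightarrow> \<I>\<guillemotright>" and Q: "Q \<in> Obj C"
  shows "ev \<cdot> (\<one>\<^sub>m P \<boxdot> ((\<one>\<^sub>m X \<boxdot> y) \<cdot> \<Phi> X P Q \<cdot> (db \<boxdot> \<one>\<^sub>m Q))) = y"
proof -
  note D [simp] = left_dualD[OF d]
  have 1: "ev \<cdot> (\<one>\<^sub>m P \<boxdot> (\<one>\<^sub>m X \<boxdot> y)) = y \<cdot> (ev \<boxdot> \<one>\<^sub>m (P \<boxtimes> Q)) \<cdot> \<Psi> P X (P \<boxtimes> Q)"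
  proof -
    have "\<one>\<^sub>m P \<boxdot> (\<one>\<^sub>m X \<boxdot> y) = (\<one>\<^sub>m (P \<boxtimes> X) \<boxdot> y) \<cdot> \<Psi> P X (P \<boxtimes> Q)"
      using asc_inv_nat[of "\<one>\<^sub>m P" "\<one>\<^sub>m X" y] y Q by simp
    moreover have "ev \<cdot> (\<one>\<^sub>m (P \<boxtimes> X) \<boxdot> y) = y \<cdot> (ev \<boxdot> \<one>\<^sub>m (P \<boxtimes> Q))"
      using y Q interchange[of "\<one>\<^sub>m (P \<boxtimes> X)" ev y "\<one>\<^sub>m \<I>"] interchange[of ev "\<one>\<^sub>m \<I>" "\<one>\<^sub>m (P \<boxtimes> Q)" y]
      by simp
    ultimately show ?thesis using y Q cmp_extend[of ev "\<one>\<^sub>m (P \<boxtimes> X) \<boxdot> y" "y \<cdot> (ev \<boxdot> \<one>\<^sub>m (P \<boxtimes> Q))" "\<Psi> P X (P \<boxtimes> Q)"]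
      by simp
  qed
  have 2: "\<Psi> P (X \<boxtimes> P) Q \<cdot> (\<one>\<^sub>m P \<boxdot> (db \<boxdot> \<one>\<^sub>m Q)) = (\<one>\<^sub>m P \<boxdot> db) \<boxdot> \<one>\<^sub>m Q"
    using asc_inv_nat[of "\<one>\<^sub>m P" db "\<one>\<^sub>m Q"] Q by simp
  have 3: "(ev \<boxdot> \<one>\<^sub>m (P \<boxtimes> Q)) \<cdot> \<Phi> (P \<boxtimes> X) P Q = (ev \<boxdot> \<one>\<^sub>m P) \<boxdot> \<one>\<^sub>m Q"
    using asc_nat[of ev "\<one>\<^sub>m P" "\<one>\<^sub>m Q"] Q by simp
  have "ev \<cdot> (\<one>\<^sub>m P \<boxdot> ((\<one>\<^sub>m X \<boxdot> y) \<cdot> \<Phi> X P Q \<cdot> (db \<boxdot> \<one>\<^sub>m Q)))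
      = ev \<cdot> (\<one>\<^sub>m P \<boxdot> (\<one>\<^sub>m X \<boxdot> y)) \<cdot> (\<one>\<^sub>m P \<boxdot> \<Phi> X P Q) \<cdot> (\<one>\<^sub>m P \<boxdot> (db \<boxdot> \<one>\<^sub>m Q))"
    using y Q by simp
  also have "\<dots> = (y \<cdot> (ev \<boxdot> \<one>\<^sub>m (P \<boxtimes> Q)) \<cdot> \<Psi> P X (P \<boxtimes> Q)) \<cdot> (\<one>\<^sub>m P \<boxdot> \<Phi> X P Q) \<cdot> (\<one>\<^sub>m P \<boxdot> (db \<boxdot> \<one>\<^sub>m Q))"
    using y Q by (intro cmp_extend[OF 1]) auto
  also have "\<dots> = y \<cdot> (ev \<boxdot> \<one>\<^sub>m (P \<boxtimes> Q)) \<cdot> (\<Psi> P X (P \<boxtimes> Q) \<cdot> (\<one>\<^sub>m P \<boxdot> \<Phi> X P Q)) \<cdot> (\<one>\<^sub>m P \<boxdot> (db \<boxdot> \<one>\<^sub>m Q))"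
    using y Q by (simp del: interchange interchange_assoc)
  also have "\<dots> = y \<cdot> (ev \<boxdot> \<one>\<^sub>m (P \<boxtimes> Q)) \<cdot> \<Phi> (P \<boxtimes> X) P Q \<cdot> (\<Psi> P X P \<boxdot> \<one>\<^sub>m Q) \<cdot> \<Psi> P (X \<boxtimes> P) Q \<cdot> (\<one>\<^sub>m P \<boxdot> (db \<boxdot> \<one>\<^sub>m Q))"
    using y Q by (simp add: pentagon_left del: interchange interchange_assoc)
  also have "\<dots> = y \<cdot> (ev \<boxdot> \<one>\<^sub>m (P \<boxtimes> Q)) \<cdot> \<Phi> (P \<boxtimes> X) P Q \<cdot> (\<Psi> P X P \<boxdot> \<one>\<^sub>m Q) \<cdot> ((\<one>\<^sub>m P \<boxdot> db) \<boxdot> \<one>\<^sub>m Q)"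
    by (simp only: 2)
  also have "\<dots> = y \<cdot> ((ev \<boxdot> \<one>\<^sub>m P) \<boxdot> \<one>\<^sub>m Q) \<cdot> (\<Psi> P X P \<boxdot> \<one>\<^sub>m Q) \<cdot> ((\<one>\<^sub>m P \<boxdot> db) \<boxdot> \<one>\<^sub>m Q)"
    using y Q by (subst cmp_extend[OF 3]) auto
  also have "\<dots> = y \<cdot> (((ev \<boxdot> \<one>\<^sub>m P) \<cdot> \<Psi> P X P \<cdot> (\<one>\<^sub>m P \<boxdot> db)) \<boxdot> \<one>\<^sub>m Q)"
    using y Q by (simp del: D(6))
  also have "\<dots> = y" using y Q by simp
  finally show ?thesis .
qed

text \<open>
  The counterpart for coevaluations: every \<open>z : \<I> \<rightarrow> X \<boxtimes> Q\<close> comes from its transpose \<open>P \<rightarrow> Q\<close>,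
  now by the zig-zag identity for \<open>X\<close>.
\<close>

lemma transpose_db:
  assumes d: "left_dual C X P ev db" and z: "\<guillemotleft>z : \<I> \<rightarrow> X \<boxtimes> Q\<guillemotright>" and Q: "Q \<in> Obj C"
  shows "(\<one>\<^sub>m X \<boxdot> ((ev \<boxdot> \<one>\<^sub>m Q) \<cdot> \<Psi> P X Q \<cdot> (\<one>\<^sub>m P \<boxdot> z))) \<cdot> db = z"
proof -
  note D [simp] = left_dualD[OF d]
  have 1: "(\<one>\<^sub>m X \<boxdot> (\<one>\<^sub>m P \<boxdot> z)) \<cdot> db = \<Phi> X P (X \<boxtimes> Q) \<cdot> (db \<boxdot> \<one>\<^sub>m (X \<boxtimes> Q)) \<cdot> z"
  proof -
    have "\<one>\<^sub>m X \<boxdot> (\<one>\<^sub>m P \<boxdot> z) = \<Phi> X P (X \<boxtimes> Q) \<cdot> (\<one>\<^sub>m (X \<boxtimes> P) \<boxdot> z)"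
      using asc_nat[of "\<one>\<^sub>m X" "\<one>\<^sub>m P" z] z Q by simp
    moreover have "(\<one>\<^sub>m (X \<boxtimes> P) \<boxdot> z) \<cdot> db = (db \<boxdot> \<one>\<^sub>m (X \<boxtimes> Q)) \<cdot> z"
      using z Q interchange[of db "\<one>\<^sub>m (X \<boxtimes> P)" "\<one>\<^sub>m \<I>" z] interchange[of "\<one>\<^sub>m \<I>" db z "\<one>\<^sub>m (X \<boxtimes> Q)"]
      by simp
    ultimately show ?thesis using z Q by simp
  qed
  have 2: "\<Psi> (X \<boxtimes> P) X Q \<cdot> (db \<boxdot> \<one>\<^sub>m (X \<boxtimes> Q)) = (db \<boxdot> \<one>\<^sub>m X) \<boxdot> \<one>\<^sub>m Q"
    using asc_inv_nat[of db "\<one>\<^sub>m X" "\<one>\<^sub>m Q"] Q by simp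
  have 3: "(\<one>\<^sub>m X \<boxdot> (ev \<boxdot> \<one>\<^sub>m Q)) \<cdot> \<Phi> X (P \<boxtimes> X) Q = (\<one>\<^sub>m X \<boxdot> ev) \<boxdot> \<one>\<^sub>m Q"
    using asc_nat[of "\<one>\<^sub>m X" ev "\<one>\<^sub>m Q"] Q by simp
  have "(\<one>\<^sub>m X \<boxdot> ((ev \<boxdot> \<one>\<^sub>m Q) \<cdot> \<Psi> P X Q \<cdot> (\<one>\<^sub>m P \<boxdot> z))) \<cdot> db
      = (\<one>\<^sub>m X \<boxdot> (ev \<boxdot> \<one>\<^sub>m Q)) \<cdot> (\<one>\<^sub>m X \<boxdot> \<Psi> P X Q) \<cdot> (\<one>\<^sub>m X \<boxdot> (\<one>\<^sub>m P \<boxdot> z)) \<cdot> db"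
    using z Q by simp
  also have "\<dots> = (\<one>\<^sub>m X \<boxdot> (ev \<boxdot> \<one>\<^sub>m Q)) \<cdot> (\<one>\<^sub>m X \<boxdot> \<Psi> P X Q) \<cdot> \<Phi> X P (X \<boxtimes> Q) \<cdot> (db \<boxdot> \<one>\<^sub>m (X \<boxtimes> Q)) \<cdot> z"
    by (simp only: 1)
  also have "\<dots> = (\<one>\<^sub>m X \<boxdot> (ev \<boxdot> \<one>\<^sub>m Q)) \<cdot> ((\<one>\<^sub>m X \<boxdot> \<Psi> P X Q) \<cdot> \<Phi> X P (X \<boxtimes> Q)) \<cdot> (db \<boxdot> \<one>\<^sub>m (X \<boxtimes> Q)) \<cdot> z"
    using z Q by (simp del: interchange interchange_assoc)
  also have "\<dots> = (\<one>\<^sub>m X \<boxdot> (ev \<boxdot> \<one>\<^sub>m Q)) \<cdot> \<Phi> X (P \<boxtimes> X) Q \<cdot> (\<Phi> X P X \<boxdot> \<one>\<^sub>m Q) \<cdot> \<Psi> (X \<boxtimes> P) X Q \<cdot> (db \<boxdot> \<one>\<^sub>m (X \<boxtimes> Q)) \<cdot> z"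
    using z Q by (simp add: pentagon_right del: interchange interchange_assoc)
  also have "\<dots> = (\<one>\<^sub>m X \<boxdot> (ev \<boxdot> \<one>\<^sub>m Q)) \<cdot> \<Phi> X (P \<boxtimes> X) Q \<cdot> (\<Phi> X P X \<boxdot> \<one>\<^sub>m Q) \<cdot> ((db \<boxdot> \<one>\<^sub>m X) \<boxdot> \<one>\<^sub>m Q) \<cdot> z"
    using z Q by (subst cmp_extend[OF 2]) auto
  also have "\<dots> = ((\<one>\<^sub>m X \<boxdot> ev) \<boxdot> \<one>\<^sub>m Q) \<cdot> (\<Phi> X P X \<boxdot> \<one>\<^sub>m Q) \<cdot> ((db \<boxdot> \<one>\<^sub>m X) \<boxdot> \<one>\<^sub>m Q) \<cdot> z"
    using z Q by (subst cmp_extend[OF 3]) auto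
  also have "\<dots> = (((\<one>\<^sub>m X \<boxdot> ev) \<cdot> \<Phi> X P X \<cdot> (db \<boxdot> \<one>\<^sub>m X)) \<boxdot> \<one>\<^sub>m Q) \<cdot> z"
    using z Q by (simp del: D(5))
  also have "\<dots> = z" using z Q by simp
  finally show ?thesis .
qed

text \<open>
  The mirror image of \<open>transpose_ev\<close>, with the transpose \<open>Q \<rightarrow> P\<close> taken on the other
  side. It serves only to compare a simple object with its double left dual.
\<close>

lemma transpose_ev_mirror:
  assumes d: "left_dual C X P ev db" and y: "\<guillemotleft>y : Q \<boxtimes> X \<rightarrow> \<I>\<guillemotright>" and Q: "Q \<in> Obj C"
  shows "ev \<cdot> (((y \<boxdot> \<one>\<^sub>m P) \<cdot> \<Psi> Q X P \<cdot> (\<one>\<^sub>m Q \<boxdot> db)) \<boxdot> \<one>\<^sub>m X) = y"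
proof -
  note D [simp] = left_dualD[OF d]
  have 1: "ev \<cdot> ((y \<boxdot> \<one>\<^sub>m P) \<boxdot> \<one>\<^sub>m X) = y \<cdot> (\<one>\<^sub>m (Q \<boxtimes> X) \<boxdot> ev) \<cdot> \<Phi> (Q \<boxtimes> X) P X"
  proof -
    have "(y \<boxdot> \<one>\<^sub>m P) \<boxdot> \<one>\<^sub>m X = (y \<boxdot> \<one>\<^sub>m (P \<boxtimes> X)) \<cdot> \<Phi> (Q \<boxtimes> X) P X"
      using asc_nat[of y "\<one>\<^sub>m P" "\<one>\<^sub>m X"] y Q by simp
    moreover have "ev \<cdot> (y \<boxdot> \<one>\<^sub>m (P \<boxtimes> X)) = y \<cdot> (\<one>\<^sub>m (Q \<boxtimes> X) \<boxdot> ev)"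
      using y Q interchange[of y "\<one>\<^sub>m \<I>" "\<one>\<^sub>m (P \<boxtimes> X)" ev] interchange[of "\<one>\<^sub>m (Q \<boxtimes> X)" y ev "\<one>\<^sub>m \<I>"]
      by simp
    ultimately show ?thesis
      using y Q cmp_extend[of ev "y \<boxdot> \<one>\<^sub>m (P \<boxtimes> X)" "y \<cdot> (\<one>\<^sub>m (Q \<boxtimes> X) \<boxdot> ev)" "\<Phi> (Q \<boxtimes> X) P X"]
      by simp
  qed
  have 2: "(\<one>\<^sub>m Q \<boxdot> db) \<boxdot> \<one>\<^sub>m X = \<Psi> Q (X \<boxtimes> P) X \<cdot> (\<one>\<^sub>m Q \<boxdot> (db \<boxdot> \<one>\<^sub>m X))"
    using asc_inv_nat[of "\<one>\<^sub>m Q" db "\<one>\<^sub>m X"] Q by simp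
  have 3: "(\<one>\<^sub>m (Q \<boxtimes> X) \<boxdot> ev) \<cdot> \<Psi> Q X (P \<boxtimes> X) = \<one>\<^sub>m Q \<boxdot> (\<one>\<^sub>m X \<boxdot> ev)"
    using asc_inv_nat[of "\<one>\<^sub>m Q" "\<one>\<^sub>m X" ev] Q by simp
  have "ev \<cdot> (((y \<boxdot> \<one>\<^sub>m P) \<cdot> \<Psi> Q X P \<cdot> (\<one>\<^sub>m Q \<boxdot> db)) \<boxdot> \<one>\<^sub>m X)
      = ev \<cdot> ((y \<boxdot> \<one>\<^sub>m P) \<boxdot> \<one>\<^sub>m X) \<cdot> (\<Psi> Q X P \<boxdot> \<one>\<^sub>m X) \<cdot> ((\<one>\<^sub>m Q \<boxdot> db) \<boxdot> \<one>\<^sub>m X)"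
    using y Q by simp
  also have "\<dots> = (y \<cdot> (\<one>\<^sub>m (Q \<boxtimes> X) \<boxdot> ev) \<cdot> \<Phi> (Q \<boxtimes> X) P X) \<cdot> (\<Psi> Q X P \<boxdot> \<one>\<^sub>m X) \<cdot> ((\<one>\<^sub>m Q \<boxdot> db) \<boxdot> \<one>\<^sub>m X)"
    using y Q by (intro cmp_extend[OF 1]) auto
  also have "\<dots> = y \<cdot> (\<one>\<^sub>m (Q \<boxtimes> X) \<boxdot> ev) \<cdot> (\<Phi> (Q \<boxtimes> X) P X \<cdot> (\<Psi> Q X P \<boxdot> \<one>\<^sub>m X) \<cdot> \<Psi> Q (X \<boxtimes> P) X) \<cdot> (\<one>\<^sub>m Q \<boxdot> (db \<boxdot> \<one>\<^sub>m X))"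
    using y Q by (simp add: 2 del: interchange interchange_assoc)
  also have "\<dots> = y \<cdot> (\<one>\<^sub>m (Q \<boxtimes> X) \<boxdot> ev) \<cdot> \<Psi> Q X (P \<boxtimes> X) \<cdot> (\<one>\<^sub>m Q \<boxdot> \<Phi> X P X) \<cdot> (\<one>\<^sub>m Q \<boxdot> (db \<boxdot> \<one>\<^sub>m X))"
    using y Q by (simp add: pentagon_left[symmetric] del: interchange interchange_assoc)
  also have "\<dots> = y \<cdot> (\<one>\<^sub>m Q \<boxdot> (\<one>\<^sub>m X \<boxdot> ev)) \<cdot> (\<one>\<^sub>m Q \<boxdot> \<Phi> X P X) \<cdot> (\<one>\<^sub>m Q \<boxdot> (db \<boxdot> \<one>\<^sub>m X))"
    using y Q by (subst cmp_extend[OF 3]) auto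
  also have "\<dots> = y \<cdot> (\<one>\<^sub>m Q \<boxdot> ((\<one>\<^sub>m X \<boxdot> ev) \<cdot> \<Phi> X P X \<cdot> (db \<boxdot> \<one>\<^sub>m X)))"
    using y Q by (simp del: D(5))
  also have "\<dots> = y" using y Q by simp
  finally show ?thesis .
qed

end


section \<open>Schur's lemma and direct sums\<close>

context abelian_linear_category
begin

lemma zero_obj_mor:
  assumes "zero_obj C Z" "arr f" "src f = Z \<or> tgt f = Z"
  shows "f = \<zero>\<^bsub>Mor C (src f) (tgt f)\<^esub>"
proof -
  have Z: "Z \<in> Obj C" using assms(1) unfolding zero_obj_def by blast
  have "f \<in> \<H> (src f) (tgt f)" "\<zero>\<^bsub>Mor C (src f) (tgt f)\<^esub> \<in> \<H> (src f) (tgt f)"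
    using assms(2) by simp_all
  moreover have "\<exists>!g. g \<in> \<H> (src f) (tgt f)"
    using assms arr_obj[OF assms(2)] unfolding zero_obj_def by blast
  ultimately show ?thesis by blast
qed

lemma simple_id_nonzero:
  assumes "simple_obj C S"
  shows "\<one>\<^sub>m S \<noteq> \<zero>\<^bsub>Mor C S S\<^esub>"
proof
  assume z: "\<one>\<^sub>m S = \<zero>\<^bsub>Mor C S S\<^esub>"
  have S: "S \<in> Obj C" using assms unfolding simple_obj_def by blast
  have to_S: "f = \<zero>\<^bsub>Mor C A S\<^esub>" if "\<guillemotleft>f : A \<rightarrow> S\<guillemotright>" for f A
    using cmp_one(2)[of f S] cmp_zero_left[of f S S] that z by simp
  have from_S: "f = \<zero>\<^bsub>Mor C S A\<^esub>" if "\<guillemotleft>f : S \<rightarrow> A\<guillemotright>" for f A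
    using cmp_one(1)[of f S] cmp_zero_right[of f S S] that z by simp
  have "zero_obj C S"
    unfolding zero_obj_def
  proof (intro conjI ballI)
    fix A assume "A \<in> Obj C"
    with S to_S show "\<exists>!f. f \<in> \<H> A S" by (intro ex1I[of _ "\<zero>\<^bsub>Mor C A S\<^esub>"]) auto
    from S \<open>A \<in> Obj C\<close> from_S
    show "\<exists>!f. f \<in> \<H> S A" by (intro ex1I[of _ "\<zero>\<^bsub>Mor C S A\<^esub>"]) auto
  qed (rule S)
  then show False using assms unfolding simple_obj_def by blast
qed

text \<open>
  If \<open>f \<cdot> g = f \<cdot> h\<close>, the difference of \<open>g\<close> and \<open>h\<close> factors through the kernel.
\<close>

lemma mono_if_zero_kernel:
  assumes f: "\<guillemotleft>f : A \<rightarrow> B\<guillemotright>" and k: "kernel_of C A B f N m" and N: "zero_obj C N"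
  shows "mono_mor C A B f"
  unfolding mono_mor_def
proof (intro conjI ballI impI)
  show "f \<in> \<H> A B" using f by simp
  fix D g h assume D: "D \<in> Obj C" and "g \<in> \<H> D A" "h \<in> \<H> D A" and eq: "f \<cdot> g = f \<cdot> h"
  then have g: "\<guillemotleft>g : D \<rightarrow> A\<guillemotright>" and h: "\<guillemotleft>h : D \<rightarrow> A\<guillemotright>" using f by auto
  interpret M: abelian_group "Mor C D A" using D f by (intro mor_abelian_group) auto
  interpret L: abelian_group "Mor C D B" using D f by (intro mor_abelian_group) auto
  have gh: "g \<in> carrier (Mor C D A)" "h \<in> carrier (Mor C D A)" using g h by auto
  define d where "d = g \<ominus>\<^bsub>Mor C D A\<^esub> h"
  have d_carrier: "d \<in> carrier (Mor C D A)" unfolding d_def by (intro M.minus_closed gh)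
  then have d: "\<guillemotleft>d : D \<rightarrow> A\<guillemotright>" using D f by simp
  have dh: "d \<oplus>\<^bsub>Mor C D A\<^esub> h = g"
    unfolding d_def a_minus_def using gh by (simp add: M.a_assoc M.l_neg del: hom_iff)
  have fd: "f \<cdot> d \<in> carrier (Mor C D B)" "f \<cdot> h \<in> carrier (Mor C D B)" using d h f by auto
  have "(f \<cdot> d) \<oplus>\<^bsub>Mor C D B\<^esub> (f \<cdot> h) = f \<cdot> h"
    using cmp_add_right[of D A B d h f] d h f dh eq by simp
  then have z: "f \<cdot> d = \<zero>\<^bsub>Mor C D B\<^esub>" using L.add.r_cancel_one[OF fd(2) fd(1)] by simp
  then obtain k where "k \<in> \<H> D N" "m \<cdot> k = d"
    using k D d_carrier z unfolding kernel_of_def by blast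
  moreover have N': "N \<in> Obj C" using N unfolding zero_obj_def by blast
  moreover have "\<guillemotleft>m : N \<rightarrow> A\<guillemotright>" using k N' f unfolding kernel_of_def by simp
  moreover have "k = \<zero>\<^bsub>Mor C D N\<^esub>" using zero_obj_mor[OF N, of k] calculation D by simp
  ultimately have "d = \<zero>\<^bsub>Mor C D A\<^esub>" using cmp_zero_right[of m N D] D by simp
  then show "g = h" using dh M.l_zero[of h] h by simp
qed

text \<open>
  The kernel of \<open>f\<close> is a subobject of \<open>S\<close>, hence zero or all of \<open>S\<close>. In the second case
  \<open>f = 0\<close>. In the first case \<open>f\<close> is a monomorphism into the simple object \<open>T\<close>, and its source is
  not zero.
\<close>

theorem Schur:
  assumes S: "simple_obj C S" and T: "simple_obj C T" and f: "\<guillemotleft>f : S \<rightarrow> T\<guillemotright>"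
    and nz: "f \<noteq> \<zero>\<^bsub>Mor C S T\<^esub>"
  shows "iso_mor C S T f"
proof -
  obtain N m where N: "N \<in> Obj C" and k: "kernel_of C S T f N m"
    using ex_kernel[of S T f] f by auto
  have m: "\<guillemotleft>m : N \<rightarrow> S\<guillemotright>" and fm: "f \<cdot> m = \<zero>\<^bsub>Mor C N T\<^esub>"
    using k N f unfolding kernel_of_def by auto
  have "mono_mor C N S m"
    unfolding mono_mor_def
  proof (intro conjI ballI impI)
    show "m \<in> \<H> N S" using m by simp
    fix D g h assume D: "D \<in> Obj C" and g: "g \<in> \<H> D N" and h: "h \<in> \<H> D N" and eq: "m \<cdot> g = m \<cdot> h"
    have "f \<cdot> m \<cdot> h = (f \<cdot> m) \<cdot> h" using f m h D N by simp
    also have "\<dots> = \<zero>\<^bsub>Mor C D T\<^esub>" using f m h D N fm by simp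
    finally have "\<exists>!l. l \<in> \<H> D N \<and> m \<cdot> l = m \<cdot> h"
      using k D m h N unfolding kernel_of_def by simp
    then show "g = h" using g h eq by blast
  qed
  then consider "zero_obj C N" | "iso_mor C N S m" using S N unfolding simple_obj_def by blast
  then show ?thesis
  proof cases
    case 1
    then have "mono_mor C S T f" using mono_if_zero_kernel[OF f k] by blast
    then show ?thesis using S T f unfolding simple_obj_def by blast
  next
    case 2
    define m' where "m' = inv_mor C N S m"
    have m': "\<guillemotleft>m' : S \<rightarrow> N\<guillemotright>" "m \<cdot> m' = \<one>\<^sub>m S"
      using inv_mor[OF 2] m unfolding m'_def by auto
    have "f = (f \<cdot> m) \<cdot> m'" using f m m' by simp
    also have "\<dots> = \<zero>\<^bsub>Mor C S T\<^esub>" using fm f m' by simp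
    finally show ?thesis using nz by simp
  qed
qed

end

context semisimple_monoidal_category
begin

lemma simple_in_Obj [simp]: "simple_obj C S \<Longrightarrow> S \<in> Obj C"
  unfolding simple_obj_def by blast

lemma not_iso_zero:
  assumes "simple_obj C S" "simple_obj C T" "\<not> iso_obj C S T" "\<guillemotleft>f : S \<rightarrow> T\<guillemotright>"
  shows "f = \<zero>\<^bsub>Mor C S T\<^esub>"
  using Schur[OF assms(1,2,4)] assms(3) unfolding iso_obj_def by blast

lemma iso_obj_sym:
  assumes "iso_obj C A B" "A \<in> Obj C" "B \<in> Obj C"
  shows "iso_obj C B A"
  using assms unfolding iso_obj_def iso_mor_def inverse_mors_iff[OF assms(2,3)] inverse_mors_iff[OF assms(3,2)] by blast

lemma direct_sumD:
  assumes "direct_sum C A m B i p"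
  shows "A \<in> Obj C" "\<And>j. j < m \<Longrightarrow> \<guillemotleft>i j : B j \<rightarrow> A\<guillemotright>" "\<And>j. j < m \<Longrightarrow> \<guillemotleft>p j : A \<rightarrow> B j\<guillemotright>"
    "\<And>j. j < m \<Longrightarrow> p j \<cdot> i j = \<one>\<^sub>m (B j)"
    "\<And>j l. j < m \<Longrightarrow> l < m \<Longrightarrow> j \<noteq> l \<Longrightarrow> p j \<cdot> i l = \<zero>\<^bsub>Mor C (B l) (B j)\<^esub>"
    "finsum (Mor C A A) (\<lambda>j. i j \<cdot> p j) {..<m} = \<one>\<^sub>m A"
  using assms unfolding direct_sum_def by auto

text \<open>
  To compute with a morphism into a direct sum one needs only those summands in which it
  has a component. The next lemma is the dual statement.
\<close>

lemma direct_sum_mor_to: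
  assumes d: "direct_sum C A m B i p" and J: "J \<subseteq> {..<m}" and f: "\<guillemotleft>f : D \<rightarrow> A\<guillemotright>"
    and z: "\<And>j. j < m \<Longrightarrow> j \<notin> J \<Longrightarrow> p j \<cdot> f = \<zero>\<^bsub>Mor C D (B j)\<^esub>"
  shows "finsum (Mor C A A) (\<lambda>j. i j \<cdot> p j) J \<cdot> f = f"
proof -
  note D = direct_sumD[OF d]
  have "f = finsum (Mor C A A) (\<lambda>j. i j \<cdot> p j) {..<m} \<cdot> f" using D f by simp
  also have "\<dots> = finsum (Mor C D A) (\<lambda>j. (i j \<cdot> p j) \<cdot> f) {..<m}"
    using D f by (intro cmp_finsum_right) auto
  also have "\<dots> = finsum (Mor C D A) (\<lambda>j. (i j \<cdot> p j) \<cdot> f) J"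
    using D f J z by (intro finsum_restrict) auto
  also have "\<dots> = finsum (Mor C A A) (\<lambda>j. i j \<cdot> p j) J \<cdot> f"
    using D f J by (intro cmp_finsum_right[symmetric]) auto
  finally show ?thesis by simp
qed

lemma direct_sum_mor_from:
  assumes d: "direct_sum C A m B i p" and J: "J \<subseteq> {..<m}" and f: "\<guillemotleft>f : A \<rightarrow> D\<guillemotright>"
    and z: "\<And>j. j < m \<Longrightarrow> j \<notin> J \<Longrightarrow> f \<cdot> i j = \<zero>\<^bsub>Mor C (B j) D\<^esub>"
  shows "f \<cdot> finsum (Mor C A A) (\<lambda>j. i j \<cdot> p j) J = f"
proof -
  note D = direct_sumD[OF d]
  have z': "f \<cdot> i j \<cdot> p j = \<zero>\<^bsub>Mor C A D\<^esub>" if "j < m" "j \<notin> J" for j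
    using D f that cmp_extend[OF z[OF that], of "p j"] by simp
  have "f = f \<cdot> finsum (Mor C A A) (\<lambda>j. i j \<cdot> p j) {..<m}" using D f by simp
  also have "\<dots> = finsum (Mor C A D) (\<lambda>j. f \<cdot> i j \<cdot> p j) {..<m}"
    using D f by (intro cmp_finsum_left) auto
  also have "\<dots> = finsum (Mor C A D) (\<lambda>j. f \<cdot> i j \<cdot> p j) J"
    using D f J z' by (intro finsum_restrict) auto
  also have "\<dots> = f \<cdot> finsum (Mor C A A) (\<lambda>j. i j \<cdot> p j) J"
    using D f J by (intro cmp_finsum_left[symmetric]) auto
  finally show ?thesis by simp
qed

section \<open>The flip through the trivial part\<close>

text \<open>
  The families \<open>a\<close> and \<open>b\<close> consist of injections and projections of copies of \<open>\<I>\<close> that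
  exhaust the trivial part of \<open>A\<close>. The definition records this by the effect of
  \<open>\<Sum>j. a j \<cdot> b j\<close> on morphisms from and to \<open>\<I>\<close>, through which two such families are compared.
\<close>

definition dual_family where
  "dual_family A J a b \<longleftrightarrow> A \<in> Obj C \<and> finite J \<and>
     (\<forall>j\<in>J. \<guillemotleft>a j : \<I> \<rightarrow> A\<guillemotright> \<and> \<guillemotleft>b j : A \<rightarrow> \<I>\<guillemotright>) \<and>
     (\<forall>f. \<guillemotleft>f : \<I> \<rightarrow> A\<guillemotright> \<longrightarrow> finsum (Mor C A A) (\<lambda>j. a j \<cdot> b j) J \<cdot> f = f) \<and>
     (\<forall>g. \<guillemotleft>g : A \<rightarrow> \<I>\<guillemotright> \<longrightarrow> g \<cdot> finsum (Mor C A A) (\<lambda>j. a j \<cdot> b j) J = g)"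

lemma dual_familyD:
  assumes "dual_family A J a b"
  shows "A \<in> Obj C" "finite J" "\<And>j. j \<in> J \<Longrightarrow> \<guillemotleft>a j : \<I> \<rightarrow> A\<guillemotright>" "\<And>j. j \<in> J \<Longrightarrow> \<guillemotleft>b j : A \<rightarrow> \<I>\<guillemotright>"
    "\<And>f. \<guillemotleft>f : \<I> \<rightarrow> A\<guillemotright> \<Longrightarrow> finsum (Mor C \<I> A) (\<lambda>j. a j \<cdot> b j \<cdot> f) J = f"
    "\<And>g. \<guillemotleft>g : A \<rightarrow> \<I>\<guillemotright> \<Longrightarrow> finsum (Mor C A \<I>) (\<lambda>j. g \<cdot> a j \<cdot> b j) J = g"
proof -
  show A: "A \<in> Obj C" "finite J" and ab: "\<And>j. j \<in> J \<Longrightarrow> \<guillemotleft>a j : \<I> \<rightarrow> A\<guillemotright>" "\<And>j. j \<in> J \<Longrightarrow> \<guillemotleft>b j : A \<rightarrow> \<I>\<guillemotright>"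
    using assms unfolding dual_family_def by auto
  show "finsum (Mor C \<I> A) (\<lambda>j. a j \<cdot> b j \<cdot> f) J = f" if f: "\<guillemotleft>f : \<I> \<rightarrow> A\<guillemotright>" for f
  proof -
    have "f = finsum (Mor C A A) (\<lambda>j. a j \<cdot> b j) J \<cdot> f"
      using assms f unfolding dual_family_def by simp
    also have "\<dots> = finsum (Mor C \<I> A) (\<lambda>j. (a j \<cdot> b j) \<cdot> f) J"
      using f ab by (intro cmp_finsum_right) auto
    also have "\<dots> = finsum (Mor C \<I> A) (\<lambda>j. a j \<cdot> b j \<cdot> f) J"
      using f ab by (intro mor_finsum_cong) auto
    finally show ?thesis by simp
  qed
  show "finsum (Mor C A \<I>) (\<lambda>j. g \<cdot> a j \<cdot> b j) J = g" if g: "\<guillemotleft>g : A \<rightarrow> \<I>\<guillemotright>" for g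
  proof -
    have "g = g \<cdot> finsum (Mor C A A) (\<lambda>j. a j \<cdot> b j) J"
      using assms g unfolding dual_family_def by simp
    also have "\<dots> = finsum (Mor C A \<I>) (\<lambda>j. g \<cdot> a j \<cdot> b j) J"
      using g ab by (intro cmp_finsum_left) auto
    finally show ?thesis by simp
  qed
qed

text \<open>
  Take the summands isomorphic to \<open>\<I>\<close> in a decomposition into simple objects. By Schur's lemma
  the others have no nonzero morphism from or to \<open>\<I>\<close>.
\<close>

lemma ex_dual_family:
  assumes "A \<in> Obj C"
  shows "\<exists>J a b. dual_family A (J :: nat set) a b"
proof -
  obtain m S i p where S: "\<forall>j<m. simple_obj C (S j)" and d: "direct_sum C A m S i p"
    using ex_simple_decomposition[OF assms] by blast
  note D = direct_sumD[OF d]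
  define J where "J = {j. j < m \<and> iso_obj C \<I> (S j)}"
  have J: "J \<subseteq> {..<m}" unfolding J_def by blast
  have "\<forall>j\<in>J. \<exists>u v. inverse_mors C \<I> (S j) u v"
    unfolding J_def iso_obj_def iso_mor_def by blast
  then obtain u v where uv: "\<And>j. j \<in> J \<Longrightarrow> inverse_mors C \<I> (S j) (u j) (v j)" by metis
  have u: "\<guillemotleft>u j : \<I> \<rightarrow> S j\<guillemotright>" "\<guillemotleft>v j : S j \<rightarrow> \<I>\<guillemotright>" "u j \<cdot> v j = \<one>\<^sub>m (S j)" if "j \<in> J" for j
    using uv[OF that] D that J by auto
  \<comment> \<open>The isomorphisms \<open>u j\<close> cancel, so the idempotent of the family is that of the chosen summands.\<close>
  have e: "finsum (Mor C A A) (\<lambda>j. (i j \<cdot> u j) \<cdot> (v j \<cdot> p j)) J = finsum (Mor C A A) (\<lambda>j. i j \<cdot> p j) J"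
  proof (rule mor_finsum_cong)
    fix j assume j: "j \<in> J"
    show "(i j \<cdot> u j) \<cdot> (v j \<cdot> p j) = i j \<cdot> p j"
      using D u[OF j] j J cmp_extend[OF u(3)[OF j], of "p j"] by auto
    show "\<guillemotleft>i j \<cdot> p j : A \<rightarrow> A\<guillemotright>" using D j J by auto
  qed (use D in auto)
  have "dual_family A J (\<lambda>j. i j \<cdot> u j) (\<lambda>j. v j \<cdot> p j)"
    unfolding dual_family_def e
  proof (intro conjI allI impI ballI)
    show "finite J" using J by (rule finite_subset) simp
    fix f assume f: "\<guillemotleft>f : \<I> \<rightarrow> A\<guillemotright>"
    show "finsum (Mor C A A) (\<lambda>j. i j \<cdot> p j) J \<cdot> f = f"
      using f D S by (intro direct_sum_mor_to[OF d J, where D = \<I>] not_iso_zero) (auto simp: J_def simple_unt)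
  next
    fix f assume f: "\<guillemotleft>f : A \<rightarrow> \<I>\<guillemotright>"
    show "f \<cdot> finsum (Mor C A A) (\<lambda>j. i j \<cdot> p j) J = f"
      using f D S by (intro direct_sum_mor_from[OF d J, where D = \<I>] not_iso_zero)
        (auto simp: J_def simple_unt dest: iso_obj_sym)
  qed (use D u J in auto)
  then show ?thesis by blast
qed

text \<open>
  An endomorphism of \<open>\<I>\<close> is a scalar, and scalars may be moved across a tensor product.
\<close>

lemma scalar_tmo:
  assumes "\<guillemotleft>l : \<I> \<rightarrow> \<I>\<guillemotright>" "X \<in> Obj C"
  shows "l \<boxdot> \<one>\<^sub>m X = \<one>\<^sub>m X \<boxdot> l"
proof -
  have "l \<in> (\<lambda>c. c \<odot>\<^bsub>Mor C \<I> \<I>\<^esub> \<one>\<^sub>m \<I>) ` carrier K"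
    using end_simple[OF simple_unt] assms(1) unfolding bij_betw_def by simp
  then obtain c where c: "c \<in> carrier K" "l = c \<odot>\<^bsub>Mor C \<I> \<I>\<^esub> \<one>\<^sub>m \<I>" by blast
  show ?thesis
    using tmo_smult_left[of \<I> \<I> X X "\<one>\<^sub>m \<I>" "\<one>\<^sub>m X" c] tmo_smult_right[of X X \<I> \<I> "\<one>\<^sub>m X" "\<one>\<^sub>m \<I>" c]
      c assms(2) by simp
qed

text \<open>
  Change of basis. The morphism \<open>h\<close> has the matrix \<open>b' l \<cdot> h \<cdot> a j\<close> of endomorphisms of \<open>\<I>\<close>; the
  left-hand side expands \<open>h \<cdot> a j\<close> and the right-hand side \<open>b' l \<cdot> h\<close> by this matrix, and
  its entries pass from one tensor factor to the other. With \<open>h = id\<close> it shows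
  that the sum does not depend on the family.
\<close>

lemma dual_family_natural:
  assumes F: "dual_family A J a b" and F': "dual_family A' L a' b'"
    and h: "\<guillemotleft>h : A \<rightarrow> A'\<guillemotright>" and X: "X \<in> Obj C"
  shows "finsum (Mor C (X \<boxtimes> A) (A' \<boxtimes> X)) (\<lambda>j. ((h \<cdot> a j) \<boxdot> \<one>\<^sub>m X) \<cdot> (\<one>\<^sub>m X \<boxdot> b j)) J
       = finsum (Mor C (X \<boxtimes> A) (A' \<boxtimes> X)) (\<lambda>l. (a' l \<boxdot> \<one>\<^sub>m X) \<cdot> (\<one>\<^sub>m X \<boxdot> (b' l \<cdot> h))) L"
proof -
  note D = dual_familyD[OF F] and D' = dual_familyD[OF F']
  let ?l = "\<lambda>l j. b' l \<cdot> h \<cdot> a j"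
  have scal: "\<guillemotleft>?l l j : \<I> \<rightarrow> \<I>\<guillemotright>" if "l \<in> L" "j \<in> J" for l j
    using D D' h that by simp
  let ?t = "\<lambda>j l. (a' l \<boxdot> \<one>\<^sub>m X) \<cdot> (\<one>\<^sub>m X \<boxdot> (?l l j \<cdot> b j))"
  have t: "\<guillemotleft>?t j l : X \<boxtimes> A \<rightarrow> A' \<boxtimes> X\<guillemotright>" if "l \<in> L" "j \<in> J" for l j
    using D D' h that X by simp
  have 1: "((h \<cdot> a j) \<boxdot> \<one>\<^sub>m X) \<cdot> (\<one>\<^sub>m X \<boxdot> b j) = finsum (Mor C (X \<boxtimes> A) (A' \<boxtimes> X)) (?t j) L"
    if j: "j \<in> J" for j
  proof -
    have "(h \<cdot> a j) \<boxdot> \<one>\<^sub>m X = finsum (Mor C \<I> A') (\<lambda>l. a' l \<cdot> ?l l j) L \<boxdot> \<one>\<^sub>m X"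
      using D'(5)[of "h \<cdot> a j"] D h j by simp
    also have "\<dots> = finsum (Mor C (\<I> \<boxtimes> X) (A' \<boxtimes> X)) (\<lambda>l. (a' l \<cdot> ?l l j) \<boxdot> \<one>\<^sub>m X) L"
      using D D' h j X by (intro tmo_finsum_left) auto
    finally have "((h \<cdot> a j) \<boxdot> \<one>\<^sub>m X) \<cdot> (\<one>\<^sub>m X \<boxdot> b j)
        = finsum (Mor C X (A' \<boxtimes> X)) (\<lambda>l. (a' l \<cdot> ?l l j) \<boxdot> \<one>\<^sub>m X) L \<cdot> (\<one>\<^sub>m X \<boxdot> b j)"
      using X by simp
    also have "\<dots> = finsum (Mor C (X \<boxtimes> A) (A' \<boxtimes> X)) (\<lambda>l. ((a' l \<cdot> ?l l j) \<boxdot> \<one>\<^sub>m X) \<cdot> (\<one>\<^sub>m X \<boxdot> b j)) L"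
      using D D' h j X by (intro cmp_finsum_right) auto
    also have "\<dots> = finsum (Mor C (X \<boxtimes> A) (A' \<boxtimes> X)) (?t j) L"
    proof (rule mor_finsum_cong)
      fix l assume l: "l \<in> L"
      have "((a' l \<cdot> ?l l j) \<boxdot> \<one>\<^sub>m X) \<cdot> (\<one>\<^sub>m X \<boxdot> b j) = ((a' l \<boxdot> \<one>\<^sub>m X) \<cdot> (?l l j \<boxdot> \<one>\<^sub>m X)) \<cdot> (\<one>\<^sub>m X \<boxdot> b j)"
        using D D' h j l X by simp
      also have "\<dots> = ((a' l \<boxdot> \<one>\<^sub>m X) \<cdot> (\<one>\<^sub>m X \<boxdot> ?l l j)) \<cdot> (\<one>\<^sub>m X \<boxdot> b j)"
        using scalar_tmo[OF scal[OF l j] X] by simp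
      also have "\<dots> = ?t j l" using D D' h j l X by simp
      finally show "((a' l \<cdot> ?l l j) \<boxdot> \<one>\<^sub>m X) \<cdot> (\<one>\<^sub>m X \<boxdot> b j) = ?t j l" .
    qed (use t j D D' X in auto)
    finally show ?thesis .
  qed
  have 2: "(a' l \<boxdot> \<one>\<^sub>m X) \<cdot> (\<one>\<^sub>m X \<boxdot> (b' l \<cdot> h)) = finsum (Mor C (X \<boxtimes> A) (A' \<boxtimes> X)) (\<lambda>j. ?t j l) J"
    if l: "l \<in> L" for l
  proof -
    have "finsum (Mor C A \<I>) (\<lambda>j. ?l l j \<cdot> b j) J = b' l \<cdot> h"
      using D(6)[of "b' l \<cdot> h"] D D' h l
        mor_finsum_cong[of J "\<lambda>j. (b' l \<cdot> h) \<cdot> a j \<cdot> b j" "\<lambda>j. ?l l j \<cdot> b j" A \<I>] by simp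
    then have "\<one>\<^sub>m X \<boxdot> (b' l \<cdot> h) = \<one>\<^sub>m X \<boxdot> finsum (Mor C A \<I>) (\<lambda>j. ?l l j \<cdot> b j) J"
      by simp
    also have "\<dots> = finsum (Mor C (X \<boxtimes> A) (X \<boxtimes> \<I>)) (\<lambda>j. \<one>\<^sub>m X \<boxdot> (?l l j \<cdot> b j)) J"
      using D D' h l X by (intro tmo_finsum_right) auto
    finally have "(a' l \<boxdot> \<one>\<^sub>m X) \<cdot> (\<one>\<^sub>m X \<boxdot> (b' l \<cdot> h)) =
      (a' l \<boxdot> \<one>\<^sub>m X) \<cdot> finsum (Mor C (X \<boxtimes> A) X) (\<lambda>j. \<one>\<^sub>m X \<boxdot> (?l l j \<cdot> b j)) J"
      using X by simp
    also have "\<dots> = finsum (Mor C (X \<boxtimes> A) (A' \<boxtimes> X)) (\<lambda>j. ?t j l) J"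
      using D D' h l X by (intro cmp_finsum_left) auto
    finally show ?thesis .
  qed
  have "finsum (Mor C (X \<boxtimes> A) (A' \<boxtimes> X)) (\<lambda>j. ((h \<cdot> a j) \<boxdot> \<one>\<^sub>m X) \<cdot> (\<one>\<^sub>m X \<boxdot> b j)) J
      = finsum (Mor C (X \<boxtimes> A) (A' \<boxtimes> X)) (\<lambda>j. finsum (Mor C (X \<boxtimes> A) (A' \<boxtimes> X)) (?t j) L) J"
    using 1 t D D' X by (intro mor_finsum_cong) auto
  also have "\<dots> = finsum (Mor C (X \<boxtimes> A) (A' \<boxtimes> X)) (\<lambda>l. finsum (Mor C (X \<boxtimes> A) (A' \<boxtimes> X)) (\<lambda>j. ?t j l) J) L"
    using t D D' X by (intro finsum_swap) auto
  also have "\<dots> = finsum (Mor C (X \<boxtimes> A) (A' \<boxtimes> X)) (\<lambda>l. (a' l \<boxdot> \<one>\<^sub>m X) \<cdot> (\<one>\<^sub>m X \<boxdot> (b' l \<cdot> h))) L"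
    using 2 D D' h X by (intro mor_finsum_cong) auto
  finally show ?thesis .
qed

text \<open>
  The flip \<open>X \<boxtimes> A \<rightarrow> A \<boxtimes> X\<close> through the trivial part of \<open>A\<close>. Unlike \<open>\<tau>\<close> it is defined for all
  objects \<open>A\<close>, at the price of not being invertible in general.
\<close>

definition partial_flip ("\<sigma>") where
  "\<sigma> X A = (case (SOME (J :: nat set, a, b). dual_family A J a b) of
     (J, a, b) \<Rightarrow> finsum (Mor C (X \<boxtimes> A) (A \<boxtimes> X)) (\<lambda>j. (a j \<boxdot> \<one>\<^sub>m X) \<cdot> (\<one>\<^sub>m X \<boxdot> b j)) J)"

lemma partial_flip_eq:
  assumes F: "dual_family A J a b" and X: "X \<in> Obj C"
  shows "\<sigma> X A = finsum (Mor C (X \<boxtimes> A) (A \<boxtimes> X)) (\<lambda>j. (a j \<boxdot> \<one>\<^sub>m X) \<cdot> (\<one>\<^sub>m X \<boxdot> b j)) J"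
proof -
  note D = dual_familyD[OF F]
  obtain L :: "nat set" and a' b' where
    L: "(SOME (J :: nat set, a, b). dual_family A J a b) = (L, a', b')" by (metis prod_cases3)
  have "\<exists>x. (\<lambda>(J :: nat set, a, b). dual_family A J a b) x"
    using ex_dual_family[OF D(1)] by auto
  from someI_ex[OF this] have F': "dual_family A L a' b'" unfolding L by simp
  note D' = dual_familyD[OF F']
  have "\<sigma> X A = finsum (Mor C (X \<boxtimes> A) (A \<boxtimes> X)) (\<lambda>j. (a' j \<boxdot> \<one>\<^sub>m X) \<cdot> (\<one>\<^sub>m X \<boxdot> b' j)) L"
    unfolding partial_flip_def L by simp
  also have "\<dots> = finsum (Mor C (X \<boxtimes> A) (A \<boxtimes> X)) (\<lambda>j. ((\<one>\<^sub>m A \<cdot> a' j) \<boxdot> \<one>\<^sub>m X) \<cdot> (\<one>\<^sub>m X \<boxdot> b' j)) L"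
    using D' X by (intro mor_finsum_cong) auto
  also have "\<dots> = finsum (Mor C (X \<boxtimes> A) (A \<boxtimes> X)) (\<lambda>l. (a l \<boxdot> \<one>\<^sub>m X) \<cdot> (\<one>\<^sub>m X \<boxdot> (b l \<cdot> \<one>\<^sub>m A))) J"
    using D(1) X by (intro dual_family_natural[OF F' F]) auto
  also have "\<dots> = finsum (Mor C (X \<boxtimes> A) (A \<boxtimes> X)) (\<lambda>j. (a j \<boxdot> \<one>\<^sub>m X) \<cdot> (\<one>\<^sub>m X \<boxdot> b j)) J"
    using D X by (intro mor_finsum_cong) auto
  finally show ?thesis .
qed

lemma partial_flip_mor [simp]:
  assumes "X \<in> Obj C" "A \<in> Obj C"
  shows "arr (\<sigma> X A)" "src (\<sigma> X A) = X \<boxtimes> A" "tgt (\<sigma> X A) = A \<boxtimes> X"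
proof -
  obtain J :: "nat set" and a b where F: "dual_family A J a b" using ex_dual_family[OF assms(2)] by blast
  show "arr (\<sigma> X A)" "src (\<sigma> X A) = X \<boxtimes> A" "tgt (\<sigma> X A) = A \<boxtimes> X"
    unfolding partial_flip_eq[OF F assms(1)] using dual_familyD[OF F] assms by auto
qed

lemma partial_flip_nat_right:
  assumes h: "\<guillemotleft>h : A \<rightarrow> A'\<guillemotright>" and X: "X \<in> Obj C"
  shows "(h \<boxdot> \<one>\<^sub>m X) \<cdot> \<sigma> X A = \<sigma> X A' \<cdot> (\<one>\<^sub>m X \<boxdot> h)"
proof -
  obtain J :: "nat set" and a b where F: "dual_family A J a b" using ex_dual_family[of A] h by blast
  obtain L :: "nat set" and a' b' where F': "dual_family A' L a' b'" using ex_dual_family[of A'] h by blast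
  note D = dual_familyD[OF F] and D' = dual_familyD[OF F']
  have "(h \<boxdot> \<one>\<^sub>m X) \<cdot> \<sigma> X A
      = finsum (Mor C (X \<boxtimes> A) (A' \<boxtimes> X)) (\<lambda>j. (h \<boxdot> \<one>\<^sub>m X) \<cdot> (a j \<boxdot> \<one>\<^sub>m X) \<cdot> (\<one>\<^sub>m X \<boxdot> b j)) J"
    unfolding partial_flip_eq[OF F X] using D h X by (intro cmp_finsum_left) auto
  also have "\<dots> = finsum (Mor C (X \<boxtimes> A) (A' \<boxtimes> X)) (\<lambda>j. ((h \<cdot> a j) \<boxdot> \<one>\<^sub>m X) \<cdot> (\<one>\<^sub>m X \<boxdot> b j)) J"
    using D h X by (intro mor_finsum_cong) auto
  also have "\<dots> = finsum (Mor C (X \<boxtimes> A) (A' \<boxtimes> X)) (\<lambda>l. (a' l \<boxdot> \<one>\<^sub>m X) \<cdot> (\<one>\<^sub>m X \<boxdot> (b' l \<cdot> h))) L"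
    by (rule dual_family_natural[OF F F' h X])
  also have "\<dots> = finsum (Mor C (X \<boxtimes> A) (A' \<boxtimes> X)) (\<lambda>l. ((a' l \<boxdot> \<one>\<^sub>m X) \<cdot> (\<one>\<^sub>m X \<boxdot> b' l)) \<cdot> (\<one>\<^sub>m X \<boxdot> h)) L"
    using D' h X by (intro mor_finsum_cong) auto
  also have "\<dots> = \<sigma> X A' \<cdot> (\<one>\<^sub>m X \<boxdot> h)"
    unfolding partial_flip_eq[OF F' X] using D' h X by (intro cmp_finsum_right[symmetric]) auto
  finally show ?thesis .
qed

lemma partial_flip_nat_left:
  assumes x: "\<guillemotleft>x : X \<rightarrow> X'\<guillemotright>" and A: "A \<in> Obj C"
  shows "(\<one>\<^sub>m A \<boxdot> x) \<cdot> \<sigma> X A = \<sigma> X' A \<cdot> (x \<boxdot> \<one>\<^sub>m A)"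
proof -
  obtain J :: "nat set" and a b where F: "dual_family A J a b" using ex_dual_family[OF A] by blast
  note D = dual_familyD[OF F]
  have X: "X \<in> Obj C" "X' \<in> Obj C" using x by auto
  have eq: "(\<one>\<^sub>m A \<boxdot> x) \<cdot> (a j \<boxdot> \<one>\<^sub>m X) \<cdot> (\<one>\<^sub>m X \<boxdot> b j) = ((a j \<boxdot> \<one>\<^sub>m X') \<cdot> (\<one>\<^sub>m X' \<boxdot> b j)) \<cdot> (x \<boxdot> \<one>\<^sub>m A)"
    if j: "j \<in> J" for j
  proof -
    have "(\<one>\<^sub>m A \<boxdot> x) \<cdot> (a j \<boxdot> \<one>\<^sub>m X) = (a j \<boxdot> \<one>\<^sub>m X') \<cdot> x"
      using D j x interchange[of "\<one>\<^sub>m \<I>" "a j" x "\<one>\<^sub>m X'"] by simp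
    moreover have "(\<one>\<^sub>m X' \<boxdot> b j) \<cdot> (x \<boxdot> \<one>\<^sub>m A) = x \<cdot> (\<one>\<^sub>m X \<boxdot> b j)"
      using D j x interchange[of "\<one>\<^sub>m X" x "b j" "\<one>\<^sub>m \<I>"] by simp
    ultimately show ?thesis
      using D j x cmp_extend[of "\<one>\<^sub>m A \<boxdot> x" "a j \<boxdot> \<one>\<^sub>m X" "(a j \<boxdot> \<one>\<^sub>m X') \<cdot> x" "\<one>\<^sub>m X \<boxdot> b j"]
      by (simp del: interchange interchange_assoc)
  qed
  have "(\<one>\<^sub>m A \<boxdot> x) \<cdot> \<sigma> X A
      = finsum (Mor C (X \<boxtimes> A) (A \<boxtimes> X')) (\<lambda>j. (\<one>\<^sub>m A \<boxdot> x) \<cdot> (a j \<boxdot> \<one>\<^sub>m X) \<cdot> (\<one>\<^sub>m X \<boxdot> b j)) J"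
    unfolding partial_flip_eq[OF F X(1)] using D x by (intro cmp_finsum_left) auto
  also have "\<dots> = finsum (Mor C (X \<boxtimes> A) (A \<boxtimes> X')) (\<lambda>j. ((a j \<boxdot> \<one>\<^sub>m X') \<cdot> (\<one>\<^sub>m X' \<boxdot> b j)) \<cdot> (x \<boxdot> \<one>\<^sub>m A)) J"
    using D x eq by (intro mor_finsum_cong) auto
  also have "\<dots> = \<sigma> X' A \<cdot> (x \<boxdot> \<one>\<^sub>m A)"
    unfolding partial_flip_eq[OF F X(2)] using D x by (intro cmp_finsum_right[symmetric]) auto
  finally show ?thesis .
qed

lemma partial_flip_unt [simp]:
  assumes X: "X \<in> Obj C"
  shows "\<sigma> X \<I> = \<one>\<^sub>m X"
proof -
  interpret M: abelian_group "Mor C \<I> \<I>" by (intro mor_abelian_group) auto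
  have one: "finsum (Mor C \<I> \<I>) (\<lambda>j. \<one>\<^sub>m \<I> \<cdot> \<one>\<^sub>m \<I>) {0 :: nat} = \<one>\<^sub>m \<I>"
    by (subst finsum_single[of _ 0]) auto
  \<comment> \<open>The unit is its own trivial part, with the identity as basis.\<close>
  have F: "dual_family \<I> {0 :: nat} (\<lambda>_. \<one>\<^sub>m \<I>) (\<lambda>_. \<one>\<^sub>m \<I>)"
    unfolding dual_family_def one by simp
  show ?thesis
    unfolding partial_flip_eq[OF F X] using X by (subst finsum_single[of _ 0]) auto
qed

text \<open>
  For trivial \<open>T\<close> the inverse is the sum with the factors exchanged. Naturality of the flip in its
  trivial argument reduces both composites to \<open>\<sigma> X \<I> = id\<close>.
\<close>

lemma partial_flip_iso:
  assumes d: "direct_sum C T m (\<lambda>_. \<I>) i p" and X: "X \<in> Obj C"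
  shows "iso_mor C (X \<boxtimes> T) (T \<boxtimes> X) (\<sigma> X T)"
proof -
  note D = direct_sumD[OF d]
  let ?r = "finsum (Mor C (T \<boxtimes> X) (X \<boxtimes> T)) (\<lambda>j. (\<one>\<^sub>m X \<boxdot> i j) \<cdot> (p j \<boxdot> \<one>\<^sub>m X)) {..<m}"
  have r: "\<guillemotleft>?r : T \<boxtimes> X \<rightarrow> X \<boxtimes> T\<guillemotright>" using D X by (intro conjI finsum_mor) auto
  have 1: "?r \<cdot> \<sigma> X T = \<one>\<^sub>m (X \<boxtimes> T)"
  proof -
    have "?r \<cdot> \<sigma> X T = finsum (Mor C (X \<boxtimes> T) (X \<boxtimes> T)) (\<lambda>j. ((\<one>\<^sub>m X \<boxdot> i j) \<cdot> (p j \<boxdot> \<one>\<^sub>m X)) \<cdot> \<sigma> X T) {..<m}"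
      using D X by (intro cmp_finsum_right) auto
    also have "\<dots> = finsum (Mor C (X \<boxtimes> T) (X \<boxtimes> T)) (\<lambda>j. \<one>\<^sub>m X \<boxdot> (i j \<cdot> p j)) {..<m}"
      using D X by (intro mor_finsum_cong) (auto simp: partial_flip_nat_right[where A' = \<I>])
    also have "\<dots> = \<one>\<^sub>m X \<boxdot> finsum (Mor C T T) (\<lambda>j. i j \<cdot> p j) {..<m}"
      using D X by (intro tmo_finsum_right[symmetric]) auto
    finally show ?thesis using D X by simp
  qed
  have 2: "\<sigma> X T \<cdot> ?r = \<one>\<^sub>m (T \<boxtimes> X)"
  proof -
    have "\<sigma> X T \<cdot> ?r = finsum (Mor C (T \<boxtimes> X) (T \<boxtimes> X)) (\<lambda>j. \<sigma> X T \<cdot> (\<one>\<^sub>m X \<boxdot> i j) \<cdot> (p j \<boxdot> \<one>\<^sub>m X)) {..<m}"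
      using D X by (intro cmp_finsum_left) auto
    also have "\<dots> = finsum (Mor C (T \<boxtimes> X) (T \<boxtimes> X)) (\<lambda>j. (i j \<cdot> p j) \<boxdot> \<one>\<^sub>m X) {..<m}"
    proof (rule mor_finsum_cong)
      fix j assume "j \<in> {..<m}"
      then show "\<sigma> X T \<cdot> (\<one>\<^sub>m X \<boxdot> i j) \<cdot> (p j \<boxdot> \<one>\<^sub>m X) = (i j \<cdot> p j) \<boxdot> \<one>\<^sub>m X"
        using D X cmp_extend[OF partial_flip_nat_right[of "i j" \<I> T X, symmetric], of "p j \<boxdot> \<one>\<^sub>m X"] by simp
    qed (use D X in auto)
    also have "\<dots> = finsum (Mor C T T) (\<lambda>j. i j \<cdot> p j) {..<m} \<boxdot> \<one>\<^sub>m X"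
      using D X by (intro tmo_finsum_left[symmetric]) auto
    finally show ?thesis using D X by simp
  qed
  show ?thesis unfolding iso_mor_def using 1 2 r D X by (intro exI[of _ ?r]) auto
qed

lemma trivial_objD: "trivial_obj C T \<Longrightarrow> T \<in> Obj C"
  unfolding trivial_obj_def direct_sum_def by blast

lemma trivial_flip_partial_flip: "trivial_flip C \<sigma>"
  unfolding trivial_flip_def
proof (intro conjI ballI allI impI)
  fix V T assume "V \<in> Obj C" "trivial_obj C T"
  then show "iso_mor C (V \<boxtimes> T) (T \<boxtimes> V) (\<sigma> V T)"
    unfolding trivial_obj_def using partial_flip_iso by blast
next
  fix V W T T' f g
  assume VW: "V \<in> Obj C" "W \<in> Obj C" and "trivial_obj C T" "trivial_obj C T'"
    and "f \<in> \<H> V W" "g \<in> \<H> T T'"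
  moreover from this have T: "T \<in> Obj C" "T' \<in> Obj C" by (auto dest: trivial_objD)
  ultimately have f: "\<guillemotleft>f : V \<rightarrow> W\<guillemotright>" and g: "\<guillemotleft>g : T \<rightarrow> T'\<guillemotright>"
    by auto
  have "(g \<boxdot> f) \<cdot> \<sigma> V T = (\<one>\<^sub>m T' \<boxdot> f) \<cdot> (g \<boxdot> \<one>\<^sub>m V) \<cdot> \<sigma> V T" using f g by simp
  also have "\<dots> = (\<one>\<^sub>m T' \<boxdot> f) \<cdot> \<sigma> V T' \<cdot> (\<one>\<^sub>m V \<boxdot> g)" using partial_flip_nat_right[OF g] VW by simp
  also have "\<dots> = (\<sigma> W T' \<cdot> (f \<boxdot> \<one>\<^sub>m T')) \<cdot> (\<one>\<^sub>m V \<boxdot> g)"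
    using f g by (intro cmp_extend partial_flip_nat_left) auto
  also have "\<dots> = \<sigma> W T' \<cdot> (f \<boxdot> g)" using f g by simp
  finally show "(g \<boxdot> f) \<cdot> \<sigma> V T = \<sigma> W T' \<cdot> (f \<boxdot> g)" .
qed simp

text \<open>
  Naturality with respect to the injections \<open>\<I> \<rightarrow> T\<close> and the normalization at \<open>\<I>\<close> determine every
  flip.
\<close>

lemma trivial_flip_unique:
  assumes t: "trivial_flip C t" and V: "V \<in> Obj C" and T: "trivial_obj C T"
  shows "t V T = \<sigma> V T"
proof -
  obtain m i p where d: "direct_sum C T m (\<lambda>_. \<I>) i p" using T unfolding trivial_obj_def by blast
  note D = direct_sumD[OF d]
  have tr: "trivial_obj C \<I>"
    unfolding trivial_obj_def direct_sum_def
    by (intro exI[of _ 1] exI[of _ "\<lambda>_. \<one>\<^sub>m \<I>"], subst finsum_single[of _ 0]) auto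
  \<comment> \<open>The right-hand side does not mention \<open>s\<close>, so any two flips agree.\<close>
  have "s V T = finsum (Mor C (V \<boxtimes> T) (T \<boxtimes> V)) (\<lambda>j. (i j \<boxdot> \<one>\<^sub>m V) \<cdot> (\<one>\<^sub>m V \<boxdot> p j)) {..<m}"
    if s: "trivial_flip C s" for s
  proof -
    have sT: "\<guillemotleft>s V T : V \<boxtimes> T \<rightarrow> T \<boxtimes> V\<guillemotright>"
    proof -
      have "iso_mor C (V \<boxtimes> T) (T \<boxtimes> V) (s V T)" using s V T unfolding trivial_flip_def by blast
      then show ?thesis using V D unfolding iso_mor_def by auto
    qed
    have nat: "s V T \<cdot> (\<one>\<^sub>m V \<boxdot> i j) = i j \<boxdot> \<one>\<^sub>m V" if "j < m" for j
    proof -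
      have "\<one>\<^sub>m V \<in> \<H> V V" "i j \<in> \<H> \<I> T" "s V \<I> = \<one>\<^sub>m V"
        using D V that s unfolding trivial_flip_def by auto
      then have "(i j \<boxdot> \<one>\<^sub>m V) \<cdot> s V \<I> = s V T \<cdot> (\<one>\<^sub>m V \<boxdot> i j)"
        using s V T tr unfolding trivial_flip_def by blast
      then show ?thesis using \<open>s V \<I> = \<one>\<^sub>m V\<close> D that V by simp
    qed
    have "s V T = s V T \<cdot> (\<one>\<^sub>m V \<boxdot> finsum (Mor C T T) (\<lambda>j. i j \<cdot> p j) {..<m})"
      using D sT V by simp
    also have "\<dots> = s V T \<cdot> finsum (Mor C (V \<boxtimes> T) (V \<boxtimes> T)) (\<lambda>j. \<one>\<^sub>m V \<boxdot> (i j \<cdot> p j)) {..<m}"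
      using D V by (subst tmo_finsum_right) auto
    also have "\<dots> = finsum (Mor C (V \<boxtimes> T) (T \<boxtimes> V)) (\<lambda>j. s V T \<cdot> (\<one>\<^sub>m V \<boxdot> (i j \<cdot> p j))) {..<m}"
      using D V sT by (intro cmp_finsum_left) auto
    also have "\<dots> = finsum (Mor C (V \<boxtimes> T) (T \<boxtimes> V)) (\<lambda>j. (i j \<boxdot> \<one>\<^sub>m V) \<cdot> (\<one>\<^sub>m V \<boxdot> p j)) {..<m}"
    proof (rule mor_finsum_cong)
      fix j assume j: "j \<in> {..<m}"
      have "s V T \<cdot> (\<one>\<^sub>m V \<boxdot> (i j \<cdot> p j)) = s V T \<cdot> (\<one>\<^sub>m V \<boxdot> i j) \<cdot> (\<one>\<^sub>m V \<boxdot> p j)" using D j V by simp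
      also have "\<dots> = (i j \<boxdot> \<one>\<^sub>m V) \<cdot> (\<one>\<^sub>m V \<boxdot> p j)" using D j V sT by (intro cmp_extend nat) auto
      finally show "s V T \<cdot> (\<one>\<^sub>m V \<boxdot> (i j \<cdot> p j)) = (i j \<boxdot> \<one>\<^sub>m V) \<cdot> (\<one>\<^sub>m V \<boxdot> p j)" .
    qed (use D V in auto)
    finally show ?thesis .
  qed
  from this[OF t] this[OF trivial_flip_partial_flip] show ?thesis by simp
qed

lemma tau_eq_partial_flip:
  assumes "V \<in> Obj C" "trivial_obj C T"
  shows "tau C V T = \<sigma> V T"
  unfolding tau_def
  using trivial_flip_partial_flip trivial_flip_unique[OF _ assms] by (intro the_equality) blast+

lemma isotypical_hom_zero:
  assumes A: "isotypical C S A" and R: "simple_obj C R" and ne: "\<not> iso_obj C R S"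
    and g: "\<guillemotleft>g : A \<rightarrow> R\<guillemotright>"
  shows "g = \<zero>\<^bsub>Mor C A R\<^esub>"
proof -
  obtain m i p where S: "simple_obj C S" and d: "direct_sum C A m (\<lambda>_. S) i p"
    using A unfolding isotypical_def by blast
  note D = direct_sumD[OF d]
  interpret M: abelian_group "Mor C A A" using D by (intro mor_abelian_group) auto
  \<comment> \<open>Every component of \<open>g\<close> vanishes, so \<open>g\<close> factors through the empty sum of projections.\<close>
  have "g \<cdot> finsum (Mor C A A) (\<lambda>j. i j \<cdot> p j) {} = g"
    using D g S R ne by (intro direct_sum_mor_from[OF d, where D = R] not_iso_zero) (auto dest: iso_obj_sym)
  then show ?thesis using g by simp
qed

text \<open>
  By naturality the composite is \<open>\<sigma> X A \<cdot> (\<one>\<^sub>m X \<boxdot> \<iota> \<cdot> \<pi>)\<close>. The idempotent \<open>\<iota> \<cdot> \<pi>\<close> acts as the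
  identity on morphisms \<open>A \<rightarrow> \<I>\<close>, because the other isotypical components of \<open>A\<close> have no nonzero
  morphism to \<open>\<I>\<close>, and so it is absorbed by \<open>\<sigma> X A\<close>.
\<close>

lemma trivial_component_partial_flip:
  assumes tc: "trivial_component C A T \<iota> \<pi>" and X: "X \<in> Obj C" and A: "A \<in> Obj C"
  shows "(\<iota> \<boxdot> \<one>\<^sub>m X) \<cdot> tau C X T \<cdot> (\<one>\<^sub>m X \<boxdot> \<pi>) = \<sigma> X A"
    and "\<guillemotleft>\<iota> : T \<rightarrow> A\<guillemotright>" and "\<guillemotleft>\<pi> : A \<rightarrow> T\<guillemotright>" and "trivial_obj C T"
proof -
  obtain m S B i p j where T: "trivial_obj C T" and dec: "isotypical_decomposition C A m S B i p"
    and j: "j < m" "S j = \<I>" "B j = T" "i j = \<iota>" "p j = \<pi>"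
    using tc unfolding trivial_component_def by blast
  have d: "direct_sum C A m B i p" and iso: "\<And>l. l < m \<Longrightarrow> isotypical C (S l) (B l)"
    and ne: "\<And>l. l < m \<Longrightarrow> j \<noteq> l \<Longrightarrow> \<not> iso_obj C \<I> (S l)"
    using dec j unfolding isotypical_decomposition_def by auto
  note D = direct_sumD[OF d]
  have "\<guillemotleft>i j : B j \<rightarrow> A\<guillemotright>" "\<guillemotleft>p j : A \<rightarrow> B j\<guillemotright>" using D j by auto
  then show \<iota>: "\<guillemotleft>\<iota> : T \<rightarrow> A\<guillemotright>" and \<pi>: "\<guillemotleft>\<pi> : A \<rightarrow> T\<guillemotright>" using j by auto
  show "trivial_obj C T" by fact
  have e: "finsum (Mor C A A) (\<lambda>j. i j \<cdot> p j) {j} = \<iota> \<cdot> \<pi>"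
    using \<iota> \<pi> j by (subst finsum_single[of _ j]) auto
  have g: "g \<cdot> \<iota> \<cdot> \<pi> = g" if "\<guillemotleft>g : A \<rightarrow> \<I>\<guillemotright>" for g
  proof -
    have "g \<cdot> i l = \<zero>\<^bsub>Mor C (B l) \<I>\<^esub>" if l: "l < m" "l \<notin> {j}" for l
      using D l \<open>\<guillemotleft>g : A \<rightarrow> \<I>\<guillemotright>\<close> by (intro isotypical_hom_zero[OF iso simple_unt ne]) auto
    then show ?thesis
      using direct_sum_mor_from[OF d, of "{j}" g \<I>] j that unfolding e by simp
  qed
  obtain J :: "nat set" and a b where F: "dual_family A J a b" using ex_dual_family[OF A] by blast
  note D' = dual_familyD[OF F]
  have "(\<iota> \<boxdot> \<one>\<^sub>m X) \<cdot> tau C X T \<cdot> (\<one>\<^sub>m X \<boxdot> \<pi>) = (\<sigma> X A \<cdot> (\<one>\<^sub>m X \<boxdot> \<iota>)) \<cdot> (\<one>\<^sub>m X \<boxdot> \<pi>)"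
    unfolding tau_eq_partial_flip[OF X T] using \<iota> \<pi> X by (intro cmp_extend partial_flip_nat_right) auto
  also have "\<dots> = \<sigma> X A \<cdot> (\<one>\<^sub>m X \<boxdot> (\<iota> \<cdot> \<pi>))" using \<iota> \<pi> X by simp
  also have "\<dots> = finsum (Mor C (X \<boxtimes> A) (A \<boxtimes> X)) (\<lambda>j. ((a j \<boxdot> \<one>\<^sub>m X) \<cdot> (\<one>\<^sub>m X \<boxdot> b j)) \<cdot> (\<one>\<^sub>m X \<boxdot> (\<iota> \<cdot> \<pi>))) J"
    unfolding partial_flip_eq[OF F X] using D' X \<iota> \<pi> by (intro cmp_finsum_right) auto
  also have "\<dots> = \<sigma> X A"
    unfolding partial_flip_eq[OF F X] using D' X \<iota> \<pi> g by (intro mor_finsum_cong) auto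
  finally show "(\<iota> \<boxdot> \<one>\<^sub>m X) \<cdot> tau C X T \<cdot> (\<one>\<^sub>m X \<boxdot> \<pi>) = \<sigma> X A" .
qed

end


section \<open>Existence of right duals\<close>

context semisimple_monoidal_category
begin

lemma direct_sum_eqI:
  assumes d: "direct_sum C A m B i p" and f: "\<guillemotleft>f : A \<rightarrow> D\<guillemotright>" and g: "\<guillemotleft>g : A \<rightarrow> D\<guillemotright>"
    and eq: "\<And>j. j < m \<Longrightarrow> f \<cdot> i j = g \<cdot> i j"
  shows "f = g"
proof -
  note D = direct_sumD[OF d]
  have e: "h = finsum (Mor C A D) (\<lambda>j. (h \<cdot> i j) \<cdot> p j) {..<m}" if h: "\<guillemotleft>h : A \<rightarrow> D\<guillemotright>" for h
  proof -
    have "h = h \<cdot> finsum (Mor C A A) (\<lambda>j. i j \<cdot> p j) {..<m}" using D h by simp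
    also have "\<dots> = finsum (Mor C A D) (\<lambda>j. h \<cdot> i j \<cdot> p j) {..<m}"
      using D h by (intro cmp_finsum_left) auto
    also have "\<dots> = finsum (Mor C A D) (\<lambda>j. (h \<cdot> i j) \<cdot> p j) {..<m}"
      using D h by (intro mor_finsum_cong) auto
    finally show ?thesis .
  qed
  have "finsum (Mor C A D) (\<lambda>j. (f \<cdot> i j) \<cdot> p j) {..<m} = finsum (Mor C A D) (\<lambda>j. (g \<cdot> i j) \<cdot> p j) {..<m}"
    using D f g eq by (intro mor_finsum_cong) auto
  with e[OF f] e[OF g] show ?thesis by simp
qed

text \<open>
  An isomorphism is a direct sum with one summand. In this way transport of duals along
  isomorphisms is a special case of \<open>left_dual_direct_sum\<close>.
\<close>

lemma direct_sum_single:
  assumes "\<guillemotleft>u : A \<rightarrow> B\<guillemotright>" "\<guillemotleft>v : B \<rightarrow> A\<guillemotright>" "u \<cdot> v = \<one>\<^sub>m B" "v \<cdot> u = \<one>\<^sub>m A"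
  shows "direct_sum C A 1 (\<lambda>_. B) (\<lambda>_. v) (\<lambda>_. u)"
proof -
  have "finsum (Mor C A A) (\<lambda>j. v \<cdot> u) {..<1 :: nat} = \<one>\<^sub>m A"
    using assms by (subst finsum_single[of _ 0]) auto
  then show ?thesis unfolding direct_sum_def using assms by simp
qed

lemma ex_finite_direct_sum:
  "(\<And>j. j < m \<Longrightarrow> B j \<in> Obj C) \<Longrightarrow> \<exists>A i p. direct_sum C A m B i p"
proof (induction m)
  case 0
  obtain Z where Z: "zero_obj C Z" using ex_zero_obj by blast
  then have Z': "Z \<in> Obj C" unfolding zero_obj_def by blast
  interpret M: abelian_group "Mor C Z Z" using Z' by (intro mor_abelian_group) auto
  have "\<one>\<^sub>m Z = \<zero>\<^bsub>Mor C Z Z\<^esub>" using zero_obj_mor[OF Z, of "\<one>\<^sub>m Z"] Z' by simp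
  \<comment> \<open>There is nothing to inject or to project, so the families are arbitrary.\<close>
  then have "direct_sum C Z 0 B undefined undefined" unfolding direct_sum_def using Z' by simp
  then show ?case by blast
next
  case (Suc m)
  then obtain A i p where d: "direct_sum C A m B i p" by auto
  note D = direct_sumD[OF d]
  have B: "B m \<in> Obj C" using Suc by simp
  obtain S s r where e: "direct_sum C S 2 (\<lambda>j. if j = 0 then A else B m) s r"
    using ex_direct_sum[OF D(1) B] by blast
  note E = direct_sumD(1)[OF e] direct_sumD(2-4)[OF e, of 0] direct_sumD(2-4)[OF e, of 1]
    direct_sumD(5)[OF e, of 0 1] direct_sumD(5)[OF e, of 1 0] direct_sumD(6)[OF e]
  have s0: "\<guillemotleft>s 0 : A \<rightarrow> S\<guillemotright>" "\<guillemotleft>r 0 : S \<rightarrow> A\<guillemotright>" "r 0 \<cdot> s 0 = \<one>\<^sub>m A"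
    and s1: "\<guillemotleft>s 1 : B m \<rightarrow> S\<guillemotright>" "\<guillemotleft>r 1 : S \<rightarrow> B m\<guillemotright>" "r 1 \<cdot> s 1 = \<one>\<^sub>m (B m)"
    and s01: "r 0 \<cdot> s 1 = \<zero>\<^bsub>Mor C (B m) A\<^esub>" "r 1 \<cdot> s 0 = \<zero>\<^bsub>Mor C A (B m)\<^esub>"
    using E by simp_all
  interpret M: abelian_group "Mor C S S" using E(1) by (intro mor_abelian_group) auto
  have sum2: "(s 0 \<cdot> r 0) \<oplus>\<^bsub>Mor C S S\<^esub> (s 1 \<cdot> r 1) = \<one>\<^sub>m S"
  proof -
    have "{..<2 :: nat} = insert 1 {0}" by auto
    then have "finsum (Mor C S S) (\<lambda>j. s j \<cdot> r j) (insert 1 {0}) = \<one>\<^sub>m S" using E by simp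
    moreover have "finsum (Mor C S S) (\<lambda>j. s j \<cdot> r j) {0} = s 0 \<cdot> r 0"
      using s0 by (intro finsum_single) auto
    ultimately have "(s 1 \<cdot> r 1) \<oplus>\<^bsub>Mor C S S\<^esub> (s 0 \<cdot> r 0) = \<one>\<^sub>m S"
      using s0 s1 by (subst (asm) M.finsum_insert) auto
    then show ?thesis using s0 s1 by (subst M.a_comm) auto
  qed
  define i' where "i' j = (if j < m then s 0 \<cdot> i j else s 1)" for j
  define p' where "p' j = (if j < m then p j \<cdot> r 0 else r 1)" for j
  have mor: "\<guillemotleft>i' j : B j \<rightarrow> S\<guillemotright>" "\<guillemotleft>p' j : S \<rightarrow> B j\<guillemotright>" if "j < Suc m" for j
    using that D s0 s1 by (auto simp: i'_def p'_def less_Suc_eq)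
  have sum: "finsum (Mor C S S) (\<lambda>j. i' j \<cdot> p' j) {..<Suc m} = \<one>\<^sub>m S"
  proof -
    have "finsum (Mor C S S) (\<lambda>j. i' j \<cdot> p' j) {..<m} = finsum (Mor C S S) (\<lambda>j. s 0 \<cdot> (i j \<cdot> p j) \<cdot> r 0) {..<m}"
      using D s0 by (intro mor_finsum_cong) (auto simp: i'_def p'_def)
    also have "\<dots> = s 0 \<cdot> finsum (Mor C S A) (\<lambda>j. (i j \<cdot> p j) \<cdot> r 0) {..<m}"
      using D s0 by (intro cmp_finsum_left[symmetric]) auto
    also have "finsum (Mor C S A) (\<lambda>j. (i j \<cdot> p j) \<cdot> r 0) {..<m} = finsum (Mor C A A) (\<lambda>j. i j \<cdot> p j) {..<m} \<cdot> r 0"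
      using D s0 by (intro cmp_finsum_right[symmetric]) auto
    also have "s 0 \<cdot> \<dots> = s 0 \<cdot> r 0" using D s0 by simp
    finally have 1: "finsum (Mor C S S) (\<lambda>j. i' j \<cdot> p' j) {..<m} = s 0 \<cdot> r 0" .
    have "{..<Suc m} = insert m {..<m}" by auto
    then have "finsum (Mor C S S) (\<lambda>j. i' j \<cdot> p' j) {..<Suc m} = (i' m \<cdot> p' m) \<oplus>\<^bsub>Mor C S S\<^esub> (s 0 \<cdot> r 0)"
      using mor E(1) by (simp only:, subst M.finsum_insert) (auto simp: 1)
    also have "\<dots> = \<one>\<^sub>m S"
      using sum2 s0 s1 by (subst M.a_comm) (auto simp: i'_def p'_def)
    finally show ?thesis .
  qed
  have "p' j \<cdot> i' l = (if j = l then \<one>\<^sub>m (B j) else \<zero>\<^bsub>Mor C (B l) (B j)\<^esub>)"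
    if jl: "j < Suc m" "l < Suc m" for j l
  proof -
    consider "j < m" "l < m" | "j = m" "l < m" | "j < m" "l = m" | "j = m" "l = m"
      using jl by linarith
    then show ?thesis
    proof cases
      case 1
      have "(p j \<cdot> r 0) \<cdot> (s 0 \<cdot> i l) = p j \<cdot> i l"
        using 1 D s0 cmp_extend[OF s0(3), of "i l"] by simp
      then show ?thesis using 1 D by (auto simp: i'_def p'_def)
    next
      case 2
      have "r 1 \<cdot> s 0 \<cdot> i l = \<zero>\<^bsub>Mor C (B l) (B m)\<^esub>"
        using 2 D s0 s1 cmp_extend[OF s01(2), of "i l"] by simp
      then show ?thesis using 2 by (auto simp: i'_def p'_def)
    next
      case 3
      have "(p j \<cdot> r 0) \<cdot> s 1 = \<zero>\<^bsub>Mor C (B m) (B j)\<^esub>"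
        using 3 D s0 s1 s01 by simp
      then show ?thesis using 3 by (auto simp: i'_def p'_def)
    next
      case 4
      then show ?thesis using s1 by (auto simp: i'_def p'_def)
    qed
  qed
  then have "direct_sum C S (Suc m) B i' p'"
    unfolding direct_sum_def using mor sum E(1) Suc.prems by auto
  then show ?case by blast
qed

text \<open>
  Some component of \<open>f\<close> in a decomposition of \<open>A\<close> into simple objects is nonzero, hence an
  isomorphism by Schur's lemma.
\<close>

lemma simple_split:
  assumes S: "simple_obj C S" and f: "\<guillemotleft>f : S \<rightarrow> A\<guillemotright>" and nz: "f \<noteq> \<zero>\<^bsub>Mor C S A\<^esub>"
  shows "\<exists>g. \<guillemotleft>g : A \<rightarrow> S\<guillemotright> \<and> g \<cdot> f = \<one>\<^sub>m S"
proof -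
  obtain m R i p where R: "\<forall>j<m. simple_obj C (R j)" and d: "direct_sum C A m R i p"
    using ex_simple_decomposition[of A] f by blast
  note D = direct_sumD[OF d]
  interpret M: abelian_group "Mor C A A" using D by (intro mor_abelian_group) auto
  have "\<exists>j<m. p j \<cdot> f \<noteq> \<zero>\<^bsub>Mor C S (R j)\<^esub>"
  proof (rule ccontr)
    assume "\<not> (\<exists>j<m. p j \<cdot> f \<noteq> \<zero>\<^bsub>Mor C S (R j)\<^esub>)"
    then have "finsum (Mor C A A) (\<lambda>j. i j \<cdot> p j) {} \<cdot> f = f"
      using f by (intro direct_sum_mor_to[OF d]) auto
    then show False using f nz by simp
  qed
  then obtain j where j: "j < m" "p j \<cdot> f \<noteq> \<zero>\<^bsub>Mor C S (R j)\<^esub>" by blast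
  have "iso_mor C S (R j) (p j \<cdot> f)" using j R S D f by (intro Schur) auto
  then obtain h where "\<guillemotleft>h : R j \<rightarrow> S\<guillemotright>" "h \<cdot> p j \<cdot> f = \<one>\<^sub>m S"
    unfolding iso_mor_def using D j f by auto
  then show ?thesis using D j f by (intro exI[of _ "h \<cdot> p j"]) simp
qed

lemma cmp_smult [simp]:
  assumes "c \<in> carrier K" "arr f" "arr g" "src f = A" "tgt f = B" "src g = B" "tgt g = D"
  shows "g \<cdot> (c \<odot>\<^bsub>Mor C A B\<^esub> f) = c \<odot>\<^bsub>Mor C A (tgt g)\<^esub> (g \<cdot> f)"
    "(c \<odot>\<^bsub>Mor C B D\<^esub> g) \<cdot> f = c \<odot>\<^bsub>Mor C (src f) D\<^esub> (g \<cdot> f)"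
  using assms by (auto intro!: cmp_smult_left cmp_smult_right)

lemma tmo_smult [simp]:
  assumes "c \<in> carrier K" "arr f" "src f = A" "tgt f = B" "arr g"
  shows "g \<boxdot> (c \<odot>\<^bsub>Mor C A B\<^esub> f) = c \<odot>\<^bsub>Mor C (src g \<boxtimes> A) (tgt g \<boxtimes> B)\<^esub> (g \<boxdot> f)"
    "(c \<odot>\<^bsub>Mor C A B\<^esub> f) \<boxdot> g = c \<odot>\<^bsub>Mor C (A \<boxtimes> src g) (B \<boxtimes> tgt g)\<^esub> (f \<boxdot> g)"
  using assms by (auto intro!: tmo_smult_left tmo_smult_right)

definition scalar_endos where
  "scalar_endos A \<longleftrightarrow> A \<in> Obj C \<and>
     (\<forall>f. \<guillemotleft>f : A \<rightarrow> A\<guillemotright> \<longrightarrow> (\<exists>c\<in>carrier K. f = c \<odot>\<^bsub>Mor C A A\<^esub> \<one>\<^sub>m A))"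

lemma scalar_endos_simple:
  assumes S: "simple_obj C S"
  shows "scalar_endos S"
  using end_simple[OF S] S unfolding scalar_endos_def bij_betw_def by auto

text \<open>
  The transpose of an endomorphism \<open>h\<close> of \<open>P\<close> is an endomorphism of \<open>X\<close>, hence a scalar \<open>c\<close>, and
  \<open>h\<close> can be recovered from its transpose. Thus \<open>h = c\<close>.
\<close>

lemma scalar_endos_dual:
  assumes d: "left_dual C X P ev db" and X: "scalar_endos X"
  shows "scalar_endos P"
  unfolding scalar_endos_def
proof (intro conjI allI impI)
  note D [simp] = left_dualD[OF d]
  show "P \<in> Obj C" by simp
  fix h assume h: "\<guillemotleft>h : P \<rightarrow> P\<guillemotright>"
  let ?y = "ev \<cdot> (h \<boxdot> \<one>\<^sub>m X)"
  let ?g = "(\<one>\<^sub>m X \<boxdot> ?y) \<cdot> \<Phi> X P X \<cdot> (db \<boxdot> \<one>\<^sub>m X)"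
  obtain c where c: "c \<in> carrier K" "?g = c \<odot>\<^bsub>Mor C X X\<^esub> \<one>\<^sub>m X"
    using X h unfolding scalar_endos_def by (elim conjE allE[of _ ?g]) auto
  have "?y = ev \<cdot> (\<one>\<^sub>m P \<boxdot> ?g)" using h by (intro transpose_ev[OF d, symmetric]) auto
  also have "\<dots> = c \<odot>\<^bsub>Mor C (P \<boxtimes> X) \<I>\<^esub> ev"
    unfolding c(2) using c(1) by simp
  finally have y: "?y = c \<odot>\<^bsub>Mor C (P \<boxtimes> X) \<I>\<^esub> ev" .
  have nat: "\<Psi> P X P \<cdot> (h \<boxdot> \<one>\<^sub>m (X \<boxtimes> P)) = ((h \<boxdot> \<one>\<^sub>m X) \<boxdot> \<one>\<^sub>m P) \<cdot> \<Psi> P X P"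
    using asc_inv_nat[of h "\<one>\<^sub>m X" "\<one>\<^sub>m P"] h by simp
  have "h = ((ev \<boxdot> \<one>\<^sub>m P) \<cdot> \<Psi> P X P \<cdot> (\<one>\<^sub>m P \<boxdot> db)) \<cdot> h" using h by (simp del: cmp_assoc')
  also have "\<dots> = (ev \<boxdot> \<one>\<^sub>m P) \<cdot> \<Psi> P X P \<cdot> (h \<boxdot> \<one>\<^sub>m (X \<boxtimes> P)) \<cdot> (\<one>\<^sub>m P \<boxdot> db)"
    using h interchange[of h "\<one>\<^sub>m P" "\<one>\<^sub>m \<I>" db] interchange[of "\<one>\<^sub>m P" h db "\<one>\<^sub>m (X \<boxtimes> P)"]
    by (simp del: D(6))
  also have "\<dots> = (ev \<boxdot> \<one>\<^sub>m P) \<cdot> ((h \<boxdot> \<one>\<^sub>m X) \<boxdot> \<one>\<^sub>m P) \<cdot> \<Psi> P X P \<cdot> (\<one>\<^sub>m P \<boxdot> db)"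
    using h by (subst cmp_extend[OF nat]) (auto simp del: interchange interchange_assoc)
  also have "\<dots> = (?y \<boxdot> \<one>\<^sub>m P) \<cdot> \<Psi> P X P \<cdot> (\<one>\<^sub>m P \<boxdot> db)" using h by simp
  also have "\<dots> = c \<odot>\<^bsub>Mor C P P\<^esub> \<one>\<^sub>m P"
    unfolding y using c(1) by simp
  finally show "\<exists>c\<in>carrier K. h = c \<odot>\<^bsub>Mor C P P\<^esub> \<one>\<^sub>m P" using c(1) by blast
qed

text \<open>
  The idempotent \<open>u \<cdot> v\<close> is a scalar \<open>c\<close>, and \<open>v \<cdot> (u \<cdot> v) \<cdot> u = id\<close> gives \<open>c = 1\<close>.
\<close>

lemma retract_of_scalar_endos:
  assumes S: "simple_obj C S" and Z: "scalar_endos Z"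
    and u: "\<guillemotleft>u : S \<rightarrow> Z\<guillemotright>" and v: "\<guillemotleft>v : Z \<rightarrow> S\<guillemotright>" and vu: "v \<cdot> u = \<one>\<^sub>m S"
  shows "u \<cdot> v = \<one>\<^sub>m Z"
proof -
  obtain c where c: "c \<in> carrier K" "u \<cdot> v = c \<odot>\<^bsub>Mor C Z Z\<^esub> \<one>\<^sub>m Z"
    using Z u v unfolding scalar_endos_def by (elim conjE allE[of _ "u \<cdot> v"]) auto
  interpret MS: module K "Mor C S S" using u by (intro mor_module) auto
  interpret MZ: module K "Mor C Z Z" using u by (intro mor_module) auto
  have "\<one>\<^sub>m S = v \<cdot> (u \<cdot> v) \<cdot> u" using u v vu cmp_extend[OF vu, of "v \<cdot> u"] by simp
  also have "\<dots> = c \<odot>\<^bsub>Mor C S S\<^esub> \<one>\<^sub>m S"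
    unfolding c(2) using u v vu c(1) by simp
  finally have "c \<odot>\<^bsub>Mor C S S\<^esub> \<one>\<^sub>m S = \<one>\<^bsub>K\<^esub> \<odot>\<^bsub>Mor C S S\<^esub> \<one>\<^sub>m S"
    using u by (simp add: MS.smult_one)
  then have "c = \<one>\<^bsub>K\<^esub>"
    using end_simple[OF S] c(1) unfolding bij_betw_def inj_on_def by blast
  then show ?thesis using c(2) u by (simp add: MZ.smult_one)
qed

text \<open>
  Evaluation and coevaluation are the sums of those of the summands. A zig-zag
  identity may be checked after composition with each injection; orthogonality
  then leaves a single term of each sum, and the claim becomes the zig-zag identity of
  that summand.
\<close>

lemma left_dual_direct_sum:
  assumes V: "direct_sum C V m B i p" and X: "direct_sum C X m Y k q"
    and dual: "\<And>j. j < m \<Longrightarrow> left_dual C (Y j) (B j) (e j) (d j)"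
  shows "\<exists>ev db. left_dual C X V ev db"
proof -
  note DV = direct_sumD[OF V] and DX = direct_sumD[OF X] and DD = left_dualD[OF dual]
  define ev where "ev = finsum (Mor C (V \<boxtimes> X) \<I>) (\<lambda>j. e j \<cdot> (p j \<boxdot> q j)) {..<m}"
  define db where "db = finsum (Mor C \<I> (X \<boxtimes> V)) (\<lambda>j. (k j \<boxdot> i j) \<cdot> d j) {..<m}"
  have ev: "\<guillemotleft>ev : V \<boxtimes> X \<rightarrow> \<I>\<guillemotright>"
    unfolding ev_def using DV DX DD by (intro conjI finsum_mor) auto
  have db: "\<guillemotleft>db : \<I> \<rightarrow> X \<boxtimes> V\<guillemotright>"
    unfolding db_def using DV DX DD by (intro conjI finsum_mor) auto
  have ev_k: "ev \<cdot> (\<one>\<^sub>m V \<boxdot> k l) = e l \<cdot> (p l \<boxdot> \<one>\<^sub>m (Y l))" if l: "l < m" for l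
  proof -
    have "ev \<cdot> (\<one>\<^sub>m V \<boxdot> k l) = finsum (Mor C (V \<boxtimes> Y l) \<I>) (\<lambda>j. (e j \<cdot> (p j \<boxdot> q j)) \<cdot> (\<one>\<^sub>m V \<boxdot> k l)) {..<m}"
      unfolding ev_def using l DV DX DD by (intro cmp_finsum_right) auto
    also have "\<dots> = (e l \<cdot> (p l \<boxdot> q l)) \<cdot> (\<one>\<^sub>m V \<boxdot> k l)"
      using l DV DX DD by (intro finsum_single) auto
    finally show ?thesis using l DV DX DD by simp
  qed
  have ev_i: "ev \<cdot> (i l \<boxdot> \<one>\<^sub>m X) = e l \<cdot> (\<one>\<^sub>m (B l) \<boxdot> q l)" if l: "l < m" for l
  proof -
    have "ev \<cdot> (i l \<boxdot> \<one>\<^sub>m X) = finsum (Mor C (B l \<boxtimes> X) \<I>) (\<lambda>j. (e j \<cdot> (p j \<boxdot> q j)) \<cdot> (i l \<boxdot> \<one>\<^sub>m X)) {..<m}"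
      unfolding ev_def using l DV DX DD by (intro cmp_finsum_right) auto
    also have "\<dots> = (e l \<cdot> (p l \<boxdot> q l)) \<cdot> (i l \<boxdot> \<one>\<^sub>m X)"
      using l DV DX DD by (intro finsum_single) auto
    finally show ?thesis using l DV DX DD by simp
  qed
  have p_db: "(\<one>\<^sub>m X \<boxdot> p l) \<cdot> db = (k l \<boxdot> \<one>\<^sub>m (B l)) \<cdot> d l" if l: "l < m" for l
  proof -
    have "(\<one>\<^sub>m X \<boxdot> p l) \<cdot> db = finsum (Mor C \<I> (X \<boxtimes> B l)) (\<lambda>j. (\<one>\<^sub>m X \<boxdot> p l) \<cdot> (k j \<boxdot> i j) \<cdot> d j) {..<m}"
      unfolding db_def using l DV DX DD by (intro cmp_finsum_left) auto
    also have "\<dots> = (\<one>\<^sub>m X \<boxdot> p l) \<cdot> (k l \<boxdot> i l) \<cdot> d l"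
      using l DV DX DD by (intro finsum_single) auto
    finally show ?thesis using l DV DX DD by simp
  qed
  have q_db: "(q l \<boxdot> \<one>\<^sub>m V) \<cdot> db = (\<one>\<^sub>m (Y l) \<boxdot> i l) \<cdot> d l" if l: "l < m" for l
  proof -
    have "(q l \<boxdot> \<one>\<^sub>m V) \<cdot> db = finsum (Mor C \<I> (Y l \<boxtimes> V)) (\<lambda>j. (q l \<boxdot> \<one>\<^sub>m V) \<cdot> (k j \<boxdot> i j) \<cdot> d j) {..<m}"
      unfolding db_def using l DV DX DD by (intro cmp_finsum_left) auto
    also have "\<dots> = (q l \<boxdot> \<one>\<^sub>m V) \<cdot> (k l \<boxdot> i l) \<cdot> d l"
      using l DV DX DD by (intro finsum_single) auto
    finally show ?thesis using l DV DX DD by simp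
  qed
  have zig: "(\<one>\<^sub>m X \<boxdot> ev) \<cdot> \<Phi> X V X \<cdot> (db \<boxdot> \<one>\<^sub>m X) = \<one>\<^sub>m X"
  proof (rule direct_sum_eqI[OF X])
    fix l assume l: "l < m"
    note L = DV(1) DV(2,3)[OF l] DX(1) DX(2,3)[OF l] DD[OF l] ev db
    have n1: "\<Phi> X V X \<cdot> (\<one>\<^sub>m (X \<boxtimes> V) \<boxdot> k l) = (\<one>\<^sub>m X \<boxdot> (\<one>\<^sub>m V \<boxdot> k l)) \<cdot> \<Phi> X V (Y l)"
      using asc_nat[of "\<one>\<^sub>m X" "\<one>\<^sub>m V" "k l"] L by simp
    have n2: "(\<one>\<^sub>m X \<boxdot> (p l \<boxdot> \<one>\<^sub>m (Y l))) \<cdot> \<Phi> X V (Y l) = \<Phi> X (B l) (Y l) \<cdot> ((\<one>\<^sub>m X \<boxdot> p l) \<boxdot> \<one>\<^sub>m (Y l))"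
      using asc_nat[of "\<one>\<^sub>m X" "p l" "\<one>\<^sub>m (Y l)"] L by simp
    have n3: "\<Phi> X (B l) (Y l) \<cdot> ((k l \<boxdot> \<one>\<^sub>m (B l)) \<boxdot> \<one>\<^sub>m (Y l)) = (k l \<boxdot> \<one>\<^sub>m (B l \<boxtimes> Y l)) \<cdot> \<Phi> (Y l) (B l) (Y l)"
      using asc_nat[of "k l" "\<one>\<^sub>m (B l)" "\<one>\<^sub>m (Y l)"] L by simp
    have "((\<one>\<^sub>m X \<boxdot> ev) \<cdot> \<Phi> X V X \<cdot> (db \<boxdot> \<one>\<^sub>m X)) \<cdot> k l
        = (\<one>\<^sub>m X \<boxdot> ev) \<cdot> \<Phi> X V X \<cdot> (\<one>\<^sub>m (X \<boxtimes> V) \<boxdot> k l) \<cdot> (db \<boxdot> \<one>\<^sub>m (Y l))"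
      using L interchange[of "\<one>\<^sub>m \<I>" db "k l" "\<one>\<^sub>m X"] by simp
    also have "\<dots> = (\<one>\<^sub>m X \<boxdot> ev) \<cdot> ((\<one>\<^sub>m X \<boxdot> (\<one>\<^sub>m V \<boxdot> k l)) \<cdot> \<Phi> X V (Y l)) \<cdot> (db \<boxdot> \<one>\<^sub>m (Y l))"
      using L by (subst cmp_extend[OF n1]) auto
    also have "\<dots> = (\<one>\<^sub>m X \<boxdot> (ev \<cdot> (\<one>\<^sub>m V \<boxdot> k l))) \<cdot> \<Phi> X V (Y l) \<cdot> (db \<boxdot> \<one>\<^sub>m (Y l))"
      using L by simp
    also have "\<dots> = (\<one>\<^sub>m X \<boxdot> e l) \<cdot> ((\<one>\<^sub>m X \<boxdot> (p l \<boxdot> \<one>\<^sub>m (Y l))) \<cdot> \<Phi> X V (Y l)) \<cdot> (db \<boxdot> \<one>\<^sub>m (Y l))"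
      unfolding ev_k[OF l] using L by simp
    also have "\<dots> = (\<one>\<^sub>m X \<boxdot> e l) \<cdot> \<Phi> X (B l) (Y l) \<cdot> (((\<one>\<^sub>m X \<boxdot> p l) \<cdot> db) \<boxdot> \<one>\<^sub>m (Y l))"
      unfolding n2 using L by simp
    also have "\<dots> = (\<one>\<^sub>m X \<boxdot> e l) \<cdot> (\<Phi> X (B l) (Y l) \<cdot> ((k l \<boxdot> \<one>\<^sub>m (B l)) \<boxdot> \<one>\<^sub>m (Y l))) \<cdot> (d l \<boxdot> \<one>\<^sub>m (Y l))"
      unfolding p_db[OF l] using L by simp
    also have "\<dots> = (\<one>\<^sub>m X \<boxdot> e l) \<cdot> (k l \<boxdot> \<one>\<^sub>m (B l \<boxtimes> Y l)) \<cdot> \<Phi> (Y l) (B l) (Y l) \<cdot> (d l \<boxdot> \<one>\<^sub>m (Y l))"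
      unfolding n3 using L by (simp del: interchange interchange_assoc)
    also have "\<dots> = k l \<cdot> ((\<one>\<^sub>m (Y l) \<boxdot> e l) \<cdot> \<Phi> (Y l) (B l) (Y l) \<cdot> (d l \<boxdot> \<one>\<^sub>m (Y l)))"
    proof -
      have "(\<one>\<^sub>m X \<boxdot> e l) \<cdot> (k l \<boxdot> \<one>\<^sub>m (B l \<boxtimes> Y l)) = k l \<cdot> (\<one>\<^sub>m (Y l) \<boxdot> e l)"
        using L interchange[of "\<one>\<^sub>m (Y l)" "k l" "e l" "\<one>\<^sub>m \<I>"] by simp
      from cmp_extend[OF this, of "\<Phi> (Y l) (B l) (Y l) \<cdot> (d l \<boxdot> \<one>\<^sub>m (Y l))"] show ?thesis
        using L by (simp del: interchange interchange_assoc DD(5))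
    qed
    also have "\<dots> = k l" using L by simp
    finally show "((\<one>\<^sub>m X \<boxdot> ev) \<cdot> \<Phi> X V X \<cdot> (db \<boxdot> \<one>\<^sub>m X)) \<cdot> k l = \<one>\<^sub>m X \<cdot> k l" using L by simp
  qed (use ev db DX DV in auto)
  have zag: "(ev \<boxdot> \<one>\<^sub>m V) \<cdot> \<Psi> V X V \<cdot> (\<one>\<^sub>m V \<boxdot> db) = \<one>\<^sub>m V"
  proof (rule direct_sum_eqI[OF V])
    fix l assume l: "l < m"
    note L = DV(1) DV(2,3)[OF l] DX(1) DX(2,3)[OF l] DD[OF l] ev db
    have n1: "\<Psi> V X V \<cdot> (i l \<boxdot> \<one>\<^sub>m (X \<boxtimes> V)) = ((i l \<boxdot> \<one>\<^sub>m X) \<boxdot> \<one>\<^sub>m V) \<cdot> \<Psi> (B l) X V"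
      using asc_inv_nat[of "i l" "\<one>\<^sub>m X" "\<one>\<^sub>m V"] L by simp
    have n2: "((\<one>\<^sub>m (B l) \<boxdot> q l) \<boxdot> \<one>\<^sub>m V) \<cdot> \<Psi> (B l) X V = \<Psi> (B l) (Y l) V \<cdot> (\<one>\<^sub>m (B l) \<boxdot> (q l \<boxdot> \<one>\<^sub>m V))"
      using asc_inv_nat[of "\<one>\<^sub>m (B l)" "q l" "\<one>\<^sub>m V"] L by simp
    have n3: "\<Psi> (B l) (Y l) V \<cdot> (\<one>\<^sub>m (B l) \<boxdot> (\<one>\<^sub>m (Y l) \<boxdot> i l)) = (\<one>\<^sub>m (B l \<boxtimes> Y l) \<boxdot> i l) \<cdot> \<Psi> (B l) (Y l) (B l)"
      using asc_inv_nat[of "\<one>\<^sub>m (B l)" "\<one>\<^sub>m (Y l)" "i l"] L by simp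
    have "((ev \<boxdot> \<one>\<^sub>m V) \<cdot> \<Psi> V X V \<cdot> (\<one>\<^sub>m V \<boxdot> db)) \<cdot> i l
        = (ev \<boxdot> \<one>\<^sub>m V) \<cdot> \<Psi> V X V \<cdot> (i l \<boxdot> \<one>\<^sub>m (X \<boxtimes> V)) \<cdot> (\<one>\<^sub>m (B l) \<boxdot> db)"
      using L interchange[of "i l" "\<one>\<^sub>m V" "\<one>\<^sub>m \<I>" db] by simp
    also have "\<dots> = (ev \<boxdot> \<one>\<^sub>m V) \<cdot> (((i l \<boxdot> \<one>\<^sub>m X) \<boxdot> \<one>\<^sub>m V) \<cdot> \<Psi> (B l) X V) \<cdot> (\<one>\<^sub>m (B l) \<boxdot> db)"
      using L by (subst cmp_extend[OF n1]) auto
    also have "\<dots> = ((ev \<cdot> (i l \<boxdot> \<one>\<^sub>m X)) \<boxdot> \<one>\<^sub>m V) \<cdot> \<Psi> (B l) X V \<cdot> (\<one>\<^sub>m (B l) \<boxdot> db)"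
      using L by simp
    also have "\<dots> = (e l \<boxdot> \<one>\<^sub>m V) \<cdot> (((\<one>\<^sub>m (B l) \<boxdot> q l) \<boxdot> \<one>\<^sub>m V) \<cdot> \<Psi> (B l) X V) \<cdot> (\<one>\<^sub>m (B l) \<boxdot> db)"
      unfolding ev_i[OF l] using L by simp
    also have "\<dots> = (e l \<boxdot> \<one>\<^sub>m V) \<cdot> \<Psi> (B l) (Y l) V \<cdot> (\<one>\<^sub>m (B l) \<boxdot> ((q l \<boxdot> \<one>\<^sub>m V) \<cdot> db))"
      unfolding n2 using L by simp
    also have "\<dots> = (e l \<boxdot> \<one>\<^sub>m V) \<cdot> (\<Psi> (B l) (Y l) V \<cdot> (\<one>\<^sub>m (B l) \<boxdot> (\<one>\<^sub>m (Y l) \<boxdot> i l))) \<cdot> (\<one>\<^sub>m (B l) \<boxdot> d l)"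
      unfolding q_db[OF l] using L by simp
    also have "\<dots> = (e l \<boxdot> \<one>\<^sub>m V) \<cdot> (\<one>\<^sub>m (B l \<boxtimes> Y l) \<boxdot> i l) \<cdot> \<Psi> (B l) (Y l) (B l) \<cdot> (\<one>\<^sub>m (B l) \<boxdot> d l)"
      unfolding n3 using L by (simp del: interchange interchange_assoc)
    also have "\<dots> = i l \<cdot> ((e l \<boxdot> \<one>\<^sub>m (B l)) \<cdot> \<Psi> (B l) (Y l) (B l) \<cdot> (\<one>\<^sub>m (B l) \<boxdot> d l))"
    proof -
      have "(e l \<boxdot> \<one>\<^sub>m V) \<cdot> (\<one>\<^sub>m (B l \<boxtimes> Y l) \<boxdot> i l) = i l \<cdot> (e l \<boxdot> \<one>\<^sub>m (B l))"
        using L interchange[of "e l" "\<one>\<^sub>m \<I>" "\<one>\<^sub>m (B l)" "i l"] by simp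
      from cmp_extend[OF this, of "\<Psi> (B l) (Y l) (B l) \<cdot> (\<one>\<^sub>m (B l) \<boxdot> d l)"] show ?thesis
        using L by (simp del: interchange interchange_assoc DD(6))
    qed
    also have "\<dots> = i l" using L by simp
    finally show "((ev \<boxdot> \<one>\<^sub>m V) \<cdot> \<Psi> V X V \<cdot> (\<one>\<^sub>m V \<boxdot> db)) \<cdot> i l = \<one>\<^sub>m V \<cdot> i l" using L by simp
  qed (use ev db DX DV in auto)
  have "left_dual C X V ev db"
    unfolding left_dual_def asc_inv_def[symmetric] using zig zag ev db DX DV by simp
  then show ?thesis by blast
qed

end

context semisimple_rigid_monoidal_category
begin

text \<open>
  A right dual \<open>Y\<close> requires a morphism \<open>S \<boxtimes> Y \<rightarrow> \<I>\<close>, while the left duality has the coevaluation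
  \<open>d : \<I> \<rightarrow> S \<boxtimes> Y\<close> in the opposite direction. Semisimplicity reverses it: \<open>d\<close> is nonzero and
  hence split by some \<open>r\<close>. The transpose \<open>u : S \<rightarrow> Z\<close> of \<open>r\<close>
  identifies \<open>S\<close> with the left dual \<open>Z\<close> of \<open>Y\<close>.
\<close>

lemma ex_right_dual_simple:
  assumes S: "simple_obj C S"
  shows "\<exists>Y ev db. left_dual C Y S ev db"
proof -
  have S': "S \<in> Obj C" using S by simp
  obtain Y e d where d: "left_dual C S Y e d" using rigid[OF S'] by blast
  note D [simp] = left_dualD[OF d]
  obtain Z e' d' where d': "left_dual C Y Z e' d'" using rigid[OF D(4)] by blast
  note D' [simp] = left_dualD[OF d']
  have "d \<noteq> \<zero>\<^bsub>Mor C \<I> (S \<boxtimes> Y)\<^esub>"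
  proof
    assume "d = \<zero>\<^bsub>Mor C \<I> (S \<boxtimes> Y)\<^esub>"
    then have "(\<one>\<^sub>m S \<boxdot> e) \<cdot> \<Phi> S Y S \<cdot> (d \<boxdot> \<one>\<^sub>m S) = \<zero>\<^bsub>Mor C S S\<^esub>" using S' D(1,2,4) by simp
    then show False using D(5) simple_id_nonzero[OF S] by simp
  qed
  then obtain r where r: "\<guillemotleft>r : S \<boxtimes> Y \<rightarrow> \<I>\<guillemotright>" "r \<cdot> d = \<one>\<^sub>m \<I>"
    using simple_split[OF simple_unt, of d] by auto
  define u where "u = (r \<boxdot> \<one>\<^sub>m Z) \<cdot> \<Psi> S Y Z \<cdot> (\<one>\<^sub>m S \<boxdot> d')"
  have u: "\<guillemotleft>u : S \<rightarrow> Z\<guillemotright>" unfolding u_def using r by simp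
  have ru: "e' \<cdot> (u \<boxdot> \<one>\<^sub>m Y) = r"
    unfolding u_def using r by (intro transpose_ev_mirror[OF d']) auto
  have "u \<noteq> \<zero>\<^bsub>Mor C S Z\<^esub>"
  proof
    assume "u = \<zero>\<^bsub>Mor C S Z\<^esub>"
    then have "r = \<zero>\<^bsub>Mor C (S \<boxtimes> Y) \<I>\<^esub>" using ru by simp
    then show False using r simple_id_nonzero[OF simple_unt] by simp
  qed
  then obtain v where v: "\<guillemotleft>v : Z \<rightarrow> S\<guillemotright>" "v \<cdot> u = \<one>\<^sub>m S" using simple_split[OF S u] by blast
  have "scalar_endos Z"
    by (rule scalar_endos_dual[OF d' scalar_endos_dual[OF d scalar_endos_simple[OF S]]])
  then have uv: "u \<cdot> v = \<one>\<^sub>m Z" using retract_of_scalar_endos[OF S _ u v] by blast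
  have V: "direct_sum C S 1 (\<lambda>_. Z) (\<lambda>_. v) (\<lambda>_. u)"
    using u v uv by (intro direct_sum_single) auto
  have X: "direct_sum C Y 1 (\<lambda>_. Y) (\<lambda>_. \<one>\<^sub>m Y) (\<lambda>_. \<one>\<^sub>m Y)"
    by (intro direct_sum_single) auto
  show ?thesis using left_dual_direct_sum[OF V X, of "\<lambda>_. e'" "\<lambda>_. d'"] d' by blast
qed

theorem ex_right_dual:
  assumes "V \<in> Obj C"
  shows "\<exists>X ev db. right_dual C V X ev db"
proof -
  obtain m S i p where S: "\<And>j. j < m \<Longrightarrow> simple_obj C (S j)" and V: "direct_sum C V m S i p"
    using ex_simple_decomposition[OF assms] by blast
  have "\<exists>Y e d. left_dual C Y (S j) e d" if "j < m" for j
    using ex_right_dual_simple[OF S[OF that]] .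
  then obtain Y e d where dual: "\<And>j. j < m \<Longrightarrow> left_dual C (Y j) (S j) (e j) (d j)" by metis
  obtain X k q where X: "direct_sum C X m Y k q"
    using ex_finite_direct_sum[of m Y] left_dualD(3)[OF dual] by blast
  show ?thesis unfolding right_dual_def using left_dual_direct_sum[OF V X dual] by blast
qed

end


section \<open>Words and the associativity isomorphisms between them\<close>

context linear_monoidal_category
begin

text \<open>
  Tensor products of words with brackets to the right. General words occur because the proof
  replaces the factors of a tensor power of \<open>V\<close> one at a time by \<open>W\<close>.
\<close>

primrec tensor_word where
  "tensor_word [] = \<I>"
| "tensor_word (A # as) = A \<boxtimes> tensor_word as"

text \<open>
  The canonical associativity isomorphism \<open>tensor_word as \<boxtimes> B \<rightarrow> tensor_word (as @ [B])\<close>, which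
  is \<open>asc_pow\<close> for constant words.
\<close>

primrec snoc_asc where
  "snoc_asc [] B = \<one>\<^sub>m B"
| "snoc_asc (A # as) B = (\<one>\<^sub>m A \<boxdot> snoc_asc as B) \<cdot> \<Phi> A (tensor_word as) B"

text \<open>
  The morphism \<open>g\<close> acting behind the word \<open>us\<close>: it is tensored from the left with the identities
  of the letters.
\<close>

primrec whisker where
  "whisker [] g = g"
| "whisker (A # us) g = \<one>\<^sub>m A \<boxdot> whisker us g"

lemma tensor_word_obj [simp]: "set as \<subseteq> Obj C \<Longrightarrow> tensor_word as \<in> Obj C"
  by (induction as) auto

lemma set_replicate_obj [simp]: "V \<in> Obj C \<Longrightarrow> set (replicate m V) \<subseteq> Obj C"
  by auto

lemma snoc_asc_mor [simp]:
  assumes "set as \<subseteq> Obj C" "B \<in> Obj C"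
  shows "arr (snoc_asc as B)" "src (snoc_asc as B) = tensor_word as \<boxtimes> B" "tgt (snoc_asc as B) = tensor_word (as @ [B])"
  using assms by (induction as) auto

lemma whisker_mor:
  assumes "set us \<subseteq> Obj C" "\<guillemotleft>g : tensor_word as \<rightarrow> tensor_word bs\<guillemotright>"
  shows "arr (whisker us g) \<and> src (whisker us g) = tensor_word (us @ as) \<and> tgt (whisker us g) = tensor_word (us @ bs)"
  using assms by (induction us) auto

lemma tpow_eq_tensor_word: "tpow C V n = tensor_word (replicate n V)"
  by (induction n) auto

lemma asc_pow_snoc_asc: "asc_pow C V n = snoc_asc (replicate n V) V"
  by (induction n) (auto simp: tpow_eq_tensor_word)

text \<open>
  Naturality of \<open>snoc_asc\<close> may be checked behind a common prefix of the two words.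
\<close>

lemma snoc_asc_whisker:
  assumes us: "set us \<subseteq> Obj C" and as: "set as \<subseteq> Obj C" and bs: "set bs \<subseteq> Obj C" and B: "B \<in> Obj C"
    and g: "\<guillemotleft>g : tensor_word as \<rightarrow> tensor_word bs\<guillemotright>" and g': "\<guillemotleft>g' : tensor_word (as @ [B]) \<rightarrow> tensor_word (bs @ [B])\<guillemotright>"
    and eq: "snoc_asc bs B \<cdot> (g \<boxdot> \<one>\<^sub>m B) = g' \<cdot> snoc_asc as B"
  shows "snoc_asc (us @ bs) B \<cdot> (whisker us g \<boxdot> \<one>\<^sub>m B) = whisker us g' \<cdot> snoc_asc (us @ as) B"
  using us
proof (induction us)
  case Nil
  then show ?case using eq by simp
next
  case (Cons A us)
  then have us: "set us \<subseteq> Obj C" and A: "A \<in> Obj C" by auto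
  note w = whisker_mor[OF us g] whisker_mor[OF us g']
  note IH = Cons.IH[OF us]
  have n: "\<Phi> A (tensor_word (us @ bs)) B \<cdot> ((\<one>\<^sub>m A \<boxdot> whisker us g) \<boxdot> \<one>\<^sub>m B)
      = (\<one>\<^sub>m A \<boxdot> (whisker us g \<boxdot> \<one>\<^sub>m B)) \<cdot> \<Phi> A (tensor_word (us @ as)) B"
    using asc_nat[of "\<one>\<^sub>m A" "whisker us g" "\<one>\<^sub>m B"] w A B by simp
  have "snoc_asc ((A # us) @ bs) B \<cdot> (whisker (A # us) g \<boxdot> \<one>\<^sub>m B)
      = (\<one>\<^sub>m A \<boxdot> snoc_asc (us @ bs) B) \<cdot> (\<one>\<^sub>m A \<boxdot> (whisker us g \<boxdot> \<one>\<^sub>m B)) \<cdot> \<Phi> A (tensor_word (us @ as)) B"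
    using w A B us as bs n by simp
  also have "\<dots> = (\<one>\<^sub>m A \<boxdot> (whisker us g' \<cdot> snoc_asc (us @ as) B)) \<cdot> \<Phi> A (tensor_word (us @ as)) B"
    using w A B us as bs IH by simp
  also have "\<dots> = whisker (A # us) g' \<cdot> snoc_asc ((A # us) @ as) B"
    using w A B us as bs by simp
  finally show ?case .
qed

lemma snoc_asc_head:
  assumes f: "\<guillemotleft>f : V \<rightarrow> W\<guillemotright>" and vs: "set vs \<subseteq> Obj C" and B: "B \<in> Obj C"
  shows "snoc_asc (W # vs) B \<cdot> ((f \<boxdot> \<one>\<^sub>m (tensor_word vs)) \<boxdot> \<one>\<^sub>m B) = (f \<boxdot> \<one>\<^sub>m (tensor_word (vs @ [B]))) \<cdot> snoc_asc (V # vs) B"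
proof -
  have "\<Phi> W (tensor_word vs) B \<cdot> ((f \<boxdot> \<one>\<^sub>m (tensor_word vs)) \<boxdot> \<one>\<^sub>m B) = (f \<boxdot> \<one>\<^sub>m (tensor_word vs \<boxtimes> B)) \<cdot> \<Phi> V (tensor_word vs) B"
    using asc_nat[of f "\<one>\<^sub>m (tensor_word vs)" "\<one>\<^sub>m B"] f vs B by simp
  then show ?thesis using f vs B by simp
qed

lemma snoc_asc_last:
  assumes f: "\<guillemotleft>f : V \<rightarrow> W\<guillemotright>" and us: "set us \<subseteq> Obj C"
  shows "snoc_asc us W \<cdot> (\<one>\<^sub>m (tensor_word us) \<boxdot> f) = whisker us f \<cdot> snoc_asc us V"
  using us
proof (induction us)
  case Nil
  then show ?case using f by simp
next
  case (Cons A us)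
  then have us: "set us \<subseteq> Obj C" and A: "A \<in> Obj C" by auto
  note w = whisker_mor[OF us, of f "[V]" "[W]"]
  have n: "\<Phi> A (tensor_word us) W \<cdot> (\<one>\<^sub>m (A \<boxtimes> tensor_word us) \<boxdot> f) = (\<one>\<^sub>m A \<boxdot> (\<one>\<^sub>m (tensor_word us) \<boxdot> f)) \<cdot> \<Phi> A (tensor_word us) V"
    using asc_nat[of "\<one>\<^sub>m A" "\<one>\<^sub>m (tensor_word us)" f] f us A by simp
  show ?case using n Cons.IH[OF us] w f us A by simp
qed

section \<open>A trace through the trivial part\<close>

text \<open>
  The condition on \<open>t\<close> says that it is the transpose of \<open>g\<close> with respect to the evaluations. The
  zig-zag identities imply the corresponding property for the coevaluations: both sides
  have the transpose \<open>g\<close>, and \<open>transpose_db\<close> recovers them from it.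
\<close>

lemma transpose_db_natural:
  assumes d: "left_dual C X P ev db" and d': "left_dual C X' P' ev' db'"
    and g: "\<guillemotleft>g : P \<rightarrow> P'\<guillemotright>" and t: "\<guillemotleft>t : X' \<rightarrow> X\<guillemotright>"
    and t_ev: "ev \<cdot> (\<one>\<^sub>m P \<boxdot> t) = ev' \<cdot> (g \<boxdot> \<one>\<^sub>m X')"
  shows "(t \<boxdot> \<one>\<^sub>m P') \<cdot> db' = (\<one>\<^sub>m X \<boxdot> g) \<cdot> db"
proof -
  note D [simp] = left_dualD(1-4)[OF d] and D' [simp] = left_dualD(1-4)[OF d']
  have n1: "\<Psi> P X P' \<cdot> (\<one>\<^sub>m P \<boxdot> (t \<boxdot> \<one>\<^sub>m P')) = ((\<one>\<^sub>m P \<boxdot> t) \<boxdot> \<one>\<^sub>m P') \<cdot> \<Psi> P X' P'"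
    using asc_inv_nat[of "\<one>\<^sub>m P" t "\<one>\<^sub>m P'"] t by simp
  have n2: "((g \<boxdot> \<one>\<^sub>m X') \<boxdot> \<one>\<^sub>m P') \<cdot> \<Psi> P X' P' = \<Psi> P' X' P' \<cdot> (g \<boxdot> \<one>\<^sub>m (X' \<boxtimes> P'))"
    using asc_inv_nat[of g "\<one>\<^sub>m X'" "\<one>\<^sub>m P'"] g by simp
  have n3: "(g \<boxdot> \<one>\<^sub>m (X' \<boxtimes> P')) \<cdot> (\<one>\<^sub>m P \<boxdot> db') = (\<one>\<^sub>m P' \<boxdot> db') \<cdot> g"
    using g interchange[of g "\<one>\<^sub>m P'" "\<one>\<^sub>m \<I>" db'] by simp
  have "(ev \<boxdot> \<one>\<^sub>m P') \<cdot> \<Psi> P X P' \<cdot> (\<one>\<^sub>m P \<boxdot> ((t \<boxdot> \<one>\<^sub>m P') \<cdot> db'))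
      = (ev \<boxdot> \<one>\<^sub>m P') \<cdot> (\<Psi> P X P' \<cdot> (\<one>\<^sub>m P \<boxdot> (t \<boxdot> \<one>\<^sub>m P'))) \<cdot> (\<one>\<^sub>m P \<boxdot> db')"
    using t by simp
  also have "\<dots> = ((ev \<cdot> (\<one>\<^sub>m P \<boxdot> t)) \<boxdot> \<one>\<^sub>m P') \<cdot> \<Psi> P X' P' \<cdot> (\<one>\<^sub>m P \<boxdot> db')"
    unfolding n1 using t by simp
  also have "\<dots> = (ev' \<boxdot> \<one>\<^sub>m P') \<cdot> (((g \<boxdot> \<one>\<^sub>m X') \<boxdot> \<one>\<^sub>m P') \<cdot> \<Psi> P X' P') \<cdot> (\<one>\<^sub>m P \<boxdot> db')"
    unfolding t_ev using g by simp
  also have "\<dots> = (ev' \<boxdot> \<one>\<^sub>m P') \<cdot> \<Psi> P' X' P' \<cdot> (g \<boxdot> \<one>\<^sub>m (X' \<boxtimes> P')) \<cdot> (\<one>\<^sub>m P \<boxdot> db')"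
    unfolding n2 using g by (simp del: interchange interchange_assoc)
  also have "\<dots> = ((ev' \<boxdot> \<one>\<^sub>m P') \<cdot> \<Psi> P' X' P' \<cdot> (\<one>\<^sub>m P' \<boxdot> db')) \<cdot> g"
    unfolding n3 using g by simp
  also have "\<dots> = g" using left_dualD(6)[OF d'] g by simp
  finally have "(ev \<boxdot> \<one>\<^sub>m P') \<cdot> \<Psi> P X P' \<cdot> (\<one>\<^sub>m P \<boxdot> ((t \<boxdot> \<one>\<^sub>m P') \<cdot> db')) = g" .
  moreover have "(\<one>\<^sub>m X \<boxdot> ((ev \<boxdot> \<one>\<^sub>m P') \<cdot> \<Psi> P X P' \<cdot> (\<one>\<^sub>m P \<boxdot> ((t \<boxdot> \<one>\<^sub>m P') \<cdot> db')))) \<cdot> db = (t \<boxdot> \<one>\<^sub>m P') \<cdot> db'"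
    using t by (intro transpose_db[OF d]) auto
  ultimately show ?thesis by simp
qed

end

context semisimple_monoidal_category
begin

text \<open>
  A partial trace over \<open>P\<close>. There is no braiding that could move the dual \<open>X\<close> from the left
  side, where \<open>db\<close> creates it, to the right side, where \<open>ev\<close> consumes it; the flip through the
  trivial part of \<open>W \<boxtimes> P\<close> takes its place.
\<close>

definition flip_trace ("\<Theta>") where
  "\<Theta> P X ev db V W h =
     (\<one>\<^sub>m W \<boxdot> ev) \<cdot> \<Phi> W P X \<cdot> \<sigma> X (W \<boxtimes> P) \<cdot> (\<one>\<^sub>m X \<boxdot> h) \<cdot> \<Phi> X P V \<cdot> (db \<boxdot> \<one>\<^sub>m V)"

lemma flip_trace_mor:
  assumes d: "left_dual C X P ev db" and h: "\<guillemotleft>h : P \<boxtimes> V \<rightarrow> W \<boxtimes> P\<guillemotright>" and VW: "V \<in> Obj C" "W \<in> Obj C"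
  shows "\<guillemotleft>\<Theta> P X ev db V W h : V \<rightarrow> W\<guillemotright>"
  unfolding flip_trace_def using left_dualD(1-4)[OF d] h VW by simp

lemma flip_trace_post:
  assumes d: "left_dual C X P ev db" and h: "\<guillemotleft>h : P \<boxtimes> V \<rightarrow> W \<boxtimes> P\<guillemotright>" and V: "V \<in> Obj C"
    and f: "\<guillemotleft>f : W \<rightarrow> W'\<guillemotright>"
  shows "f \<cdot> \<Theta> P X ev db V W h = \<Theta> P X ev db V W' ((f \<boxdot> \<one>\<^sub>m P) \<cdot> h)"
proof -
  note D [simp] = left_dualD(1-4)[OF d]
  let ?r = "(\<one>\<^sub>m X \<boxdot> h) \<cdot> \<Phi> X P V \<cdot> (db \<boxdot> \<one>\<^sub>m V)"
  have r: "\<guillemotleft>?r : V \<rightarrow> X \<boxtimes> (W \<boxtimes> P)\<guillemotright>" using h V f by simp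
  have n1: "f \<cdot> (\<one>\<^sub>m W \<boxdot> ev) = (\<one>\<^sub>m W' \<boxdot> ev) \<cdot> (f \<boxdot> \<one>\<^sub>m (P \<boxtimes> X))"
    using f interchange[of "\<one>\<^sub>m W" f ev "\<one>\<^sub>m \<I>"] by simp
  have n2: "(f \<boxdot> \<one>\<^sub>m (P \<boxtimes> X)) \<cdot> \<Phi> W P X = \<Phi> W' P X \<cdot> ((f \<boxdot> \<one>\<^sub>m P) \<boxdot> \<one>\<^sub>m X)"
    using asc_nat[of f "\<one>\<^sub>m P" "\<one>\<^sub>m X"] f by simp
  have n3: "((f \<boxdot> \<one>\<^sub>m P) \<boxdot> \<one>\<^sub>m X) \<cdot> \<sigma> X (W \<boxtimes> P) = \<sigma> X (W' \<boxtimes> P) \<cdot> (\<one>\<^sub>m X \<boxdot> (f \<boxdot> \<one>\<^sub>m P))"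
    using f by (intro partial_flip_nat_right) auto
  have "f \<cdot> \<Theta> P X ev db V W h = f \<cdot> (\<one>\<^sub>m W \<boxdot> ev) \<cdot> \<Phi> W P X \<cdot> \<sigma> X (W \<boxtimes> P) \<cdot> ?r"
    unfolding flip_trace_def by simp
  also have "\<dots> = ((\<one>\<^sub>m W' \<boxdot> ev) \<cdot> (f \<boxdot> \<one>\<^sub>m (P \<boxtimes> X))) \<cdot> \<Phi> W P X \<cdot> \<sigma> X (W \<boxtimes> P) \<cdot> ?r"
    using f r by (intro cmp_extend n1) auto
  also have "\<dots> = (\<one>\<^sub>m W' \<boxdot> ev) \<cdot> ((f \<boxdot> \<one>\<^sub>m (P \<boxtimes> X)) \<cdot> \<Phi> W P X) \<cdot> \<sigma> X (W \<boxtimes> P) \<cdot> ?r"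
    using f r h V by (simp del: interchange interchange_assoc)
  also have "\<dots> = (\<one>\<^sub>m W' \<boxdot> ev) \<cdot> \<Phi> W' P X \<cdot> (((f \<boxdot> \<one>\<^sub>m P) \<boxdot> \<one>\<^sub>m X) \<cdot> \<sigma> X (W \<boxtimes> P)) \<cdot> ?r"
    unfolding n2 using f r h V by simp
  also have "\<dots> = \<Theta> P X ev db V W' ((f \<boxdot> \<one>\<^sub>m P) \<cdot> h)"
    unfolding n3 flip_trace_def using f r h V by simp
  finally show ?thesis .
qed

lemma flip_trace_pre:
  assumes d: "left_dual C X P ev db" and h: "\<guillemotleft>h : P \<boxtimes> V \<rightarrow> W \<boxtimes> P\<guillemotright>" and W: "W \<in> Obj C"
    and f: "\<guillemotleft>f : V' \<rightarrow> V\<guillemotright>"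
  shows "\<Theta> P X ev db V W h \<cdot> f = \<Theta> P X ev db V' W (h \<cdot> (\<one>\<^sub>m P \<boxdot> f))"
proof -
  note D [simp] = left_dualD(1-4)[OF d]
  have n1: "(db \<boxdot> \<one>\<^sub>m V) \<cdot> f = (\<one>\<^sub>m (X \<boxtimes> P) \<boxdot> f) \<cdot> (db \<boxdot> \<one>\<^sub>m V')"
    using f interchange[of "\<one>\<^sub>m \<I>" db f "\<one>\<^sub>m V"] by simp
  have n2: "\<Phi> X P V \<cdot> (\<one>\<^sub>m (X \<boxtimes> P) \<boxdot> f) = (\<one>\<^sub>m X \<boxdot> (\<one>\<^sub>m P \<boxdot> f)) \<cdot> \<Phi> X P V'"
    using asc_nat[of "\<one>\<^sub>m X" "\<one>\<^sub>m P" f] f by simp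
  have "\<Phi> X P V \<cdot> (db \<boxdot> \<one>\<^sub>m V) \<cdot> f = (\<one>\<^sub>m X \<boxdot> (\<one>\<^sub>m P \<boxdot> f)) \<cdot> \<Phi> X P V' \<cdot> (db \<boxdot> \<one>\<^sub>m V')"
    unfolding n1 using cmp_extend[OF n2, of "db \<boxdot> \<one>\<^sub>m V'"] f by (simp del: interchange interchange_assoc)
  then show ?thesis unfolding flip_trace_def using f h W by simp
qed

text \<open>
  Cyclicity of the trace. From the right-hand side, \<open>g\<close> moves through \<open>\<sigma>\<close> to the
  evaluation and turns into its transpose \<open>t : X' \<rightarrow> X\<close> there. Then \<open>t\<close> moves back through \<open>\<sigma>\<close>,
  past \<open>h\<close>, to the coevaluation and turns into \<open>g\<close> again, now in front of \<open>h\<close>. For \<open>g = id\<close> this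
  says that the trace does not depend on the choice of the dual.
\<close>

theorem flip_trace_slide:
  assumes d: "left_dual C X P ev db" and d': "left_dual C X' P' ev' db'"
    and g: "\<guillemotleft>g : P \<rightarrow> P'\<guillemotright>" and h: "\<guillemotleft>h : P' \<boxtimes> V \<rightarrow> W \<boxtimes> P\<guillemotright>"
    and V: "V \<in> Obj C" and W: "W \<in> Obj C"
  shows "\<Theta> P X ev db V W (h \<cdot> (g \<boxdot> \<one>\<^sub>m V)) = \<Theta> P' X' ev' db' V W ((\<one>\<^sub>m W \<boxdot> g) \<cdot> h)"
proof -
  note D [simp] = left_dualD(1-4)[OF d] and D' [simp] = left_dualD(1-4)[OF d']
  define t where "t = (\<one>\<^sub>m X \<boxdot> (ev' \<cdot> (g \<boxdot> \<one>\<^sub>m X'))) \<cdot> \<Phi> X P X' \<cdot> (db \<boxdot> \<one>\<^sub>m X')"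
  have t: "\<guillemotleft>t : X' \<rightarrow> X\<guillemotright>" unfolding t_def using g by simp
  have t_ev: "ev \<cdot> (\<one>\<^sub>m P \<boxdot> t) = ev' \<cdot> (g \<boxdot> \<one>\<^sub>m X')"
    unfolding t_def using g by (intro transpose_ev[OF d]) auto
  have t_db: "(t \<boxdot> \<one>\<^sub>m P') \<cdot> db' = (\<one>\<^sub>m X \<boxdot> g) \<cdot> db"
    by (rule transpose_db_natural[OF d d' g t t_ev])
  have n1: "\<sigma> X' (W \<boxtimes> P') \<cdot> (\<one>\<^sub>m X' \<boxdot> (\<one>\<^sub>m W \<boxdot> g)) = ((\<one>\<^sub>m W \<boxdot> g) \<boxdot> \<one>\<^sub>m X') \<cdot> \<sigma> X' (W \<boxtimes> P)"
    using g W by (intro partial_flip_nat_right[symmetric]) auto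
  have n2: "\<Phi> W P' X' \<cdot> ((\<one>\<^sub>m W \<boxdot> g) \<boxdot> \<one>\<^sub>m X') = (\<one>\<^sub>m W \<boxdot> (g \<boxdot> \<one>\<^sub>m X')) \<cdot> \<Phi> W P X'"
    using asc_nat[of "\<one>\<^sub>m W" g "\<one>\<^sub>m X'"] g W by simp
  have n3: "(\<one>\<^sub>m W \<boxdot> (\<one>\<^sub>m P \<boxdot> t)) \<cdot> \<Phi> W P X' = \<Phi> W P X \<cdot> (\<one>\<^sub>m (W \<boxtimes> P) \<boxdot> t)"
    using asc_nat[of "\<one>\<^sub>m W" "\<one>\<^sub>m P" t] t W by simp
  have n4: "(\<one>\<^sub>m (W \<boxtimes> P) \<boxdot> t) \<cdot> \<sigma> X' (W \<boxtimes> P) = \<sigma> X (W \<boxtimes> P) \<cdot> (t \<boxdot> \<one>\<^sub>m (W \<boxtimes> P))"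
    using t W by (intro partial_flip_nat_left) auto
  have n5: "(t \<boxdot> \<one>\<^sub>m (W \<boxtimes> P)) \<cdot> (\<one>\<^sub>m X' \<boxdot> h) = (\<one>\<^sub>m X \<boxdot> h) \<cdot> (t \<boxdot> \<one>\<^sub>m (P' \<boxtimes> V))"
    using t W h V by simp
  have n6: "(t \<boxdot> \<one>\<^sub>m (P' \<boxtimes> V)) \<cdot> \<Phi> X' P' V = \<Phi> X P' V \<cdot> ((t \<boxdot> \<one>\<^sub>m P') \<boxdot> \<one>\<^sub>m V)"
    using asc_nat[of t "\<one>\<^sub>m P'" "\<one>\<^sub>m V"] t V by simp
  have n7: "\<Phi> X P' V \<cdot> ((\<one>\<^sub>m X \<boxdot> g) \<boxdot> \<one>\<^sub>m V) = (\<one>\<^sub>m X \<boxdot> (g \<boxdot> \<one>\<^sub>m V)) \<cdot> \<Phi> X P V"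
    using asc_nat[of "\<one>\<^sub>m X" g "\<one>\<^sub>m V"] g V by simp
  have left: "(\<one>\<^sub>m W \<boxdot> ev') \<cdot> \<Phi> W P' X' \<cdot> \<sigma> X' (W \<boxtimes> P') \<cdot> (\<one>\<^sub>m X' \<boxdot> (\<one>\<^sub>m W \<boxdot> g))
      = (\<one>\<^sub>m W \<boxdot> ev) \<cdot> \<Phi> W P X \<cdot> \<sigma> X (W \<boxtimes> P) \<cdot> (t \<boxdot> \<one>\<^sub>m (W \<boxtimes> P))"
  proof -
    have "(\<one>\<^sub>m W \<boxdot> ev') \<cdot> \<Phi> W P' X' \<cdot> \<sigma> X' (W \<boxtimes> P') \<cdot> (\<one>\<^sub>m X' \<boxdot> (\<one>\<^sub>m W \<boxdot> g))
        = (\<one>\<^sub>m W \<boxdot> ev') \<cdot> (\<Phi> W P' X' \<cdot> ((\<one>\<^sub>m W \<boxdot> g) \<boxdot> \<one>\<^sub>m X')) \<cdot> \<sigma> X' (W \<boxtimes> P)"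
      unfolding n1 using g W by simp
    also have "\<dots> = (\<one>\<^sub>m W \<boxdot> (ev' \<cdot> (g \<boxdot> \<one>\<^sub>m X'))) \<cdot> \<Phi> W P X' \<cdot> \<sigma> X' (W \<boxtimes> P)"
      unfolding n2 using g W by simp
    also have "\<dots> = (\<one>\<^sub>m W \<boxdot> ev) \<cdot> ((\<one>\<^sub>m W \<boxdot> (\<one>\<^sub>m P \<boxdot> t)) \<cdot> \<Phi> W P X') \<cdot> \<sigma> X' (W \<boxtimes> P)"
      unfolding t_ev[symmetric] using t W by simp
    also have "\<dots> = (\<one>\<^sub>m W \<boxdot> ev) \<cdot> \<Phi> W P X \<cdot> ((\<one>\<^sub>m (W \<boxtimes> P) \<boxdot> t) \<cdot> \<sigma> X' (W \<boxtimes> P))"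
      unfolding n3 using t W by simp
    finally show ?thesis unfolding n4 .
  qed
  have right: "(t \<boxdot> \<one>\<^sub>m (W \<boxtimes> P)) \<cdot> (\<one>\<^sub>m X' \<boxdot> h) \<cdot> \<Phi> X' P' V \<cdot> (db' \<boxdot> \<one>\<^sub>m V)
      = (\<one>\<^sub>m X \<boxdot> (h \<cdot> (g \<boxdot> \<one>\<^sub>m V))) \<cdot> \<Phi> X P V \<cdot> (db \<boxdot> \<one>\<^sub>m V)"
  proof -
    have "(t \<boxdot> \<one>\<^sub>m (W \<boxtimes> P)) \<cdot> (\<one>\<^sub>m X' \<boxdot> h) \<cdot> \<Phi> X' P' V \<cdot> (db' \<boxdot> \<one>\<^sub>m V)
        = ((\<one>\<^sub>m X \<boxdot> h) \<cdot> (t \<boxdot> \<one>\<^sub>m (P' \<boxtimes> V))) \<cdot> \<Phi> X' P' V \<cdot> (db' \<boxdot> \<one>\<^sub>m V)"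
      using t h V W by (intro cmp_extend n5) auto
    also have "\<dots> = (\<one>\<^sub>m X \<boxdot> h) \<cdot> ((t \<boxdot> \<one>\<^sub>m (P' \<boxtimes> V)) \<cdot> \<Phi> X' P' V) \<cdot> (db' \<boxdot> \<one>\<^sub>m V)"
      using t h V W by (simp del: interchange interchange_assoc)
    also have "\<dots> = (\<one>\<^sub>m X \<boxdot> h) \<cdot> \<Phi> X P' V \<cdot> (((t \<boxdot> \<one>\<^sub>m P') \<cdot> db') \<boxdot> \<one>\<^sub>m V)"
      unfolding n6 using t h V W by simp
    also have "\<dots> = (\<one>\<^sub>m X \<boxdot> h) \<cdot> (\<Phi> X P' V \<cdot> ((\<one>\<^sub>m X \<boxdot> g) \<boxdot> \<one>\<^sub>m V)) \<cdot> (db \<boxdot> \<one>\<^sub>m V)"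
      unfolding t_db using g h V W by simp
    also have "\<dots> = (\<one>\<^sub>m X \<boxdot> (h \<cdot> (g \<boxdot> \<one>\<^sub>m V))) \<cdot> \<Phi> X P V \<cdot> (db \<boxdot> \<one>\<^sub>m V)"
      unfolding n7 using g h V W by simp
    finally show ?thesis .
  qed
  let ?r = "(\<one>\<^sub>m X' \<boxdot> h) \<cdot> \<Phi> X' P' V \<cdot> (db' \<boxdot> \<one>\<^sub>m V)"
  have r: "\<guillemotleft>?r : V \<rightarrow> X' \<boxtimes> (W \<boxtimes> P)\<guillemotright>" using h V W by simp
  have "\<Theta> P' X' ev' db' V W ((\<one>\<^sub>m W \<boxdot> g) \<cdot> h)
      = ((\<one>\<^sub>m W \<boxdot> ev') \<cdot> \<Phi> W P' X' \<cdot> \<sigma> X' (W \<boxtimes> P') \<cdot> (\<one>\<^sub>m X' \<boxdot> (\<one>\<^sub>m W \<boxdot> g))) \<cdot> ?r"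
    unfolding flip_trace_def using g h V W by simp
  also have "\<dots> = (\<one>\<^sub>m W \<boxdot> ev) \<cdot> \<Phi> W P X \<cdot> \<sigma> X (W \<boxtimes> P) \<cdot> (t \<boxdot> \<one>\<^sub>m (W \<boxtimes> P)) \<cdot> ?r"
    unfolding left using r t g h V W by (simp del: interchange interchange_assoc)
  also have "\<dots> = \<Theta> P X ev db V W (h \<cdot> (g \<boxdot> \<one>\<^sub>m V))"
    unfolding right flip_trace_def ..
  finally show ?thesis by simp
qed

section \<open>Naturality of the Frobenius--Schur endomorphisms\<close>

lemma FS_eq_flip_trace:
  assumes V: "V \<in> Obj C" and ch: "FS_choice C (Suc m) V X ev db T \<iota> \<pi>"
  shows "FS C (Suc m) V X ev db T \<iota> \<pi> = \<Theta> (tensor_word (replicate m V)) X ev db V V (snoc_asc (replicate m V) V)"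
    and "left_dual C X (tensor_word (replicate m V)) ev db"
proof -
  let ?P = "tensor_word (replicate m V)"
  show d: "left_dual C X ?P ev db"
    using ch unfolding FS_choice_def right_dual_def by (simp add: tpow_eq_tensor_word)
  have tc: "trivial_component C (V \<boxtimes> ?P) T \<iota> \<pi>"
    using ch unfolding FS_choice_def by (simp add: tpow_eq_tensor_word)
  note D [simp] = left_dualD(1-4)[OF d]
  note tr = trivial_component_partial_flip[OF tc, of X]
  have \<iota>: "\<guillemotleft>\<iota> : T \<rightarrow> V \<boxtimes> ?P\<guillemotright>" and \<pi>: "\<guillemotleft>\<pi> : V \<boxtimes> ?P \<rightarrow> T\<guillemotright>" and T: "trivial_obj C T"
    using tr V by auto
  let ?s = "snoc_asc (replicate m V) V"
  have s: "\<guillemotleft>?s : ?P \<boxtimes> V \<rightarrow> V \<boxtimes> ?P\<guillemotright>"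
    using V by (simp add: replicate_append_same)
  let ?r = "(\<one>\<^sub>m X \<boxdot> ?s) \<cdot> \<Phi> X ?P V \<cdot> (db \<boxdot> \<one>\<^sub>m V)"
  have r: "\<guillemotleft>?r : V \<rightarrow> X \<boxtimes> (V \<boxtimes> ?P)\<guillemotright>" using s V by simp
  note t = tau_eq_partial_flip[OF D(3) T]
  have "FS C (Suc m) V X ev db T \<iota> \<pi> =
      (\<one>\<^sub>m V \<boxdot> ev) \<cdot> \<Phi> V ?P X \<cdot> (\<iota> \<boxdot> \<one>\<^sub>m X) \<cdot> tau C X T \<cdot> (\<one>\<^sub>m X \<boxdot> \<pi>) \<cdot> ?r"
    unfolding FS_def Let_def t using \<iota> \<pi> s V
    by (simp add: tpow_eq_tensor_word asc_pow_snoc_asc del: interchange interchange_assoc)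
  also have "\<dots> = (\<one>\<^sub>m V \<boxdot> ev) \<cdot> \<Phi> V ?P X \<cdot> ((\<iota> \<boxdot> \<one>\<^sub>m X) \<cdot> tau C X T \<cdot> (\<one>\<^sub>m X \<boxdot> \<pi>)) \<cdot> ?r"
    unfolding t using \<iota> \<pi> r V by (simp del: interchange interchange_assoc)
  finally show "FS C (Suc m) V X ev db T \<iota> \<pi> = \<Theta> ?P X ev db V V ?s"
    unfolding tr(1)[OF D(3) tob_closed[OF V D(4)]] flip_trace_def .
qed

end

context semisimple_rigid_monoidal_category
begin

text \<open>
  In \<open>H k\<close> the morphism \<open>f\<close> acts on letter \<open>k\<close>, counted from \<open>0\<close>, of the target of the associativity isomorphism
  for the word \<open>W\<^sup>k V\<^sup>m\<^sup>-\<^sup>k\<close>. For \<open>k < m\<close> it may act on the same letter of the source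
  instead, as a morphism \<open>g\<close> from that word to the next one; then \<open>flip_trace_slide\<close> moves \<open>g\<close> to
  the target, where one letter \<open>W\<close> in front shifts \<open>f\<close> to letter \<open>k + 1\<close>.
\<close>

lemma flip_trace_word_chain:
  fixes m :: nat
  assumes f: "\<guillemotleft>f : V \<rightarrow> W\<guillemotright>"
  defines "word \<equiv> \<lambda>k. replicate k W @ replicate (m - k) V"
  defines "H \<equiv> \<lambda>k. whisker (replicate k W) (f \<boxdot> \<one>\<^sub>m (tensor_word (replicate (m - k) V))) \<cdot> snoc_asc (word k) V"
  shows "\<lbrakk>k \<le> m; left_dual C X (tensor_word (word 0)) ev db; left_dual C X' (tensor_word (word k)) ev' db'\<rbrakk> \<Longrightarrow>
    \<Theta> (tensor_word (word 0)) X ev db V W (H 0) = \<Theta> (tensor_word (word k)) X' ev' db' V W (H k)"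
proof (induction k arbitrary: X' ev' db')
  case 0
  have w: "\<guillemotleft>H 0 : tensor_word (word 0) \<boxtimes> V \<rightarrow> W \<boxtimes> tensor_word (word 0)\<guillemotright>"
    unfolding H_def word_def using f by (simp add: replicate_append_same)
  \<comment> \<open>Only the dual may differ, and sliding the identity compares the two choices.\<close>
  then show ?case
    using flip_trace_slide[OF 0(2,3), of "\<one>\<^sub>m (tensor_word (word 0))" "H 0" V W] f left_dualD(4)[OF 0(2)] by simp
next
  case (Suc k)
  define r where "r = m - Suc k"
  have mk: "m - k = Suc r" using Suc.prems(1) unfolding r_def by simp
  have wk: "word k = replicate k W @ (V # replicate r V)" unfolding word_def mk by simp
  have wk': "word (Suc k) = replicate k W @ (W # replicate r V)"
    unfolding word_def r_def by (simp add: replicate_app_Cons_same)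
  have V: "V \<in> Obj C" and W: "W \<in> Obj C" using f by auto
  have sets: "set (replicate k W) \<subseteq> Obj C" "set (replicate r V) \<subseteq> Obj C"
    "set (word k) \<subseteq> Obj C" "set (word (Suc k)) \<subseteq> Obj C"
    unfolding word_def using V W by auto
  define g where "g = whisker (replicate k W) (f \<boxdot> \<one>\<^sub>m (tensor_word (replicate r V)))"
  have g: "\<guillemotleft>g : tensor_word (word k) \<rightarrow> tensor_word (word (Suc k))\<guillemotright>"
    using whisker_mor[OF sets(1), of "f \<boxdot> \<one>\<^sub>m (tensor_word (replicate r V))" "V # replicate r V" "W # replicate r V"]
      f sets V W unfolding g_def wk wk' by simp
  have end_word: "word (Suc k) @ [V] = W # word k"
    unfolding word_def mk r_def[symmetric] by (simp add: replicate_append_same)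
  have s: "\<guillemotleft>snoc_asc (word (Suc k)) V : tensor_word (word (Suc k)) \<boxtimes> V \<rightarrow> W \<boxtimes> tensor_word (word k)\<guillemotright>"
    using snoc_asc_mor[OF sets(4) V] sets V W unfolding end_word by simp
  \<comment> \<open>Letter \<open>k\<close> is not the last one, so \<open>f\<close> may act before the associativity isomorphism.\<close>
  have Hk: "H k = snoc_asc (word (Suc k)) V \<cdot> (g \<boxdot> \<one>\<^sub>m V)"
  proof -
    have "snoc_asc (replicate k W @ (W # replicate r V)) V \<cdot> (g \<boxdot> \<one>\<^sub>m V)
        = whisker (replicate k W) (f \<boxdot> \<one>\<^sub>m (tensor_word (replicate r V @ [V]))) \<cdot> snoc_asc (replicate k W @ (V # replicate r V)) V"
      unfolding g_def using f sets V W snoc_asc_head[OF f sets(2) V] by (intro snoc_asc_whisker) auto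
    then show ?thesis unfolding H_def wk wk' mk by (simp add: replicate_append_same)
  qed
  have HSk: "H (Suc k) = (\<one>\<^sub>m W \<boxdot> g) \<cdot> snoc_asc (word (Suc k)) V"
    unfolding H_def g_def r_def by simp
  obtain Y e d where d: "left_dual C Y (tensor_word (word k)) e d"
    using ex_right_dual[OF tensor_word_obj[OF sets(3)]] unfolding right_dual_def by blast
  have "\<Theta> (tensor_word (word 0)) X ev db V W (H 0) = \<Theta> (tensor_word (word k)) Y e d V W (H k)"
    using Suc.prems d by (intro Suc.IH) auto
  also have "\<dots> = \<Theta> (tensor_word (word (Suc k))) X' ev' db' V W (H (Suc k))"
    unfolding Hk HSk using flip_trace_slide[OF d Suc.prems(3) g s V W] .
  finally show ?case .
qed

text \<open>
  The two ends of the chain: for \<open>k = 0\<close> the morphism \<open>f\<close> acts on the first letter of the target,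
  which is the output of the trace; for \<open>k = m\<close> it acts on the last letter, and so comes from
  the input.
\<close>

theorem FS_natural:
  assumes f: "\<guillemotleft>f : V \<rightarrow> W\<guillemotright>"
    and chV: "FS_choice C (Suc m) V X ev db T \<iota> \<pi>" and chW: "FS_choice C (Suc m) W X' ev' db' T' \<iota>' \<pi>'"
  shows "\<guillemotleft>FS C (Suc m) V X ev db T \<iota> \<pi> : V \<rightarrow> V\<guillemotright>" "\<guillemotleft>FS C (Suc m) W X' ev' db' T' \<iota>' \<pi>' : W \<rightarrow> W\<guillemotright>"
    "f \<cdot> FS C (Suc m) V X ev db T \<iota> \<pi> = FS C (Suc m) W X' ev' db' T' \<iota>' \<pi>' \<cdot> f"
proof -
  have V: "V \<in> Obj C" and W: "W \<in> Obj C" using f by auto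
  note FV = FS_eq_flip_trace[OF V chV] and FW = FS_eq_flip_trace[OF W chW]
  have s: "\<guillemotleft>snoc_asc (replicate m A) A : tensor_word (replicate m A) \<boxtimes> A \<rightarrow> A \<boxtimes> tensor_word (replicate m A)\<guillemotright>"
    if "A \<in> Obj C" for A
    using that by (simp add: replicate_append_same)
  show "\<guillemotleft>FS C (Suc m) V X ev db T \<iota> \<pi> : V \<rightarrow> V\<guillemotright>" "\<guillemotleft>FS C (Suc m) W X' ev' db' T' \<iota>' \<pi>' : W \<rightarrow> W\<guillemotright>"
    unfolding FV(1) FW(1) using flip_trace_mor[OF FV(2) s[OF V] V V] flip_trace_mor[OF FW(2) s[OF W] W W] by auto
  have "f \<cdot> FS C (Suc m) V X ev db T \<iota> \<pi>
      = \<Theta> (tensor_word (replicate m V)) X ev db V W ((f \<boxdot> \<one>\<^sub>m (tensor_word (replicate m V))) \<cdot> snoc_asc (replicate m V) V)"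
    unfolding FV(1) using s[OF V] V f by (intro flip_trace_post[OF FV(2)]) auto
  also have "\<dots> = \<Theta> (tensor_word (replicate m W)) X' ev' db' V W (whisker (replicate m W) f \<cdot> snoc_asc (replicate m W) V)"
    using flip_trace_word_chain[OF f, of m m X ev db X' ev' db'] FV(2) FW(2) f by simp
  also have "\<dots> = \<Theta> (tensor_word (replicate m W)) X' ev' db' V W (snoc_asc (replicate m W) W \<cdot> (\<one>\<^sub>m (tensor_word (replicate m W)) \<boxdot> f))"
    using snoc_asc_last[OF f, of "replicate m W"] W by auto
  also have "\<dots> = FS C (Suc m) W X' ev' db' T' \<iota>' \<pi>' \<cdot> f"
    unfolding FW(1) using s[OF W] W f by (intro flip_trace_pre[OF FW(2), symmetric]) auto
  finally show "f \<cdot> FS C (Suc m) V X ev db T \<iota> \<pi> = FS C (Suc m) W X' ev' db' T' \<iota>' \<pi>' \<cdot> f" .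
qed

end

theorem proposition7p7:
  fixes K :: "('k, 'a) ring_scheme" and C :: "('o, 'm, 'k) lin_tensor_cat"
    and n :: nat and V W X\<^sub>V X\<^sub>W T\<^sub>V T\<^sub>W :: 'o
    and f ev\<^sub>V ev\<^sub>W db\<^sub>V db\<^sub>W \<iota>\<^sub>V \<iota>\<^sub>W \<pi>\<^sub>V \<pi>\<^sub>W :: 'm
  assumes "semisimple_rigid_monoidal_category K C" and "n \<ge> 1"
    and "V \<in> Obj C" and "W \<in> Obj C" and "f \<in> carrier (Mor C V W)"
    and "FS_choice C n V X\<^sub>V ev\<^sub>V db\<^sub>V T\<^sub>V \<iota>\<^sub>V \<pi>\<^sub>V"
    and "FS_choice C n W X\<^sub>W ev\<^sub>W db\<^sub>W T\<^sub>W \<iota>\<^sub>W \<pi>\<^sub>W"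
  shows "FS C n V X\<^sub>V ev\<^sub>V db\<^sub>V T\<^sub>V \<iota>\<^sub>V \<pi>\<^sub>V \<in> carrier (Mor C V V) \<and>
      FS C n W X\<^sub>W ev\<^sub>W db\<^sub>W T\<^sub>W \<iota>\<^sub>W \<pi>\<^sub>W \<in> carrier (Mor C W W) \<and>
      f \<cdot>\<^bsub>C\<^esub> FS C n V X\<^sub>V ev\<^sub>V db\<^sub>V T\<^sub>V \<iota>\<^sub>V \<pi>\<^sub>V = FS C n W X\<^sub>W ev\<^sub>W db\<^sub>W T\<^sub>W \<iota>\<^sub>W \<pi>\<^sub>W \<cdot>\<^bsub>C\<^esub> f"
proof -
  interpret semisimple_rigid_monoidal_category K C by fact
  obtain m where n: "n = Suc m" using \<open>n \<ge> 1\<close> by (cases n) auto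
  have f: "\<guillemotleft>f : V \<rightarrow> W\<guillemotright>" using assms(3-5) by simp
  show ?thesis
    using FS_natural[OF f assms(6,7)[unfolded n]] assms(3,4) unfolding n by simp
qed

end
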